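(* Let $\nu$ be a probability measure on $\mathfrak N$ absolutely continuous with respect to $\pi$ with $L=d\nu/d\pi$, and assume $L\log L\in L^1(\pi)$ and $\log L\in L^r(\pi)$ for some $r>1$. Then there exists a sequence $(\dot y_n)_{n\ge1}$ of elements of $\mathcal P^{++}_{\infty,\mathrm{pc}}(\mathcal N,\pi)$ such that, with $L_n=d(\mathbf Y_n^\#\pi)/d\pi$, $$L_n\log L_n\xrightarrow[n\to\infty]{L^1(\pi)}L\log L\quad\text{and}\quad L_n\log L\xrightarrow[n\to\infty]{L^1(\pi)}L\log L.$$
   Context: $\mathfrak N$ denotes the set of locally finite simple configurations on $(0,\infty)$, identified with counting paths; $N$ is the canonical process, $\mathcal N_t=\sigma(N(s),s\le t)$, and $\pi$ is the unit rate Poisson law. $\mathcal P^{++}_{\infty,\mathrm{pc}}(\mathcal N,\pi)$ is the set of positive $\mathcal N$-predictable processes $\dot y$, piecewise constant in time, for which there are $\varepsilon\in(0,1)$ and $T>0$ with $\varepsilon\le\dot y(s)\le1/\varepsilon$ for all $s$ and $\dot y(s)=1$ for $s\ge T$, $\pi$-a.s. For such $\dot y_n$, $y_n(t)=\int_0^t\dot y_n(s)ds$, $y_n^*$ is its inverse, and $\mathbf Y_n:\mathfrak N\to\mathfrak N$ maps $N$ to $t\mapsto N(y_n^*(N,t))$; $\mathbf Y_n^\#\pi$ is the image measure. *)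

theory Defs
  imports "HOL-Probability.Probability"
begin

type_synonym path = "real \<Rightarrow> nat"

text \<open>Locally finite simple configurations on (0,inf), as counting paths:
  N(t) = number of points in (0,t]; N(t) = 0 for t <= 0, nondecreasing,
  right-continuous, jumps of size at most 1 (simple).\<close>
definition Nfrak :: "path set" where
  "Nfrak = {\<omega>. (\<forall>t\<le>0. \<omega> t = 0) \<and> mono \<omega>
      \<and> (\<forall>t. \<exists>s>t. \<omega> s = \<omega> t)
      \<and> (\<forall>t>0. \<exists>s<t. \<omega> t \<le> Suc (\<omega> s))}"

definition Nspace :: "path measure" where
  "Nspace = sigma Nfrak {{\<omega>\<in>Nfrak. \<omega> u = k} | u k. True}"

definition Fil :: "real \<Rightarrow> path measure" where
  "Fil s = sigma Nfrak {{\<omega>\<in>Nfrak. \<omega> u = k} | u k. u \<le> s}"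

definition Pred :: "(real \<times> path) measure" where
  "Pred = sigma ({0<..} \<times> Nfrak)
     {{s<..t} \<times> A | s t A. 0 \<le> s \<and> s < t \<and> A \<in> sets (Fil s)}"

definition is_poisson_law :: "path measure \<Rightarrow> bool" where
  "is_poisson_law M \<longleftrightarrow> sets M = sets Nspace \<and> prob_space M \<and>
     (\<forall>(n::nat) (t::nat \<Rightarrow> real) (k::nat \<Rightarrow> nat).
        t 0 = 0 \<longrightarrow> (\<forall>i<n. t i < t (Suc i)) \<longrightarrow>
        measure M {\<omega>\<in>Nfrak. \<forall>i<n. \<omega> (t (Suc i)) - \<omega> (t i) = k i}
          = (\<Prod>i<n. pmf (poisson_pmf (t (Suc i) - t i)) (k i)))"

definition pi_law :: "path measure" where
  "pi_law = (THE M. is_poisson_law M)"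

definition piecewise_const :: "(real \<Rightarrow> real) \<Rightarrow> bool" where
  "piecewise_const f \<longleftrightarrow> (\<exists>D. finite D \<and>
     (\<forall>s t. 0 < s \<longrightarrow> s < t \<longrightarrow> {s..t} \<inter> D = {} \<longrightarrow> f s = f t))"

definition Ppp :: "(path \<Rightarrow> real \<Rightarrow> real) \<Rightarrow> bool" where
  "Ppp ydot \<longleftrightarrow>
     (\<lambda>(s,\<omega>). ydot \<omega> s) \<in> borel_measurable Pred \<and>
     (AE \<omega> in pi_law. piecewise_const (ydot \<omega>)) \<and>
     (\<exists>\<epsilon> T. 0 < \<epsilon> \<and> \<epsilon> < 1 \<and> 0 < T \<and>
        (AE \<omega> in pi_law. \<forall>s>0. \<epsilon> \<le> ydot \<omega> s \<and> ydot \<omega> s \<le> 1 / \<epsilon>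
                                 \<and> (T \<le> s \<longrightarrow> ydot \<omega> s = 1)))"

definition yfun :: "(path \<Rightarrow> real \<Rightarrow> real) \<Rightarrow> path \<Rightarrow> real \<Rightarrow> real" where
  "yfun ydot \<omega> t = integral {0..t} (ydot \<omega>)"

definition ystar :: "(path \<Rightarrow> real \<Rightarrow> real) \<Rightarrow> path \<Rightarrow> real \<Rightarrow> real" where
  "ystar ydot \<omega> t = (THE u. 0 \<le> u \<and> yfun ydot \<omega> u = t)"

definition Ymap :: "(path \<Rightarrow> real \<Rightarrow> real) \<Rightarrow> path \<Rightarrow> path" where
  "Ymap ydot \<omega> = (\<lambda>t. if t \<le> 0 then 0 else \<omega> (ystar ydot \<omega> t))"

definition dens :: "path measure \<Rightarrow> path measure \<Rightarrow> path \<Rightarrow> real" where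
  "dens M N \<omega> = enn2real (RN_deriv M N \<omega>)"

end

theory Submission
  imports Defs
begin

text \<open>Cut time into cells of length \<open>\<delta>\<close> and let \<open>lam\<close> be a positive function of the bits that record
  which of the earlier cells are occupied. The time change that maps a source cell of length
  \<open>lam \<beta> * \<delta>\<close> linearly onto the next image cell is predictable, and for each of the finitely many
  bit strings \<open>\<beta>\<close> it agrees, on the event that the image has bits \<open>\<beta>\<close>, with a deterministic
  piecewise linear time change. So no strong Markov property is needed: summing the deterministic
  laws over \<open>\<beta>\<close> shows that the image law has density \<open>\<Prod>\<^sub>j lam\<^sub>j ^ \<Delta>N\<^sub>j * exp (- (lam\<^sub>j - 1) * \<delta>)\<close>.

  Given a density that is a function of finitely many bits, let \<open>lam\<close> be the ratio between the
  conditional expectations of the density given the next bit set and given the past alone.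
  When the mesh tends to zero on a fixed horizon \<open>T\<close>, the density above converges pointwise to the
  target and stays below \<open>exp (a * N T + b)\<close>. All exponential moments of \<open>N T\<close> are finite and
  \<open>log L \<in> L\<^sup>r\<close>, so dominated convergence applies to both quantities in question. Bit functions
  approximate bounded densities in \<open>L\<^sup>1\<close>, and truncation reduces \<open>L\<close> to a bounded density.\<close>

section \<open>Uniqueness of the Poisson law\<close>

text \<open>The direction of the time change shapes the construction: image cells have the fixed
  length \<delta> while source cells stretch, so the image acquires intensity \<open>lam\<close> and
  the rate \<open>ydot\<close> is the reciprocal of \<open>lam\<close>. Occupation bits replace
  counts because then only finitely many histories exist, and a bit function with values between c
  and C gives ratios bounded by \<open>C / c\<close> at every mesh; this yields bounds on the
  logarithm of the density that are uniform in the mesh. The price is that the density of the image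
  depends on counts while the target depends on bits. For a fixed path and a fixed horizon the two
  agree once no cell holds two points. The remaining error is of first order in the mesh at each
  point and of second order on each empty cell, so its sum vanishes. The exponent \<open>r\<close>
  enters through its conjugate \<open>r / (r - 1)\<close>: the product of an approximating density
  with log L is dominated by an exponential moment of the count plus the r-th power of log L.
  Finally, \<open>pi_law\<close> is a definite description, so the Poisson law has to be constructed
  and shown to be unique before anything can be said about it.\<close>

lemma NfrakD:
  assumes "\<omega> \<in> Nfrak"
  shows Nfrak_nonpos: "t \<le> 0 \<Longrightarrow> \<omega> t = 0"
    and Nfrak_mono: "s \<le> t \<Longrightarrow> \<omega> s \<le> \<omega> t"
    and Nfrak_right: "\<exists>s>t. \<omega> s = \<omega> t"
    and Nfrak_jump: "0 < t \<Longrightarrow> \<exists>s<t. \<omega> t \<le> Suc (\<omega> s)"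
  using assms by (auto simp: Nfrak_def mono_def)

lemma space_Nspace [simp]: "space Nspace = Nfrak"
  unfolding Nspace_def by (rule space_measure_of) auto

lemma sets_Nspace: "sets Nspace = sigma_sets Nfrak {{\<omega>\<in>Nfrak. \<omega> u = k} | u k. True}"
  unfolding Nspace_def by (rule sets_measure_of) auto

lemma measurable_eval [measurable]: "(\<lambda>\<omega>. \<omega> u) \<in> Nspace \<rightarrow>\<^sub>M count_space (UNIV :: nat set)"
proof (subst measurable_count_space_eq2_countable)
  show "(\<lambda>\<omega>. \<omega> u) \<in> space Nspace \<rightarrow> UNIV \<and>
    (\<forall>a\<in>UNIV. (\<lambda>\<omega>. \<omega> u) -` {a} \<inter> space Nspace \<in> sets Nspace)"
  proof (intro conjI ballI)
    fix a :: nat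
    have "(\<lambda>\<omega>. \<omega> u) -` {a} \<inter> space Nspace = {\<omega>\<in>Nfrak. \<omega> u = a}" by auto
    then show "(\<lambda>\<omega>. \<omega> u) -` {a} \<inter> space Nspace \<in> sets Nspace"
      unfolding sets_Nspace by (auto intro!: sigma_sets.Basic)
  qed auto
qed

lemma measurable_into_Nspace:
  assumes "\<And>x. x \<in> space M \<Longrightarrow> f x \<in> Nfrak"
    and "\<And>u. (\<lambda>x. f x u) \<in> M \<rightarrow>\<^sub>M count_space (UNIV :: nat set)"
  shows "f \<in> M \<rightarrow>\<^sub>M Nspace"
  unfolding Nspace_def
proof (rule measurable_measure_of)
  fix A assume "A \<in> {{\<omega>\<in>Nfrak. \<omega> u = k} | u k. True}"
  then obtain u k where A: "A = {\<omega>\<in>Nfrak. \<omega> u = k}" by auto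
  have "f -` A \<inter> space M = (\<lambda>x. f x u) -` {k} \<inter> space M"
    using assms(1) by (auto simp: A)
  then show "f -` A \<inter> space M \<in> sets M"
    using measurable_sets[OF assms(2), of "{k}"] by auto
qed (use assms(1) in auto)

definition incr_event :: "nat \<Rightarrow> (nat \<Rightarrow> real) \<Rightarrow> (nat \<Rightarrow> nat) \<Rightarrow> path set" where
  "incr_event n t k = {\<omega>\<in>Nfrak. \<forall>i<n. \<omega> (t (Suc i)) - \<omega> (t i) = k i}"

lemma incr_event_sets [measurable]: "incr_event n t k \<in> sets Nspace"
proof -
  have "incr_event n t k = {\<omega>\<in>space Nspace. \<forall>i<n. \<omega> (t (Suc i)) - \<omega> (t i) = k i}"
    by (simp add: incr_event_def)
  also have "\<dots> \<in> sets Nspace" by measurable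
  finally show ?thesis .
qed

text \<open>Cylinders in terms of values are closed under intersection up to the empty set, whereas
  the law prescribes probabilities of increments; both descriptions are needed. Only the values of
  \<kappa> on \<open>F\<close> matter.\<close>

definition cyl :: "real set \<Rightarrow> path \<Rightarrow> path set" where
  "cyl F \<kappa> = {\<omega>\<in>Nfrak. \<forall>u\<in>F. \<omega> u = \<kappa> u}"

text \<open>Sorting \<open>F\<close> gives the grid, and since paths vanish at 0 the increments
  determine the values. Nonemptiness forces \<kappa> to be nondecreasing along \<open>F\<close>;
  otherwise truncated subtraction could turn an empty cylinder into a nonempty increment
  event.\<close>

lemma cyl_as_incr_event:
  assumes F: "finite F" "0 \<in> F" "F \<subseteq> {0..}" and ne: "cyl F \<kappa> \<noteq> {}"
  obtains n t k where "t 0 = 0" "\<forall>i<n. t i < t (Suc i)" "F = t ` {..n}" "cyl F \<kappa> = incr_event n t k"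
proof -
  define xs where "xs = sorted_list_of_set F"
  have xs: "sorted xs" "distinct xs" "set xs = F" using F by (auto simp: xs_def)
  then have len: "length xs > 0" using F by auto
  define n where "n = length xs - 1"
  have n: "length xs = Suc n" using len by (simp add: n_def)
  define t where "t i = xs ! i" for i
  have F_eq: "F = t ` {..n}"
    using xs(3) n by (auto simp: t_def in_set_conv_nth less_Suc_eq_le image_iff)
  have inc: "t i < t (Suc i)" if "i < n" for i
    using xs(1,2) that n
    by (metis Suc_mono lessI less_SucI sorted_wrt_nth_less strict_sorted_iff t_def)
  have t0: "t 0 = 0"
  proof -
    obtain j where j: "j \<le> n" "t j = 0" using F(2) F_eq by auto
    have "t 0 \<le> t j" using sorted_nth_mono[OF xs(1), of 0 j] n j by (simp add: t_def)
    moreover have "t 0 \<ge> 0" using F(3) F_eq by auto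
    ultimately show ?thesis using j by simp
  qed
  define k where "k i = \<kappa> (t (Suc i)) - \<kappa> (t i)" for i
  obtain \<omega>0 where w0: "\<omega>0 \<in> Nfrak" "\<And>u. u \<in> F \<Longrightarrow> \<omega>0 u = \<kappa> u" using ne by (auto simp: cyl_def)
  have \<kappa>0: "\<kappa> 0 = 0" using w0 F(2) Nfrak_nonpos by force
  have \<kappa>m: "\<kappa> (t i) \<le> \<kappa> (t (Suc i))" if "i < n" for i
    using w0(2)[of "t i"] w0(2)[of "t (Suc i)"] that F_eq inc[OF that] Nfrak_mono[OF w0(1), of "t i" "t (Suc i)"] by auto
  have "cyl F \<kappa> = incr_event n t k"
  proof (intro set_eqI iffI)
    fix \<omega> assume "\<omega> \<in> cyl F \<kappa>"
    then show "\<omega> \<in> incr_event n t k" by (auto simp: cyl_def incr_event_def k_def F_eq)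
  next
    fix \<omega> assume w: "\<omega> \<in> incr_event n t k"
    then have wN: "\<omega> \<in> Nfrak" by (simp add: incr_event_def)
    have "\<omega> (t i) = \<kappa> (t i)" if "i \<le> n" for i
      using that
    proof (induction i)
      case 0 then show ?case using t0 \<kappa>0 Nfrak_nonpos[OF wN] by simp
    next
      case (Suc i)
      have "\<omega> (t (Suc i)) - \<omega> (t i) = \<kappa> (t (Suc i)) - \<kappa> (t i)"
        using w Suc.prems by (simp add: incr_event_def k_def)
      moreover have "\<omega> (t i) \<le> \<omega> (t (Suc i))" using inc[of i] Suc.prems Nfrak_mono[OF wN, of "t i" "t (Suc i)"] by simp
      ultimately show ?case using Suc \<kappa>m[of i] by auto
    qed
    then show "\<omega> \<in> cyl F \<kappa>" using wN by (auto simp: cyl_def F_eq)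
  qed
  then show thesis using that[of t n k] t0 inc F_eq by auto
qed

text \<open>It suffices to test grids that contain a prescribed finite set \<open>S\<close>; the one-cell time change
  below has a product density only along such grids.\<close>
lemma measure_eq_incr_eventI:
  assumes sets: "sets P = sets Nspace" "sets Q = sets Nspace"
    and fin: "finite_measure P" and S: "finite S" "S \<subseteq> {0..}"
    and eq: "\<And>n t k. t 0 = 0 \<Longrightarrow> \<forall>i<n. t i < t (Suc i) \<Longrightarrow> S \<subseteq> t ` {..n} \<Longrightarrow>
      emeasure P (incr_event n t k) = emeasure Q (incr_event n t k)"
  shows "P = Q"
proof -
  define E where "E = {cyl F \<kappa> | F \<kappa>. finite F \<and> insert 0 S \<subseteq> F \<and> F \<subseteq> {0..}}"
  define F0 where "F0 = insert 0 S"
  define K where "K F = PiE F (\<lambda>_. UNIV :: nat set)" for F :: "real set"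
  have K: "countable (K F)" if "finite F" for F
    unfolding K_def using that by (intro countable_PiE) auto
  have E_sets: "E \<subseteq> sets Nspace"
  proof
    fix A assume "A \<in> E"
    then obtain F \<kappa> where A: "A = cyl F \<kappa>" "finite F" by (auto simp: E_def)
    have "cyl F \<kappa> = {\<omega>\<in>space Nspace. \<forall>u\<in>F. \<omega> u = \<kappa> u}" by (simp add: cyl_def)
    also have "\<dots> \<in> sets Nspace" using A(2) by measurable
    finally show "A \<in> sets Nspace" using A by simp
  qed
  have Ecyl: "cyl F \<kappa> \<in> E" if "finite F" "insert 0 S \<subseteq> F" "F \<subseteq> {0..}" for F \<kappa>
    using that by (auto simp: E_def)
  \<comment> \<open>A condition on the values over \<open>F\<close> splits into cylinders indexed by
    the restrictions of paths to \<open>F\<close>, of which there are countably many for finite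
    \<open>F\<close>.\<close>
  have cover: "{\<omega>\<in>Nfrak. p \<omega>} = (\<Union>\<kappa>\<in>{\<kappa>\<in>K F. p' \<kappa>}. cyl F \<kappa>)"
    if "\<And>\<omega> \<kappa>. \<omega> \<in> cyl F \<kappa> \<Longrightarrow> p' \<kappa> = p \<omega>" for F p p'
  proof (intro set_eqI iffI)
    fix \<omega> assume w: "\<omega> \<in> {\<omega>\<in>Nfrak. p \<omega>}"
    have "restrict \<omega> F \<in> K F" by (simp add: K_def)
    moreover have "\<omega> \<in> cyl F (restrict \<omega> F)" using w by (auto simp: cyl_def)
    ultimately show "\<omega> \<in> (\<Union>\<kappa>\<in>{\<kappa>\<in>K F. p' \<kappa>}. cyl F \<kappa>)" using that w by blast
  qed (use that in \<open>auto simp: cyl_def\<close>)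
  have gen: "sigma_sets Nfrak E = sets Nspace"
  proof (rule antisym)
    show "sigma_sets Nfrak E \<subseteq> sets Nspace"
      using sets.sigma_sets_subset[OF E_sets] by simp
    have "{\<omega>\<in>Nfrak. \<omega> u = k} \<in> sigma_sets Nfrak E" for u k
    proof (cases "u \<le> 0")
      case True
      have "Nfrak \<in> sigma_sets Nfrak E" by (rule sigma_sets_top)
      moreover have "{\<omega>\<in>Nfrak. \<omega> u = k} = (if k = 0 then Nfrak else {})"
        using True by (auto simp: Nfrak_nonpos)
      ultimately show ?thesis by (auto intro: sigma_sets.Empty)
    next
      case False
      let ?F = "insert u F0"
      have "{\<omega>\<in>Nfrak. \<omega> u = k} = (\<Union>\<kappa>\<in>{\<kappa>\<in>K ?F. \<kappa> u = k}. cyl ?F \<kappa>)"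
        by (rule cover) (auto simp: cyl_def)
      also have "\<dots> \<in> sigma_sets Nfrak E"
        using False S by (intro sigma_sets_UNION countable_Collect K countable_image)
          (auto simp: F0_def intro!: sigma_sets.Basic Ecyl K countable_Collect)
      finally show ?thesis .
    qed
    then show "sets Nspace \<subseteq> sigma_sets Nfrak E"
      unfolding sets_Nspace by (intro sigma_sets_mono) auto
  qed
  have Int: "Int_stable E"
  proof (rule Int_stableI)
    fix A B assume "A \<in> E" "B \<in> E"
    then obtain F \<kappa> F' \<kappa>' where A: "A = cyl F \<kappa>" "finite F" "insert 0 S \<subseteq> F" "F \<subseteq> {0..}"
      and B: "B = cyl F' \<kappa>'" "finite F'" "insert 0 S \<subseteq> F'" "F' \<subseteq> {0..}" unfolding E_def by blast
    show "A \<inter> B \<in> E"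
    proof (cases "\<forall>u\<in>F \<inter> F'. \<kappa> u = \<kappa>' u")
      case True
      then have "A \<inter> B = cyl (F \<union> F') (\<lambda>u. if u \<in> F then \<kappa> u else \<kappa>' u)"
        by (auto simp: A B cyl_def)
      then show ?thesis using A B Ecyl[of "F \<union> F'"] by (simp add: subset_iff)
    next
      case False
      then have "A \<inter> B = {}" by (auto simp: A B cyl_def)
      \<comment> \<open>The empty set must itself be a cylinder for intersection stability. Since 0
        lies in \<open>F\<close>, prescribing the value 1 at time 0 is impossible.\<close>
      also have "{} = cyl F (\<lambda>_. 1)" using A(3) Nfrak_nonpos by (force simp: cyl_def)
      finally show ?thesis using A Ecyl by auto
    qed
  qed
  show ?thesis
  proof (rule measure_eqI_generator_eq_countable[where E = E and \<Omega> = Nfrak and A = "cyl F0 ` K F0"])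
    show "E \<subseteq> Pow Nfrak" by (auto simp: E_def cyl_def)
    show "emeasure P X = emeasure Q X" if XE: "X \<in> E" for X
    proof (cases "X = {}")
      case False
      obtain F \<kappa> where F: "X = cyl F \<kappa>" "finite F" "insert 0 S \<subseteq> F" "F \<subseteq> {0..}"
        using XE unfolding E_def by blast
      with False obtain n t k where *: "t 0 = 0" "\<forall>i<n. t i < t (Suc i)" "F = t ` {..n}"
        "cyl F \<kappa> = incr_event n t k" by (metis cyl_as_incr_event insert_subset)
      then show ?thesis using eq[of t n k] F by auto
    qed simp
    show "sets P = sigma_sets Nfrak E" "sets Q = sigma_sets Nfrak E" using sets gen by auto
    show "cyl F0 ` K F0 \<subseteq> E" using S by (auto simp: F0_def intro!: Ecyl)
    show "\<Union> (cyl F0 ` K F0) = Nfrak"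
      using cover[of F0 "\<lambda>_. True" "\<lambda>_. True"] by auto
    show "countable (cyl F0 ` K F0)" using S by (intro countable_image K) (auto simp: F0_def)
    show "emeasure P a \<noteq> \<infinity>" for a using finite_measure.emeasure_finite[OF fin, of a] by simp
  qed (rule Int)
qed

lemma is_poisson_law_unique:
  assumes "is_poisson_law P" "is_poisson_law Q"
  shows "P = Q"
proof (rule measure_eq_incr_eventI[where S = "{}"])
  show "sets P = sets Nspace" "sets Q = sets Nspace" "finite_measure P"
    using assms by (auto simp: is_poisson_law_def prob_space_def)
  fix n :: nat and t :: "nat \<Rightarrow> real" and k :: "nat \<Rightarrow> nat" assume "t 0 = 0" "\<forall>i<n. t i < t (Suc i)"
  then have "measure P (incr_event n t k) = measure Q (incr_event n t k)"
    using assms unfolding is_poisson_law_def incr_event_def by auto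
  moreover have "finite_measure P" "finite_measure Q"
    using assms by (auto simp: is_poisson_law_def prob_space_def)
  ultimately show "emeasure P (incr_event n t k) = emeasure Q (incr_event n t k)"
    by (simp add: finite_measure.emeasure_eq_measure)
qed auto

section \<open>Existence of the Poisson law\<close>

definition expo :: "real measure" where
  "expo = density lborel (exponential_density 1)"

definition SX :: "real stream measure" where "SX = stream_space expo"

lemma prob_space_expo: "prob_space expo"
  unfolding expo_def by (rule prob_space_exponential_density) simp

lemma sets_expo [measurable_cong, simp]: "sets expo = sets borel"
  by (simp add: expo_def)

lemma sets_SX [measurable_cong]: "sets SX = sets (stream_space (borel :: real measure))"
  unfolding SX_def by (rule sets_stream_space_cong) simp

lemma prob_space_SX: "prob_space SX"
  unfolding SX_def by (rule prob_space.prob_space_stream_space[OF prob_space_expo])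

lemma space_SX [simp]: "space SX = UNIV"
  using sets_eq_imp_space_eq[OF sets_SX] by (simp add: space_stream_space)

lemma nn_integral_SX:
  assumes "f \<in> borel_measurable SX"
  shows "(\<integral>\<^sup>+E. f E \<partial>SX) = (\<integral>\<^sup>+e. (\<integral>\<^sup>+E. f (e ## E) \<partial>SX) \<partial>expo)"
  using prob_space.nn_integral_stream_space[OF prob_space_expo, of f] assms by (simp add: SX_def)

lemma nn_integral_expo:
  assumes [measurable]: "f \<in> borel_measurable borel"
  shows "(\<integral>\<^sup>+e. f e \<partial>expo) = (\<integral>\<^sup>+e. ennreal (exp (-e)) * f e * indicator {0<..} e \<partial>lborel)"
proof -
  have "(\<integral>\<^sup>+e. f e \<partial>expo) = (\<integral>\<^sup>+e. ennreal (exponential_density 1 e) * f e \<partial>lborel)"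
    unfolding expo_def by (subst nn_integral_density) auto
  also have "\<dots> = (\<integral>\<^sup>+e. ennreal (exp (-e)) * f e * indicator {0<..} e \<partial>lborel)"
    using AE_lborel_singleton[of 0]
    by (intro nn_integral_cong_AE) (auto simp: exponential_density_def split: split_indicator)
  finally show ?thesis .
qed

primrec arr :: "nat \<Rightarrow> real stream \<Rightarrow> real" where
  "arr 0 E = 0"
| "arr (Suc n) E = shd E + arr n (stl E)"

lemma arr_Suc_snth: "arr (Suc n) E = arr n E + E !! n"
  by (induction n arbitrary: E) simp_all

lemma measurable_arr [measurable]: "arr n \<in> borel_measurable (stream_space borel)"
proof (induction n)
  case (Suc n)
  have "(\<lambda>E. arr n (stl E)) \<in> borel_measurable (stream_space borel)"
    by (rule measurable_compose[OF measurable_stl Suc])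
  then show ?case by simp
qed simp

text \<open>Choosing the first arrival strictly after t makes the path right-continuous. If the
  arrivals never exceed t, the value is unspecified; \<open>nonexpl\<close> excludes this.\<close>

definition cnt :: "real stream \<Rightarrow> path" where
  "cnt E t = (LEAST k. t < arr (Suc k) E)"

definition nonexpl :: "real stream \<Rightarrow> bool" where
  "nonexpl E \<longleftrightarrow> (\<forall>n. 0 < E !! n) \<and> (\<forall>m::nat. \<exists>k. real m < arr (Suc k) E)"

lemma measurable_cnt [measurable]: "(\<lambda>E. cnt E t) \<in> stream_space borel \<rightarrow>\<^sub>M count_space UNIV"
  unfolding cnt_def by measurable

lemma pred_nonexpl [measurable]: "Measurable.pred (stream_space borel) nonexpl"
  unfolding nonexpl_def by measurable

lemma nonexpl_ex: "nonexpl E \<Longrightarrow> \<exists>k. t < arr (Suc k) E"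
  unfolding nonexpl_def by (meson less_trans reals_Archimedean2)

lemma cnt_upper: "nonexpl E \<Longrightarrow> t < arr (Suc (cnt E t)) E"
  unfolding cnt_def by (rule LeastI_ex) (rule nonexpl_ex)

lemma cnt_le: "t < arr (Suc k) E \<Longrightarrow> cnt E t \<le> k"
  unfolding cnt_def by (rule Least_le)

text \<open>Renewal at the first arrival. Only the tail \<open>E\<close> has to be nonexplosive and
  \<open>e\<close> may have any sign, which is what allows the first gap to be shortened freely in
  \<open>cnt_shift\<close>.\<close>

lemma cnt_SCons:
  assumes "nonexpl E"
  shows "cnt (e ## E) t = (if t < e then 0 else Suc (cnt E (t - e)))"
proof (cases "t < e")
  case False
  obtain k where "t - e < arr (Suc k) E" using nonexpl_ex[OF assms] by blast
  then have "t < arr (Suc (Suc k)) (e ## E)" by simp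
  then have "cnt (e ## E) t = Suc (LEAST k. t < arr (Suc (Suc k)) (e ## E))"
    unfolding cnt_def using False by (intro Least_Suc[where n = "Suc k"]) auto
  also have "(\<lambda>k. t < arr (Suc (Suc k)) (e ## E)) = (\<lambda>k. t - e < arr (Suc k) E)"
    by (auto simp: fun_eq_iff)
  finally show ?thesis using False by (simp add: cnt_def)
next
  case True
  then show ?thesis using cnt_le[of t 0 "e ## E"] by simp
qed

lemma arr_strict_mono: "nonexpl E \<Longrightarrow> m < n \<Longrightarrow> arr m E < arr n E"
  by (rule lift_Suc_mono_less) (auto simp: arr_Suc_snth nonexpl_def simp del: arr.simps)

text \<open>Positive gaps make the jumps simple: if \<open>Suc k\<close> arrivals have occurred by
  t, then the k-th arrival is strictly earlier than t, and the count there is already at least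
  k.\<close>

lemma cnt_Nfrak:
  assumes E: "nonexpl E"
  shows "cnt E \<in> Nfrak"
proof -
  have mono: "cnt E s \<le> cnt E t" if "s \<le> t" for s t
    using cnt_upper[OF E, of t] that by (intro cnt_le) auto
  have "cnt E t = 0" if "t \<le> 0" for t
  proof -
    have "0 < arr (Suc 0) E" using arr_strict_mono[OF E, of 0 "Suc 0"] by simp
    then show ?thesis using cnt_le[of t 0 E] that by simp
  qed
  moreover have "\<exists>s>t. cnt E s = cnt E t" for t
  proof -
    obtain s where s: "t < s" "s < arr (Suc (cnt E t)) E" using cnt_upper[OF E, of t] dense by blast
    then show ?thesis using mono[of t s] cnt_le[OF s(2)] by (intro exI[of _ s]) auto
  qed
  moreover have "\<exists>s<t. cnt E t \<le> Suc (cnt E s)" for t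
  proof (cases "cnt E t")
    case 0
    then show ?thesis by (intro exI[of _ "t - 1"]) auto
  next
    case (Suc k)
    have "\<not> t < arr (Suc k) E" using cnt_le[of t k E] Suc by auto
    then have "arr k E < t" using arr_strict_mono[OF E, of k "Suc k"] by simp
    moreover have "k \<le> cnt E (arr k E)"
    proof (rule ccontr)
      assume "\<not> k \<le> cnt E (arr k E)"
      then have "Suc (cnt E (arr k E)) = k \<or> Suc (cnt E (arr k E)) < k" by auto
      then have "arr (Suc (cnt E (arr k E))) E \<le> arr k E"
        using arr_strict_mono[OF E, of "Suc (cnt E (arr k E))" k] by (auto simp del: arr.simps)
      then show False using cnt_upper[OF E, of "arr k E"] by simp
    qed
    ultimately show ?thesis using Suc by auto
  qed
  ultimately show ?thesis using mono by (auto simp: Nfrak_def mono_def)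
qed

text \<open>The Laplace transform at 1 of one gap is 1/2, and independence of the gaps multiplies
  these factors. The formula serves to exclude explosion.\<close>

lemma nn_integral_exp_arr: "(\<integral>\<^sup>+E. ennreal (exp (- arr n E)) \<partial>SX) = ennreal ((1/2) ^ n)"
proof (induction n)
  case 0
  then show ?case using prob_space.emeasure_space_1[OF prob_space_SX] by simp
next
  case (Suc n)
  have half: "(\<integral>\<^sup>+e. ennreal (exp (- e)) \<partial>expo) = ennreal (1/2)"
  proof -
    have "(\<integral>\<^sup>+e. ennreal (exp (- e)) \<partial>expo) = (\<integral>\<^sup>+e. ennreal (exp (-2 * e)) * indicator {0..} e \<partial>lborel)"
      using AE_lborel_singleton[of 0]
      by (subst nn_integral_expo, simp, intro nn_integral_cong_AE)
        (auto simp: ennreal_mult[symmetric] exp_add[symmetric] split: split_indicator)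
    also have "\<dots> = ennreal (0 - (- exp (-2 * 0) / 2))"
    proof (rule nn_integral_FTC_atLeast)
      show "((\<lambda>x::real. - exp (-2 * x) / 2) \<longlongrightarrow> 0) at_top" by real_asymp
    qed (auto intro!: derivative_eq_intros)
    finally show ?thesis by simp
  qed
  have "(\<integral>\<^sup>+E. ennreal (exp (- arr (Suc n) E)) \<partial>SX)
      = (\<integral>\<^sup>+e. (\<integral>\<^sup>+E. ennreal (exp (- e)) * ennreal (exp (- arr n E)) \<partial>SX) \<partial>expo)"
    by (subst nn_integral_SX) (auto simp: ennreal_mult[symmetric] exp_add[symmetric] simp del: arr.simps(2) intro!: nn_integral_cong, simp)
  also have "\<dots> = (\<integral>\<^sup>+e. ennreal (exp (- e)) * ennreal ((1/2) ^ n) \<partial>expo)"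
    by (subst nn_integral_cmult) (auto simp: Suc)
  also have "\<dots> = ennreal (1/2) * ennreal ((1/2) ^ n)"
    by (subst nn_integral_multc) (auto simp: half)
  also have "\<dots> = ennreal ((1/2) ^ Suc n)"
    by (subst ennreal_mult[symmetric]) auto
  finally show ?case .
qed

text \<open>Where all arrivals stay below m, the variable \<open>exp (m - arr (Suc k) E)\<close> is
  at least 1, so by Markov's inequality this event has probability at most
  \<open>exp m * (1/2) ^ Suc k\<close> for every k, hence 0.\<close>

lemma AE_nonexpl: "AE E in SX. nonexpl E"
proof -
  interpret prob_space SX by (rule prob_space_SX)
  have "AE e in expo. 0 < e"
    unfolding expo_def using AE_lborel_singleton[of 0]
    by (auto simp: AE_density exponential_density_def)
  then have pos: "AE E in SX. \<forall>n. 0 < E !! n"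
    using prob_space.AE_stream_all[OF prob_space_expo, of "\<lambda>e. 0 < e"]
    unfolding SX_def by (simp add: stream_all_def sset_range)
  have "AE E in SX. \<exists>k. real m < arr (Suc k) E" for m :: nat
  proof -
    define B where "B = {E. \<forall>k. arr (Suc k) E \<le> real m}"
    have [measurable]: "B \<in> sets SX"
    proof -
      have "B = {E\<in>space SX. \<forall>k. arr (Suc k) E \<le> real m}" by (simp add: B_def)
      also have "\<dots> \<in> sets SX" by measurable
      finally show ?thesis .
    qed
    have bd: "emeasure SX B \<le> ennreal (exp (real m) * (1/2) ^ Suc k)" for k
    proof -
      have "emeasure SX B = (\<integral>\<^sup>+E. indicator B E \<partial>SX)" by simp
      also have "\<dots> \<le> (\<integral>\<^sup>+E. ennreal (exp (real m)) * ennreal (exp (- arr (Suc k) E)) \<partial>SX)"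
        by (intro nn_integral_mono)
          (auto simp: B_def ennreal_mult[symmetric] exp_add[symmetric] simp del: arr.simps split: split_indicator)
      also have "\<dots> = ennreal (exp (real m)) * ennreal ((1/2) ^ Suc k)"
        by (subst nn_integral_cmult) (auto simp: nn_integral_exp_arr simp del: arr.simps power_Suc)
      finally show ?thesis by (simp add: ennreal_mult[symmetric])
    qed
    have "(\<lambda>k. exp (real m) * (1/2) ^ Suc k) \<longlonglongrightarrow> exp (real m) * 0"
      by (intro tendsto_intros LIMSEQ_Suc LIMSEQ_power_zero) auto
    then have "(\<lambda>k. ennreal (exp (real m) * (1/2) ^ Suc k)) \<longlonglongrightarrow> ennreal (exp (real m) * 0)"
      by (rule tendsto_ennrealI)
    then have "emeasure SX B \<le> ennreal (exp (real m) * 0)"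
      by (rule LIMSEQ_le_const) (use bd in auto)
    then have "B \<in> null_sets SX" by (auto simp: null_sets_def)
    then have "AE E in SX. E \<notin> B" by (rule AE_not_in)
    then show ?thesis by eventually_elim (auto simp: B_def not_le simp del: arr.simps)
  qed
  then have "AE E in SX. \<forall>m::nat. \<exists>k. real m < arr (Suc k) E" by (simp add: AE_all_countable)
  with pos show ?thesis by eventually_elim (auto simp: nonexpl_def)
qed

text \<open>The pathwise half of the memoryless property: moving the origin of time shortens the
  first gap. The probabilistic half is the factor \<open>exp (- t 1)\<close> that is split off in
  \<open>fdd_SX\<close>.\<close>

lemma cnt_shift:
  assumes "nonexpl E"
  shows "cnt ((e - d) ## E) t = cnt (e ## E) (t + d)"
  using assms by (simp add: cnt_SCons algebra_simps less_diff_eq)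

section \<open>Finite-dimensional distributions of the counting path\<close>

definition has_incr :: "nat \<Rightarrow> (nat \<Rightarrow> real) \<Rightarrow> (nat \<Rightarrow> nat) \<Rightarrow> path \<Rightarrow> bool" where
  "has_incr n t k \<omega> \<longleftrightarrow> (\<forall>i<n. \<omega> (t (Suc i)) - \<omega> (t i) = k i)"

lemma has_incr_cong:
  "(\<And>i. i < n \<Longrightarrow> \<omega> (t (Suc i)) - \<omega> (t i) = \<omega>' (t' (Suc i)) - \<omega>' (t' i)) \<Longrightarrow>
    has_incr n t k \<omega> = has_incr n t' k \<omega>'"
  by (simp add: has_incr_def)

lemma has_incr_Suc:
  "has_incr (Suc n) t k \<omega> \<longleftrightarrow> \<omega> (t 1) - \<omega> (t 0) = k 0 \<and>
    has_incr n (\<lambda>i. t (Suc i)) (\<lambda>i. k (Suc i)) \<omega>"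
  by (auto simp: has_incr_def less_Suc_eq_0_disj)

lemma has_incr_SCons_late:
  assumes E: "nonexpl E" and e: "0 < e" "t 1 < e" and t0: "t 0 = 0"
  shows "has_incr (Suc n) t k (cnt (e ## E)) \<longleftrightarrow> k 0 = 0 \<and>
    has_incr n (\<lambda>i. t (Suc i) - t 1) (\<lambda>i. k (Suc i)) (cnt ((e - t 1) ## E))"
  using e t0 unfolding has_incr_Suc
  by (simp add: cnt_shift[OF E] has_incr_def) (auto simp: cnt_SCons[OF E])

text \<open>Restarting at the first arrival removes one point from the first count and shrinks the
  first cell to length \<open>t 1 - e\<close>. The number of cells stays the same, so an induction
  that uses this step must run over the first count; \<open>case_nat\<close> keeps the left end of
  the grid at 0.\<close>

lemma has_incr_SCons_early:
  assumes E: "nonexpl E" and e: "0 < e" "e < t 1" and t0: "t 0 = 0" and t: "\<And>i. i < n \<Longrightarrow> t 1 \<le> t (Suc i)"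
    and tn: "t 1 \<le> t (Suc n)"
  shows "has_incr (Suc n) t k (cnt (e ## E)) \<longleftrightarrow> 0 < k 0 \<and>
    has_incr (Suc n) (case_nat 0 (\<lambda>i. t (Suc i) - e)) (case_nat (k 0 - 1) (\<lambda>i. k (Suc i))) (cnt E)"
proof -
  have c0: "cnt E 0 = 0" using cnt_Nfrak[OF E] by (simp add: Nfrak_nonpos)
  have c1: "cnt (e ## E) (t 1) = Suc (cnt E (t 1 - e))" "cnt (e ## E) (t 0) = 0"
    using e t0 by (auto simp: cnt_SCons[OF E])
  have "cnt (e ## E) (t (Suc i)) = Suc (cnt E (t (Suc i) - e))" if "i \<le> n" for i
    using t[of i] tn that e by (auto simp: cnt_SCons[OF E] le_less)
  then have "has_incr n (\<lambda>i. t (Suc i)) (\<lambda>i. k (Suc i)) (cnt (e ## E)) \<longleftrightarrow>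
      has_incr n (\<lambda>i. t (Suc i) - e) (\<lambda>i. k (Suc i)) (cnt E)"
    by (intro has_incr_cong) auto
  then show ?thesis unfolding has_incr_Suc using c0 c1 by auto
qed

definition pois :: "real \<Rightarrow> nat \<Rightarrow> real" where
  "pois d k = d ^ k / fact k * exp (- d)"

lemma pois_nonneg: "0 \<le> d \<Longrightarrow> 0 \<le> pois d k"
  by (simp add: pois_def)

text \<open>The convolution recursion of the Poisson weights. The exponentials combine to the
  constant \<open>exp (- d)\<close>, which leaves the integral of a power of
  \<open>d - e\<close>.\<close>

lemma nn_integral_pois_step:
  assumes "0 \<le> d"
  shows "(\<integral>\<^sup>+e. ennreal (exp (- e) * pois (d - e) m) * indicator {0..d} e \<partial>lborel) = ennreal (pois d (Suc m))"
proof -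
  have "(\<integral>\<^sup>+e. ennreal (exp (- e) * pois (d - e) m) * indicator {0..d} e \<partial>lborel)
     = (\<integral>\<^sup>+e. ennreal (exp (- d) * (d - e) ^ m / fact m) * indicator {0..d} e \<partial>lborel)"
    by (intro nn_integral_cong) (auto simp: pois_def mult_exp_exp split: split_indicator)
  also have "\<dots> = ennreal ((- exp (- d) * (d - d) ^ Suc m / fact (Suc m)) - (- exp (- d) * (d - 0) ^ Suc m / fact (Suc m)))"
  proof (rule nn_integral_FTC_Icc)
    fix x :: real
    have "((\<lambda>x. - exp (- d) * (d - x) ^ Suc m / fact (Suc m)) has_real_derivative
        - exp (- d) * (real (Suc m) * (d - x) ^ m * (- 1)) / fact (Suc m)) (at x)"
      by (rule derivative_eq_intros refl | simp)+
    also have "- exp (- d) * (real (Suc m) * (d - x) ^ m * (- 1)) / fact (Suc m) = exp (- d) * (d - x) ^ m / fact m"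
      by (simp add: field_simps del: of_nat_Suc)
    finally show "((\<lambda>x. - exp (- d) * (d - x) ^ Suc m / fact (Suc m)) has_real_derivative
        exp (- d) * (d - x) ^ m / fact m) (at x)" .
  qed (use assms in auto)
  also have "\<dots> = ennreal (pois d (Suc m))" by (simp add: pois_def mult_ac)
  finally show ?thesis .
qed

lemma pred_has_incr [measurable]:
  assumes "\<And>u. (\<lambda>x. f x u) \<in> M \<rightarrow>\<^sub>M count_space UNIV"
  shows "Measurable.pred M (\<lambda>x. has_incr n t k (f x))"
proof -
  have [measurable]: "(\<lambda>x. f x u) \<in> M \<rightarrow>\<^sub>M count_space UNIV" for u by (rule assms)
  show ?thesis unfolding has_incr_def by measurable
qed

text \<open>Condition on the first gap, with an outer induction on the number of cells and an inner
  one on the first count. If this count is 0, the gap outlasts the first cell and the memoryless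
  property discards the cell; otherwise the gap ends inside the cell and the count drops by one on a
  shorter first cell.\<close>

lemma fdd_SX:
  assumes "t 0 = 0" "\<And>i. i < n \<Longrightarrow> t i < t (Suc i)"
  shows "(\<integral>\<^sup>+E. indicator {E. has_incr n t k (cnt E)} E \<partial>SX)
    = ennreal (\<Prod>i<n. pois (t (Suc i) - t i) (k i))"
  using assms
proof (induction n arbitrary: t k)
  case 0
  then show ?case using prob_space.emeasure_space_1[OF prob_space_SX] by (simp add: has_incr_def)
next
  case (Suc n)
  interpret SX: prob_space SX by (rule prob_space_SX)
  have outer: "(\<integral>\<^sup>+E. indicator {E. has_incr n t k (cnt E)} E \<partial>SX)
    = ennreal (\<Prod>i<n. pois (t (Suc i) - t i) (k i))"
    if "t 0 = 0" "\<And>i. i < n \<Longrightarrow> t i < t (Suc i)" for t k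
    using Suc.IH[of t k] that by blast
  from Suc.prems show ?case
  proof (induction "k 0" arbitrary: t k)
    case 0
    \<comment> \<open>The probability of the increments after the first cell when x is the part of
      the first gap that remains at time \<open>t 1\<close>.\<close>
    define \<Psi> where "\<Psi> x = (\<integral>\<^sup>+E. indicator {E. has_incr n (\<lambda>i. t (Suc i) - t 1) (\<lambda>i. k (Suc i)) (cnt E)} (x ## E) \<partial>SX)" for x
    have [measurable]: "\<Psi> \<in> borel_measurable borel" unfolding \<Psi>_def by measurable
    have t1: "0 < t 1" using 0 by force
    have "(\<integral>\<^sup>+E. indicator {E. has_incr (Suc n) t k (cnt E)} E \<partial>SX)
      = (\<integral>\<^sup>+e. (\<integral>\<^sup>+E. indicator {E. has_incr (Suc n) t k (cnt E)} (e ## E) \<partial>SX) \<partial>expo)"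
      by (rule nn_integral_SX) measurable
    also have "\<dots> = (\<integral>\<^sup>+e. ennreal (exp (-e)) * (\<integral>\<^sup>+E. indicator {E. has_incr (Suc n) t k (cnt E)} (e ## E) \<partial>SX) * indicator {0<..} e \<partial>lborel)"
      by (rule nn_integral_expo) measurable
    also have "\<dots> = (\<integral>\<^sup>+e. ennreal (exp (-e)) * \<Psi> (e - t 1) * indicator {t 1<..} e \<partial>lborel)"
    proof (rule nn_integral_cong_AE)
      show "AE e in lborel. ennreal (exp (-e)) * (\<integral>\<^sup>+E. indicator {E. has_incr (Suc n) t k (cnt E)} (e ## E) \<partial>SX) * indicator {0<..} e
        = ennreal (exp (-e)) * \<Psi> (e - t 1) * indicator {t 1<..} e"
        using AE_lborel_singleton[of "t 1"]
      proof eventually_elim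
        case (elim e)
        consider "e \<le> 0" | "0 < e" "e < t 1" | "t 1 < e" using elim by linarith
        then show ?case
        proof cases
          case 1 then show ?thesis using t1 by simp
        next
          case 2
          have "(\<integral>\<^sup>+E. indicator {E. has_incr (Suc n) t k (cnt E)} (e ## E) \<partial>SX) = (\<integral>\<^sup>+E. 0 \<partial>SX)"
            using AE_nonexpl by (intro nn_integral_cong_AE, eventually_elim)
              (use 2 0 in \<open>auto simp: has_incr_Suc cnt_SCons\<close>)
          then show ?thesis using 2 by simp
        next
          case 3
          have "(\<integral>\<^sup>+E. indicator {E. has_incr (Suc n) t k (cnt E)} (e ## E) \<partial>SX) = \<Psi> (e - t 1)"
            unfolding \<Psi>_def using AE_nonexpl by (intro nn_integral_cong_AE, eventually_elim)
              (use 3 0 t1 in \<open>auto simp: has_incr_SCons_late indicator_def\<close>)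
          then show ?thesis using 3 t1 by simp
        qed
      qed
    qed
    also have "\<dots> = (\<integral>\<^sup>+x. ennreal (exp (-(t 1 + x))) * \<Psi> x * indicator {0<..} x \<partial>lborel)"
      by (subst nn_integral_real_affine[where c = 1 and t = "t 1"]) (auto intro!: nn_integral_cong split: split_indicator)
    also have "\<dots> = (\<integral>\<^sup>+x. ennreal (exp (- t 1)) * (ennreal (exp (- x)) * \<Psi> x * indicator {0<..} x) \<partial>lborel)"
      by (intro nn_integral_cong) (auto simp: exp_diff exp_minus ennreal_mult[symmetric] mult.assoc[symmetric] exp_add divide_inverse)
    also have "\<dots> = ennreal (exp (- t 1)) * (\<integral>\<^sup>+x. ennreal (exp (- x)) * \<Psi> x * indicator {0<..} x \<partial>lborel)"
      by (rule nn_integral_cmult) measurable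
    also have "(\<integral>\<^sup>+x. ennreal (exp (- x)) * \<Psi> x * indicator {0<..} x \<partial>lborel) = (\<integral>\<^sup>+x. \<Psi> x \<partial>expo)"
      by (rule nn_integral_expo[symmetric]) measurable
    also have "\<dots> = (\<integral>\<^sup>+E. indicator {E. has_incr n (\<lambda>i. t (Suc i) - t 1) (\<lambda>i. k (Suc i)) (cnt E)} E \<partial>SX)"
      unfolding \<Psi>_def by (rule nn_integral_SX[symmetric]) measurable
    also have "\<dots> = ennreal (\<Prod>i<n. pois (t (Suc (Suc i)) - t (Suc i)) (k (Suc i)))"
      using 0 by (subst outer) auto
    also have "ennreal (exp (- t 1)) * \<dots> = ennreal (\<Prod>i<Suc n. pois (t (Suc i) - t i) (k i))"
      using 0 by (simp add: prod.lessThan_Suc_shift ennreal_mult' pois_def del: prod.lessThan_Suc)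
    finally show ?case .
  next
    case (Suc m)
    have t1: "0 < t 1" using Suc.prems by force
    have mono: "t 1 \<le> t (Suc i)" if "i \<le> n" for i
      using that
    proof (induction i)
      case (Suc i)
      then show ?case using Suc.prems \<open>\<And>i. i < Suc n \<Longrightarrow> t i < t (Suc i)\<close>[of "Suc i"] by auto
    qed simp
    define C where "C = (\<Prod>i<n. pois (t (Suc (Suc i)) - t (Suc i)) (k (Suc i)))"
    have C: "0 \<le> C" unfolding C_def using Suc.prems(2) by (intro prod_nonneg ballI pois_nonneg) (auto simp: less_imp_le)
    have "(\<integral>\<^sup>+E. indicator {E. has_incr (Suc n) t k (cnt E)} E \<partial>SX)
      = (\<integral>\<^sup>+e. (\<integral>\<^sup>+E. indicator {E. has_incr (Suc n) t k (cnt E)} (e ## E) \<partial>SX) \<partial>expo)"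
      by (rule nn_integral_SX) measurable
    also have "\<dots> = (\<integral>\<^sup>+e. ennreal (exp (-e)) * (\<integral>\<^sup>+E. indicator {E. has_incr (Suc n) t k (cnt E)} (e ## E) \<partial>SX) * indicator {0<..} e \<partial>lborel)"
      by (rule nn_integral_expo) measurable
    also have "\<dots> = (\<integral>\<^sup>+e. ennreal C * (ennreal (exp (-e) * pois (t 1 - e) m) * indicator {0..t 1} e) \<partial>lborel)"
    proof (rule nn_integral_cong_AE)
      show "AE e in lborel. ennreal (exp (-e)) * (\<integral>\<^sup>+E. indicator {E. has_incr (Suc n) t k (cnt E)} (e ## E) \<partial>SX) * indicator {0<..} e
        = ennreal C * (ennreal (exp (-e) * pois (t 1 - e) m) * indicator {0..t 1} e)"
        using AE_lborel_singleton[of "t 1"] AE_lborel_singleton[of 0]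
      proof eventually_elim
        case (elim e)
        consider "e < 0" | "0 < e" "e < t 1" | "t 1 < e" using elim by linarith
        then show ?case
        proof cases
          case 1 then show ?thesis by simp
        next
          case 3
          have "(\<integral>\<^sup>+E. indicator {E. has_incr (Suc n) t k (cnt E)} (e ## E) \<partial>SX) = (\<integral>\<^sup>+E. 0 \<partial>SX)"
            using AE_nonexpl by (intro nn_integral_cong_AE, eventually_elim)
              (use 3 t1 Suc.prems Suc.hyps in \<open>auto simp: has_incr_Suc cnt_SCons\<close>)
          then show ?thesis using 3 by simp
        next
          case 2
          let ?t = "case_nat 0 (\<lambda>i. t (Suc i) - e)" and ?k = "case_nat m (\<lambda>i. k (Suc i))"
          have "(\<integral>\<^sup>+E. indicator {E. has_incr (Suc n) t k (cnt E)} (e ## E) \<partial>SX)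
            = (\<integral>\<^sup>+E. indicator {E. has_incr (Suc n) ?t ?k (cnt E)} E \<partial>SX)"
            using AE_nonexpl
          proof (intro nn_integral_cong_AE, eventually_elim)
            case (elim E)
            have "has_incr (Suc n) t k (cnt (e ## E)) \<longleftrightarrow> has_incr (Suc n) ?t ?k (cnt E)"
              using has_incr_SCons_early[OF elim(2) 2 Suc.prems(1) _ mono[of n], of k] mono Suc.hyps(2)[symmetric] by simp
            then show ?case by (simp add: indicator_def)
          qed
          also have "\<dots> = ennreal (\<Prod>i<Suc n. pois (?t (Suc i) - ?t i) (?k i))"
          proof (rule Suc.hyps(1))
            show "?t i < ?t (Suc i)" if "i < Suc n" for i
              using that 2 Suc.prems(2)[of i] by (cases i) auto
          qed auto
          also have "\<dots> = ennreal (pois (t 1 - e) m * C)"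
            by (simp add: prod.lessThan_Suc_shift C_def del: prod.lessThan_Suc)
          finally show ?thesis using 2 C by (simp add: ennreal_mult'[symmetric] pois_nonneg ac_simps)
        qed
      qed
    qed
    also have "\<dots> = ennreal C * ennreal (pois (t 1) (Suc m))"
      using t1 nn_integral_pois_step[of "t 1" m]
      by (subst nn_integral_cmult) (auto simp: pois_def)
    also have "\<dots> = ennreal (\<Prod>i<Suc n. pois (t (Suc i) - t i) (k i))"
      using Suc.prems(1) Suc.hyps(2) C t1
      by (simp add: prod.lessThan_Suc_shift C_def[symmetric] ennreal_mult'[symmetric] ac_simps del: prod.lessThan_Suc)
    finally show ?case .
  qed
qed

text \<open>The null set of streams outside \<open>nonexpl\<close> is sent to the empty
  configuration, so that the values lie in \<open>Nfrak\<close> without exception, as a map into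
  \<open>Nspace\<close> requires.\<close>

definition poisson_path :: "real stream \<Rightarrow> path" where
  "poisson_path E = (if nonexpl E then cnt E else (\<lambda>_. 0))"

lemma measurable_poisson_path [measurable]: "poisson_path \<in> SX \<rightarrow>\<^sub>M Nspace"
proof (rule measurable_into_Nspace)
  show "poisson_path E \<in> Nfrak" for E
    using cnt_Nfrak by (auto simp: poisson_path_def) (auto simp: Nfrak_def mono_def intro: gt_ex lt_ex)
  have "(\<lambda>E. poisson_path E u) = (\<lambda>E. if nonexpl E then cnt E u else 0)" for u
    by (auto simp: poisson_path_def)
  then show "(\<lambda>E. poisson_path E u) \<in> SX \<rightarrow>\<^sub>M count_space UNIV" for u by simp
qed

lemma is_poisson_law_exists: "is_poisson_law (distr SX Nspace poisson_path)"
  unfolding is_poisson_law_def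
proof (intro conjI allI impI)
  interpret SX: prob_space SX by (rule prob_space_SX)
  show "prob_space (distr SX Nspace poisson_path)" by (rule SX.prob_space_distr) simp
  fix n :: nat and t :: "nat \<Rightarrow> real" and k :: "nat \<Rightarrow> nat"
  assume t: "t 0 = 0" "\<forall>i<n. t i < t (Suc i)"
  have "emeasure (distr SX Nspace poisson_path) (incr_event n t k)
      = (\<integral>\<^sup>+E. indicator (incr_event n t k) (poisson_path E) \<partial>SX)"
    by (subst nn_integral_indicator[symmetric], simp, subst nn_integral_distr) auto
  also have "\<dots> = (\<integral>\<^sup>+E. indicator {E. has_incr n t k (cnt E)} E \<partial>SX)"
    using AE_nonexpl by (intro nn_integral_cong_AE, eventually_elim)
      (auto simp: poisson_path_def incr_event_def has_incr_def cnt_Nfrak indicator_def)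
  also have "\<dots> = ennreal (\<Prod>i<n. pois (t (Suc i) - t i) (k i))"
    using t by (intro fdd_SX) auto
  also have "(\<Prod>i<n. pois (t (Suc i) - t i) (k i)) = (\<Prod>i<n. pmf (poisson_pmf (t (Suc i) - t i)) (k i))"
    using t by (intro prod.cong) (auto simp: pois_def)
  finally show "measure (distr SX Nspace poisson_path) {\<omega>\<in>Nfrak. \<forall>i<n. \<omega> (t (Suc i)) - \<omega> (t i) = k i}
      = (\<Prod>i<n. pmf (poisson_pmf (t (Suc i) - t i)) (k i))"
    unfolding incr_event_def by (simp add: measure_def prod_nonneg)
qed simp

lemma is_poisson_law_pi: "is_poisson_law pi_law"
  unfolding pi_law_def
  by (rule theI, rule is_poisson_law_exists) (rule is_poisson_law_unique[OF _ is_poisson_law_exists])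

section \<open>Deterministic piecewise linear time changes\<close>

lemma sets_pi [simp, measurable_cong]: "sets pi_law = sets Nspace"
  and prob_space_pi: "prob_space pi_law"
  using is_poisson_law_pi by (auto simp: is_poisson_law_def)

lemma space_pi [simp]: "space pi_law = Nfrak"
  using sets_eq_imp_space_eq[OF sets_pi] by simp

interpretation pi: prob_space pi_law
  by (rule prob_space_pi)

lemma emeasure_pi_incr_event:
  assumes "t 0 = 0" "\<forall>i<n. t i < t (Suc i)"
  shows "emeasure pi_law (incr_event n t k) = ennreal (\<Prod>i<n. pois (t (Suc i) - t i) (k i))"
proof -
  have "measure pi_law (incr_event n t k) = (\<Prod>i<n. pmf (poisson_pmf (t (Suc i) - t i)) (k i))"
    using assms is_poisson_law_pi unfolding is_poisson_law_def incr_event_def by blast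
  also have "\<dots> = (\<Prod>i<n. pois (t (Suc i) - t i) (k i))"
    using assms by (intro prod.cong) (auto simp: pois_def)
  finally show ?thesis by (simp add: pi.emeasure_eq_measure)
qed

section \<open>Piecewise linear maps and their action on paths\<close>

definition clip :: "real \<Rightarrow> real \<Rightarrow> real" where
  "clip d x = max 0 (min d x)"

text \<open>For grids with \<open>s 0 = a 0\<close> this is the piecewise linear map taking each
  \<open>s j\<close> to \<open>a j\<close>, with slope 1 outside the grid. Written as a sum of ramps
  it grows by one term per cell, and exchanging \<open>s\<close> and \<open>a\<close> inverts
  it.\<close>

definition PL :: "nat \<Rightarrow> (nat \<Rightarrow> real) \<Rightarrow> (nat \<Rightarrow> real) \<Rightarrow> real \<Rightarrow> real" where
  "PL M s a t = t + (\<Sum>j<M. ((a (Suc j) - a j) / (s (Suc j) - s j) - 1) * clip (s (Suc j) - s j) (t - s j))"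

lemma PL_0 [simp]: "PL 0 s a t = t"
  by (simp add: PL_def)

lemma PL_Suc: "PL (Suc M) s a t = PL M s a t
    + ((a (Suc M) - a M) / (s (Suc M) - s M) - 1) * clip (s (Suc M) - s M) (t - s M)"
  by (simp add: PL_def)

definition grid :: "nat \<Rightarrow> (nat \<Rightarrow> real) \<Rightarrow> bool" where
  "grid M s \<longleftrightarrow> (\<forall>j<M. s j < s (Suc j))"

lemma grid_mono:
  assumes "grid M s" "i \<le> j" "j \<le> M"
  shows "s i \<le> s j"
  using assms(2,3)
proof (induction j rule: dec_induct)
  case (step j)
  have "s j < s (Suc j)" using assms(1) step by (simp add: grid_def)
  then show ?case using step by simp
qed simp

lemma grid_SucD: "grid (Suc M) s \<Longrightarrow> grid M s"
  by (simp add: grid_def)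

lemma PL_after:
  assumes "grid M s" "s 0 = a 0" "s M \<le> t"
  shows "PL M s a t = a M + (t - s M)"
  using assms
proof (induction M arbitrary: t)
  case (Suc M)
  have "s M < s (Suc M)" using Suc.prems(1) by (simp add: grid_def)
  moreover have "PL M s a t = a M + (t - s M)"
    using Suc.IH[of t] grid_SucD[OF Suc.prems(1)] Suc.prems calculation by simp
  have "(x / D - 1) * D = x - D" if "D \<noteq> 0" for x D :: real
    using that by (simp add: left_diff_distrib)
  from this[of "s (Suc M) - s M" "a (Suc M) - a M"]
  have "((a (Suc M) - a M) / (s (Suc M) - s M) - 1) * (s (Suc M) - s M)
      = (a (Suc M) - a M) - (s (Suc M) - s M)"
    using \<open>s M < s (Suc M)\<close> by auto
  then show ?case using Suc.prems(3) \<open>s M < s (Suc M)\<close> \<open>PL M s a t = _\<close> by (simp add: PL_Suc clip_def)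
qed simp

lemma PL_before:
  assumes "grid M s" "i \<le> M" "t \<le> s i"
  shows "PL M s a t = PL i s a t"
  using assms(2,1,3)
proof (induction M rule: dec_induct)
  case (step M)
  have "t \<le> s M" using grid_mono[OF step.prems(1), of i M] step by simp
  then show ?case using step grid_SucD[OF step.prems(1)] by (auto simp: PL_Suc clip_def grid_def)
qed simp

lemma PL_within:
  assumes "grid M s" "s 0 = a 0" "i < M" "s i \<le> t" "t \<le> s (Suc i)"
  shows "PL M s a t = a i + (a (Suc i) - a i) / (s (Suc i) - s i) * (t - s i)"
proof -
  have "grid i s" using assms by (auto simp: grid_def)
  then have "PL i s a t = a i + (t - s i)" using assms by (intro PL_after) auto
  moreover have "PL M s a t = PL (Suc i) s a t" using assms by (intro PL_before) auto
  moreover have "clip (s (Suc i) - s i) (t - s i) = t - s i" using assms by (simp add: clip_def)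
  ultimately show ?thesis by (simp add: PL_Suc algebra_simps)
qed

lemma PL_grid:
  assumes "grid M s" "s 0 = a 0" "i \<le> M"
  shows "PL M s a (s i) = a i"
proof (cases "i = M")
  case True
  then show ?thesis using PL_after[where a = a, OF assms(1,2), of "s M"] by simp
next
  case False
  then show ?thesis using PL_within[where a = a, OF assms(1,2), of i "s i"] assms by (auto simp: grid_def less_imp_le)
qed

lemma grid_cases:
  assumes "grid M s"
  obtains "t \<le> s 0" | i where "i < M" "s i \<le> t" "t \<le> s (Suc i)" | "s M \<le> t"
proof -
  have "t \<le> s 0 \<or> (\<exists>i<M. s i \<le> t \<and> t \<le> s (Suc i)) \<or> s M \<le> t"
    by (induction M) (use nle_le less_Suc_eq in \<open>auto\<close>)
  then show thesis using that by blast
qed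

lemma PL_inverse:
  assumes s: "grid M s" and a: "grid M a" and 0: "s 0 = a 0"
  shows "PL M a s (PL M s a t) = t"
proof (cases rule: grid_cases[OF s, of t])
  case 1
  then show ?thesis using PL_before[OF s, of 0 t a] PL_before[OF a, of 0 t s] 0 by simp
next
  case (2 i)
  define r where "r = (a (Suc i) - a i) / (s (Suc i) - s i)"
  have lt: "s i < s (Suc i)" "a i < a (Suc i)" using s a 2 by (auto simp: grid_def)
  have r: "0 < r" using lt by (simp add: r_def)
  have eq: "PL M s a t = a i + r * (t - s i)" using PL_within[where a = a, OF s 0 2] by (simp add: r_def)
  have "r * (t - s i) \<le> r * (s (Suc i) - s i)" using r 2 by (intro mult_left_mono) auto
  also have "\<dots> = a (Suc i) - a i" using lt by (simp add: r_def)
  finally have "PL M a s (a i + r * (t - s i)) = s i + (s (Suc i) - s i) / (a (Suc i) - a i) * (a i + r * (t - s i) - a i)"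
    using r 2 by (intro PL_within a 0[symmetric]) auto
  also have "\<dots> = t" using lt by (simp add: r_def)
  finally show ?thesis by (simp add: eq)
next
  case 3
  then show ?thesis using PL_after[where a = a, OF s 0, of t] PL_after[where a = s, OF a 0[symmetric], of "PL M s a t"] by simp
qed

text \<open>Split \<open>y - x\<close> into the length c inside the cell, which is multiplied by r,
  and the rest, which keeps slope 1. Both parts are nonnegative and they do not vanish
  together.\<close>

lemma cell_strict_mono:
  assumes "0 < r" "x < y"
  shows "x + (r - 1) * clip d x < y + (r - 1) * clip d y"
proof -
  define c where "c = clip d y - clip d x"
  have c: "0 \<le> c" "c \<le> y - x" using assms by (auto simp: c_def clip_def)
  have "0 < (y - x - c) + r * c"
  proof (cases "c = y - x")
    case False
    then show ?thesis using c assms by (intro add_pos_nonneg) auto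
  qed (use assms in simp)
  then show ?thesis by (simp add: c_def algebra_simps)
qed

lemma PL_strict_mono:
  assumes "grid M s" "grid M a" "s 0 = a 0"
  shows "strict_mono (PL M s a)"
  using assms
proof (induction M)
  case 0
  then show ?case by (simp add: strict_mono_def)
next
  case (Suc M)
  have g: "grid M s" "grid M a" using Suc.prems grid_SucD by auto
  define r where "r = (a (Suc M) - a M) / (s (Suc M) - s M)"
  have r: "0 < r" using Suc.prems by (simp add: r_def grid_def)
  have low: "PL (Suc M) s a t = PL M s a t" if "t \<le> s M" for t
    using Suc.prems that by (intro PL_before) auto
  have high: "PL (Suc M) s a t = a M + ((t - s M) + (r - 1) * clip (s (Suc M) - s M) (t - s M))" if "s M \<le> t" for t
    using PL_after[where a=a, OF g(1) Suc.prems(3) that] by (simp add: PL_Suc r_def)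
  have hs: "PL (Suc M) s a x < PL (Suc M) s a y" if "s M \<le> x" "x < y" for x y
    using that cell_strict_mono[OF r, of "x - s M" "y - s M" "s (Suc M) - s M"] by (simp add: high)
  have ls: "PL (Suc M) s a x < PL (Suc M) s a y" if "y \<le> s M" "x < y" for x y
    using that Suc.IH[OF g Suc.prems(3)] by (simp add: low strict_monoD)
  show ?case
  proof (rule strict_monoI)
    fix x y :: real assume "x < y"
    consider "y \<le> s M" | "s M \<le> x" | "x < s M" "s M < y" by linarith
    then show "PL (Suc M) s a x < PL (Suc M) s a y"
      by cases (use ls hs \<open>x < y\<close> less_trans[OF ls[of "s M" x] hs[of "s M" y]] in auto)
  qed
qed

text \<open>Right-continuity and the bound on jumps are existential in time: a witness near \<phi> t
  has to be pulled back to a witness near t, which is the role of the increasing inverse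
  \<psi>.\<close>

lemma Nfrak_comp:
  assumes w: "\<omega> \<in> Nfrak" and phi: "strict_mono \<phi>" and psi: "strict_mono \<psi>"
    and inv: "\<And>x. \<phi> (\<psi> x) = x" "\<And>x. \<psi> (\<phi> x) = x" and nonpos: "\<And>t. t \<le> 0 \<Longrightarrow> \<phi> t \<le> 0"
  shows "(\<lambda>t. \<omega> (\<phi> t)) \<in> Nfrak"
proof -
  have "\<exists>s>t. \<omega> (\<phi> s) = \<omega> (\<phi> t)" for t
  proof -
    obtain s where "\<phi> t < s" "\<omega> s = \<omega> (\<phi> t)" using Nfrak_right[OF w] by blast
    then show ?thesis using strict_monoD[OF psi, of "\<phi> t" s] inv by (intro exI[of _ "\<psi> s"]) auto
  qed
  moreover have "\<exists>s<t. \<omega> (\<phi> t) \<le> Suc (\<omega> (\<phi> s))" for t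
  proof (cases "\<phi> t \<le> 0")
    case True
    then show ?thesis using Nfrak_nonpos[OF w] lt_ex by auto
  next
    case False
    then obtain s where "s < \<phi> t" "\<omega> (\<phi> t) \<le> Suc (\<omega> s)" using Nfrak_jump[OF w, of "\<phi> t"] by auto
    then show ?thesis using strict_monoD[OF psi, of s "\<phi> t"] inv by (intro exI[of _ "\<psi> s"]) auto
  qed
  moreover have "mono (\<lambda>t. \<omega> (\<phi> t))"
    using strict_mono_mono[OF phi] Nfrak_mono[OF w] by (auto simp: mono_def)
  ultimately show ?thesis using nonpos Nfrak_nonpos[OF w] by (auto simp: Nfrak_def)
qed

lemma Nfrak_comp_PL:
  assumes "\<omega> \<in> Nfrak" "grid M s" "grid M a" "s 0 = a 0" "0 \<le> s 0"
  shows "(\<lambda>t. \<omega> (PL M s a t)) \<in> Nfrak"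
proof (rule Nfrak_comp)
  show "PL M s a t \<le> 0" if "t \<le> 0" for t using PL_before[OF assms(2), of 0 t a] that assms by simp
  show "PL M s a (PL M a s x) = x" "PL M a s (PL M s a x) = x" for x
    using assms by (simp_all add: PL_inverse)
qed (use assms PL_strict_mono[of M s a] PL_strict_mono[of M a s] in auto)

lemma measurable_comp_PL:
  assumes "grid M s" "grid M a" "s 0 = a 0" "0 \<le> s 0"
  shows "(\<lambda>\<omega> t. \<omega> (PL M s a t)) \<in> Nspace \<rightarrow>\<^sub>M Nspace"
  by (rule measurable_into_Nspace) (use assms in \<open>auto intro: Nfrak_comp_PL\<close>)

section \<open>Densities of the laws under deterministic changes\<close>

definition theta :: "real \<Rightarrow> real \<Rightarrow> real \<Rightarrow> real \<Rightarrow> real" where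
  "theta s d r t = t + (r - 1) * clip d (t - s)"

lemma theta_as_PL:
  "0 < d \<Longrightarrow> theta s d r = PL 1 (case_nat s (\<lambda>_. s + d)) (case_nat s (\<lambda>_. s + r * d))"
  by (auto simp: fun_eq_iff theta_def PL_def)

lemma theta_facts:
  assumes "0 \<le> s" "0 < d" "0 < r"
  shows measurable_comp_theta: "(\<lambda>\<omega> t. \<omega> (theta s d r t)) \<in> Nspace \<rightarrow>\<^sub>M Nspace"
    and Nfrak_comp_theta: "\<omega> \<in> Nfrak \<Longrightarrow> (\<lambda>t. \<omega> (theta s d r t)) \<in> Nfrak"
    and theta_strict_mono: "strict_mono (theta s d r)"
  unfolding theta_as_PL[OF assms(2)] using assms
  by (auto intro!: measurable_comp_PL Nfrak_comp_PL PL_strict_mono simp: grid_def)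

text \<open>Truncated differences telescope here because the path is nondecreasing along the
  grid.\<close>

lemma incr_event_sum:
  assumes w: "\<omega> \<in> incr_event n t k" and t: "grid n t" and "p \<le> q" "q \<le> n"
  shows "\<omega> (t q) = \<omega> (t p) + (\<Sum>i=p..<q. k i)"
  using assms(3,4)
proof (induction q rule: dec_induct)
  case (step q)
  have "\<omega> \<in> Nfrak" using w by (simp add: incr_event_def)
  then have "\<omega> (t q) \<le> \<omega> (t (Suc q))" using t step.prems by (intro Nfrak_mono) (auto simp: grid_def less_imp_le)
  moreover have "\<omega> (t (Suc q)) - \<omega> (t q) = k q" using w step.prems by (simp add: incr_event_def)
  ultimately show ?case using step by simp
qed simp

lemma pois_scale: "pois (r * d) k = r ^ k * exp (- (r - 1) * d) * pois d k"
  by (simp add: pois_def power_mult_distrib exp_add[symmetric] algebra_simps)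

text \<open>Along a grid that contains both ends of the cell, each interval lies either inside the
  cell, where its length is multiplied by r, or outside, where it is kept. The Poisson likelihood
  ratios of the inner intervals multiply to a function of the total count in the cell.\<close>

lemma distr_one_cell:
  assumes s: "0 \<le> s" and d: "0 < d" and r: "0 < r"
  shows "distr pi_law Nspace (\<lambda>\<omega> t. \<omega> (theta s d r t))
    = density pi_law (\<lambda>\<omega>. ennreal (r ^ (\<omega> (s + d) - \<omega> s) * exp (- (r - 1) * d)))" (is "?P = ?Q")
proof (rule measure_eq_incr_eventI[where S = "{s, s + d}"])
  note [measurable] = measurable_comp_theta[OF assms]
  show "finite_measure ?P" by (simp add: pi.finite_measure_distr)
  fix n :: nat and t :: "nat \<Rightarrow> real" and k :: "nat \<Rightarrow> nat"
  assume t0: "t 0 = 0" and t: "\<forall>i<n. t i < t (Suc i)" and S: "{s, s + d} \<subseteq> t ` {..n}"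
  have g: "grid n t" using t by (simp add: grid_def)
  obtain p q where pq: "p \<le> n" "q \<le> n" "t p = s" "t q = s + d" using S by auto
  have "p < q" using grid_mono[OF g, of q p] pq d by (cases "p < q") auto
  define f where "f i = (if p \<le> i \<and> i < q then r ^ k i * exp (- (r - 1) * (t (Suc i) - t i)) else 1)" for i
  have incr: "theta s d r (t (Suc i)) - theta s d r (t i) = (if p \<le> i \<and> i < q then r * (t (Suc i) - t i) else t (Suc i) - t i)"
    if "i < n" for i
  proof -
    have "t i < t (Suc i)" using t that by simp
    moreover have "t (Suc i) \<le> s" if "i < p" using grid_mono[OF g, of "Suc i" p] pq that by simp
    moreover have "s \<le> t i" if "p \<le> i" using grid_mono[OF g, of p i] pq that \<open>i < n\<close> by simp
    moreover have "t (Suc i) \<le> s + d" if "i < q" using grid_mono[OF g, of "Suc i" q] pq that by simp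
    moreover have "s + d \<le> t i" if "q \<le> i" using grid_mono[OF g, of q i] pq that \<open>i < n\<close> by simp
    ultimately show ?thesis using \<open>p < q\<close> by (cases "i < p"; cases "i < q") (auto simp: theta_def clip_def algebra_simps)
  qed
  have "emeasure ?P (incr_event n t k) = emeasure pi_law (incr_event n (\<lambda>i. theta s d r (t i)) k)"
  proof -
    have "(\<lambda>\<omega> t. \<omega> (theta s d r t)) -` incr_event n t k \<inter> space pi_law = incr_event n (\<lambda>i. theta s d r (t i)) k"
      by (auto simp: incr_event_def Nfrak_comp_theta[OF assms])
    then show ?thesis by (subst emeasure_distr) simp_all
  qed
  also have "\<dots> = ennreal (\<Prod>i<n. pois (theta s d r (t (Suc i)) - theta s d r (t i)) (k i))"
    using theta_strict_mono[OF assms] t t0 s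
    by (intro emeasure_pi_incr_event) (auto simp: strict_mono_def theta_def clip_def)
  also have "(\<Prod>i<n. pois (theta s d r (t (Suc i)) - theta s d r (t i)) (k i)) = (\<Prod>i<n. f i * pois (t (Suc i) - t i) (k i))"
    by (intro prod.cong) (auto simp: incr f_def pois_scale)
  also have "\<dots> = (\<Prod>i<n. f i) * (\<Prod>i<n. pois (t (Suc i) - t i) (k i))"
    by (rule prod.distrib)
  also have "(\<Prod>i<n. f i) = (\<Prod>i=p..<q. r ^ k i * exp (- (r - 1) * (t (Suc i) - t i)))"
    unfolding f_def using pq by (intro prod.mono_neutral_cong_right) auto
  also have "\<dots> = r ^ (\<Sum>i=p..<q. k i) * exp (\<Sum>i=p..<q. - (r - 1) * (t (Suc i) - t i))"
    by (simp add: prod.distrib power_sum exp_sum)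
  also have "(\<Sum>i=p..<q. - (r - 1) * (t (Suc i) - t i)) = - (r - 1) * d"
    using sum_Suc_diff'[of p q t] \<open>p < q\<close> pq by (simp add: sum_distrib_left[symmetric])
  finally have P: "emeasure ?P (incr_event n t k) = ennreal (r ^ (\<Sum>i=p..<q. k i) * exp (- (r - 1) * d)) * emeasure pi_law (incr_event n t k)"
    using r by (simp add: emeasure_pi_incr_event[OF t0 t] ennreal_mult')
  have "emeasure ?Q (incr_event n t k) = (\<integral>\<^sup>+\<omega>. ennreal (r ^ (\<omega> (s + d) - \<omega> s) * exp (- (r - 1) * d)) * indicator (incr_event n t k) \<omega> \<partial>pi_law)"
    by (rule emeasure_density) auto
  also have "\<dots> = (\<integral>\<^sup>+\<omega>. ennreal (r ^ (\<Sum>i=p..<q. k i) * exp (- (r - 1) * d)) * indicator (incr_event n t k) \<omega> \<partial>pi_law)"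
  proof -
    have "\<omega> (s + d) - \<omega> s = (\<Sum>i=p..<q. k i)" if "\<omega> \<in> incr_event n t k" for \<omega>
      using incr_event_sum[OF that g, of p q] \<open>p < q\<close> pq by simp
    then show ?thesis by (intro nn_integral_cong) (auto split: split_indicator)
  qed
  also have "\<dots> = emeasure ?P (incr_event n t k)"
    unfolding P by (rule nn_integral_cmult_indicator) simp
  finally show "emeasure ?P (incr_event n t k) = emeasure ?Q (incr_event n t k)" by simp
qed (use assms in auto)

text \<open>Up to \<open>s M\<close> the one-cell map is the identity, and beyond \<open>s M\<close>
  the map \<open>PL M s a\<close> is a translation, so the slope of the last cell survives the
  composition. The order of composition makes the last cell the final change applied to the
  path.\<close>

lemma PL_Suc_comp:
  assumes "grid (Suc M) s" "grid (Suc M) a" "s 0 = a 0"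
  shows "PL (Suc M) s a t = PL M s a (theta (s M) (s (Suc M) - s M) ((a (Suc M) - a M) / (s (Suc M) - s M)) t)"
    (is "_ = PL M s a (?th t)")
proof (cases "t \<le> s M")
  case True
  then show ?thesis using assms(1) by (simp add: PL_Suc theta_def clip_def grid_def)
next
  case False
  have "0 < (a (Suc M) - a M) / (s (Suc M) - s M)" using assms by (simp add: grid_def)
  then have "s M < ?th t"
    using cell_strict_mono[of _ 0 "t - s M" "s (Suc M) - s M"] False assms(1)
    by (fastforce simp: theta_def clip_def grid_def)
  then show ?thesis using PL_after[where a = a, OF grid_SucD[OF assms(1)] assms(3), of t]
      PL_after[where a = a, OF grid_SucD[OF assms(1)] assms(3), of "?th t"] False
    by (simp add: PL_Suc theta_def)
qed

text \<open>The likelihood ratio on one cell of a Poisson process whose rate is the slope against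
  the unit rate; slope minus 1, times the cell length, is the difference of the two lengths.\<close>

definition cell_density :: "(nat \<Rightarrow> real) \<Rightarrow> (nat \<Rightarrow> real) \<Rightarrow> nat \<Rightarrow> path \<Rightarrow> real" where
  "cell_density s a j \<omega> = ((a (Suc j) - a j) / (s (Suc j) - s j)) ^ (\<omega> (s (Suc j)) - \<omega> (s j))
     * exp (- ((a (Suc j) - a j) - (s (Suc j) - s j)))"

lemma cell_density_nonneg: "grid M s \<Longrightarrow> grid M a \<Longrightarrow> j < M \<Longrightarrow> 0 \<le> cell_density s a j \<omega>"
  by (auto simp: cell_density_def grid_def less_imp_le)

lemma measurable_cell_density [measurable]: "cell_density s a j \<in> borel_measurable Nspace"
  unfolding cell_density_def by measurable

lemma distr_comp_PL:
  assumes "grid M s" "grid M a" "s 0 = a 0" "0 \<le> s 0"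
  shows "distr pi_law Nspace (\<lambda>\<omega> t. \<omega> (PL M s a t))
    = density pi_law (\<lambda>\<omega>. ennreal (\<Prod>j<M. cell_density s a j \<omega>))"
  using assms
proof (induction M)
  case 0
  have "distr pi_law Nspace (\<lambda>\<omega> t. \<omega> t) = distr pi_law pi_law (\<lambda>\<omega>. \<omega>)"
    by (rule distr_cong) auto
  then show ?case by (simp add: distr_id density_1)
next
  case (Suc M)
  let ?D = "\<lambda>M \<omega>. ennreal (\<Prod>j<M. cell_density s a j \<omega>)"
  have g: "grid M s" "grid M a" using Suc.prems grid_SucD by auto
  define d r where "d = s (Suc M) - s M" and "r = (a (Suc M) - a M) / (s (Suc M) - s M)"
  have d: "0 < d" and r: "0 < r" using Suc.prems by (auto simp: d_def r_def grid_def)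
  have sM: "0 \<le> s M" using grid_mono[OF g(1), of 0 M] Suc.prems by simp
  note [measurable] = measurable_comp_theta[OF sM d r] measurable_comp_PL[OF g Suc.prems(3,4)]
  have "distr pi_law Nspace (\<lambda>\<omega> t. \<omega> (PL (Suc M) s a t))
      = distr (distr pi_law Nspace (\<lambda>\<omega> t. \<omega> (PL M s a t))) Nspace (\<lambda>\<omega> t. \<omega> (theta (s M) d r t))"
  proof -
    have "PL (Suc M) s a t = PL M s a (theta (s M) d r t)" for t
      using PL_Suc_comp[OF Suc.prems(1-3), of t] by (simp only: d_def r_def)
    then show ?thesis by (subst distr_distr) (simp_all add: comp_def)
  qed
  also have "\<dots> = distr (density pi_law (?D M)) Nspace (\<lambda>\<omega> t. \<omega> (theta (s M) d r t))"
    using Suc.IH[OF g Suc.prems(3,4)] by simp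
  also have "\<dots> = distr (density pi_law (\<lambda>\<omega>. ?D M (\<lambda>t. \<omega> (theta (s M) d r t)))) Nspace (\<lambda>\<omega> t. \<omega> (theta (s M) d r t))"
  proof -
    \<comment> \<open>The density collected so far reads the path only at \<open>s 0\<close> up to
      \<open>s M\<close>. The last change fixes these times, so the density passes unchanged through
      the image measure.\<close>
    have fix_point: "theta (s M) d r (s j) = s j" if "j \<le> M" for j
      using grid_mono[OF g(1), of j M] that d by (simp add: theta_def clip_def)
    have "?D M (\<lambda>t. \<omega> (theta (s M) d r t)) = ?D M \<omega>" for \<omega>
      by (intro arg_cong[where f = ennreal] prod.cong) (auto simp: cell_density_def fix_point)
    then show ?thesis by simp
  qed
  also have "\<dots> = density (distr pi_law Nspace (\<lambda>\<omega> t. \<omega> (theta (s M) d r t))) (?D M)"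
    by (rule density_distr[symmetric]) auto
  also have "\<dots> = density (density pi_law (\<lambda>\<omega>. ennreal (r ^ (\<omega> (s M + d) - \<omega> (s M)) * exp (- (r - 1) * d)))) (?D M)"
    by (simp add: distr_one_cell[OF sM d r])
  also have "\<dots> = density pi_law (\<lambda>\<omega>. ennreal (r ^ (\<omega> (s M + d) - \<omega> (s M)) * exp (- (r - 1) * d)) * ?D M \<omega>)"
    by (rule density_density_eq) auto
  also have "\<dots> = density pi_law (?D (Suc M))"
  proof (rule density_cong)
    have "r * d = a (Suc M) - a M" using d by (simp add: r_def d_def)
    then have "r ^ (\<omega> (s M + d) - \<omega> (s M)) * exp (- (r - 1) * d) = cell_density s a M \<omega>" for \<omega>
    proof -
      have 1: "s M + d = s (Suc M)" by (simp add: d_def)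
      have 2: "- (r - 1) * d = - ((a (Suc M) - a M) - (s (Suc M) - s M))"
        using \<open>r * d = _\<close> by (simp add: algebra_simps) (simp add: d_def)
      show ?thesis unfolding cell_density_def 1 2 by (simp add: r_def d_def)
    qed
    moreover have "0 \<le> cell_density s a M \<omega>" for \<omega> using cell_density_nonneg[OF Suc.prems(1,2)] by simp
    ultimately show "AE \<omega> in pi_law. ennreal (r ^ (\<omega> (s M + d) - \<omega> (s M)) * exp (- (r - 1) * d)) * ?D M \<omega> = ?D (Suc M) \<omega>"
      by (auto simp: ennreal_mult'[symmetric] mult.commute)
  qed auto
  finally show ?case .
qed

section \<open>Adaptive time changes\<close>

lemma measurable_eval_borel [measurable]: "(\<lambda>\<omega>. \<omega> u) \<in> Nspace \<rightarrow>\<^sub>M (borel :: nat measure)"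
  by (rule measurable_compose[OF measurable_eval]) simp

text \<open>Recording occupation instead of the count leaves finitely many histories of each length,
  so a history can be frozen and the resulting laws summed.\<close>

definition bits :: "real \<Rightarrow> path \<Rightarrow> nat \<Rightarrow> bool list" where
  "bits \<delta> \<omega> j = map (\<lambda>i. \<omega> (real i * \<delta>) < \<omega> (real (Suc i) * \<delta>)) [0..<j]"

lemma length_bits [simp]: "length (bits \<delta> \<omega> j) = j"
  by (simp add: bits_def)

lemma bits_0 [simp]: "bits \<delta> \<omega> 0 = []"
  by (simp add: bits_def)

lemma bits_Suc: "bits \<delta> \<omega> (Suc j) = bits \<delta> \<omega> j @ [\<omega> (real j * \<delta>) < \<omega> (real (Suc j) * \<delta>)]"
  by (simp add: bits_def)

lemma take_bits: "i \<le> j \<Longrightarrow> take i (bits \<delta> \<omega> j) = bits \<delta> \<omega> i"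
  by (simp add: bits_def take_map min_def)

lemma measurable_bits [measurable]: "(\<lambda>\<omega>. bits \<delta> \<omega> j) \<in> Nspace \<rightarrow>\<^sub>M count_space UNIV"
proof (induction j)
  case (Suc j)
  note [measurable] = Suc
  have "(\<lambda>\<omega>. (bits \<delta> \<omega> j, \<omega> (real j * \<delta>) < \<omega> (real (Suc j) * \<delta>)))
      \<in> Nspace \<rightarrow>\<^sub>M count_space UNIV \<Otimes>\<^sub>M count_space UNIV" by measurable
  then have "(\<lambda>\<omega>. (bits \<delta> \<omega> j, \<omega> (real j * \<delta>) < \<omega> (real (Suc j) * \<delta>))) \<in> Nspace \<rightarrow>\<^sub>M count_space UNIV"
    by (simp add: pair_measure_countable)
  from measurable_compose[OF this, of "\<lambda>(x, y). x @ [y]" "count_space UNIV"]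
  show ?case by (simp add: bits_Suc)
qed simp

text \<open>In \<open>adaptive\<close>, the image cell \<open>j\<close> has length \<open>\<delta>\<close> and corresponds to a source cell of
  length \<open>lam \<beta> * \<delta>\<close>, where \<open>\<beta>\<close> records which of the earlier cells contain a point.\<close>
locale adaptive =
  fixes \<delta> :: real and M :: nat and lam :: "bool list \<Rightarrow> real" and K :: real
  assumes delta: "0 < \<delta>" and K: "1 \<le> K" and lam: "\<And>\<beta>. 1 / K \<le> lam \<beta> \<and> lam \<beta> \<le> K"
begin

lemma lam_pos: "0 < lam \<beta>"
  using lam[of \<beta>] K by (smt (verit) divide_pos_pos)

text \<open>The point \<open>src \<beta> (Suc j)\<close> reads only the first j bits of \<beta>. So
  the right end of source cell j is already known when that cell begins, which is the origin of
  predictability.\<close>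

definition src :: "bool list \<Rightarrow> nat \<Rightarrow> real" where
  "src \<beta> j = (\<Sum>i<j. lam (take i \<beta>) * \<delta>)"

definition img :: "nat \<Rightarrow> real" where
  "img j = real j * \<delta>"

lemma src_0 [simp]: "src \<beta> 0 = 0" and img_0 [simp]: "img 0 = 0"
  by (auto simp: src_def img_def)

lemma src_Suc: "src \<beta> (Suc j) = src \<beta> j + lam (take j \<beta>) * \<delta>"
  by (simp add: src_def)

lemma img_Suc: "img (Suc j) = img j + \<delta>"
  by (simp add: img_def algebra_simps)

lemma grid_src: "grid n (src \<beta>)" and grid_img: "grid n img"
  using delta lam_pos by (auto simp: grid_def src_Suc img_Suc)

lemma src_nonneg: "0 \<le> src \<beta> j"
  using delta lam_pos by (auto simp: src_def less_imp_le intro!: sum_nonneg mult_nonneg_nonneg)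

lemma src_cong: "take j \<beta> = take j \<beta>' \<Longrightarrow> i \<le> j \<Longrightarrow> src \<beta> i = src \<beta>' i"
  unfolding src_def by (intro sum.cong) (auto dest: arg_cong[where f = "take _"] simp: min_def, metis min.absorb1 less_imp_le order.trans take_take)

lemma src_take: "src (take j \<beta>) j = src \<beta> j"
  by (rule src_cong[of j]) auto

text \<open>The bits of the image path, computed from the source path.\<close>
primrec sbits :: "path \<Rightarrow> nat \<Rightarrow> bool list" where
  "sbits \<omega> 0 = []"
| "sbits \<omega> (Suc j) = sbits \<omega> j @
    [\<omega> (src (sbits \<omega> j) j) < \<omega> (src (sbits \<omega> j) j + lam (sbits \<omega> j) * \<delta>)]"

lemma length_sbits [simp]: "length (sbits \<omega> j) = j"
  by (induction j) auto

lemma take_sbits: "i \<le> j \<Longrightarrow> take i (sbits \<omega> j) = sbits \<omega> i"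
  by (induction j) (auto simp: le_Suc_eq)

definition change :: "bool list \<Rightarrow> real \<Rightarrow> real" where
  "change \<beta> = PL M img (src \<beta>)"

lemma change_img: "j \<le> M \<Longrightarrow> change \<beta> (img j) = src \<beta> j"
  unfolding change_def by (rule PL_grid[OF grid_img]) auto

lemma sbits_eq_iff:
  assumes "length \<beta> = M"
  shows "sbits \<omega> M = \<beta> \<longleftrightarrow> bits \<delta> (\<lambda>t. \<omega> (change \<beta> t)) M = \<beta>"
proof -
  have b: "bits \<delta> (\<lambda>t. \<omega> (change \<beta> t)) (Suc j) = bits \<delta> (\<lambda>t. \<omega> (change \<beta> t)) j @ [\<omega> (src \<beta> j) < \<omega> (src \<beta> (Suc j))]"
    if "j < M" for j
    using change_img[of j \<beta>] change_img[of "Suc j" \<beta>] that by (simp add: bits_Suc img_def)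
  have s: "sbits \<omega> (Suc j) = sbits \<omega> j @ [\<omega> (src \<beta> j) < \<omega> (src \<beta> (Suc j))]"
    if "sbits \<omega> j = take j \<beta>" for j
    using that by (simp add: src_take src_Suc)
  have tk: "take (Suc j) \<beta> = take j \<beta> @ [\<beta> ! j]" if "j < M" for j
    using that assms by (simp add: take_Suc_conv_app_nth)
  show ?thesis
  proof
    assume L: "sbits \<omega> M = \<beta>"
    have "j \<le> M \<Longrightarrow> bits \<delta> (\<lambda>t. \<omega> (change \<beta> t)) j = sbits \<omega> j" for j
    proof (induction j)
      case (Suc j)
      then show ?case using b[of j] s[of j] take_sbits[of j M \<omega>] L by simp
    qed simp
    then show "bits \<delta> (\<lambda>t. \<omega> (change \<beta> t)) M = \<beta>" using L by simp
  next
    assume R: "bits \<delta> (\<lambda>t. \<omega> (change \<beta> t)) M = \<beta>"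
    have "j \<le> M \<Longrightarrow> sbits \<omega> j = take j \<beta>" for j
    proof (induction j)
      case (Suc j)
      have "take (Suc j) \<beta> = take j \<beta> @ [\<omega> (src \<beta> j) < \<omega> (src \<beta> (Suc j))]"
        using b[of j] take_bits[of "Suc j" M \<delta> "\<lambda>t. \<omega> (change \<beta> t)"] take_bits[of j M \<delta> "\<lambda>t. \<omega> (change \<beta> t)"] Suc.prems R
        by simp
      then show ?case using Suc s[of j] by simp
    qed simp
    then show "sbits \<omega> M = \<beta>" using assms by simp
  qed
qed

definition Y :: "path \<Rightarrow> path" where
  "Y \<omega> = (\<lambda>t. \<omega> (change (sbits \<omega> M) t))"

lemma measurable_sbits [measurable]: "(\<lambda>\<omega>. sbits \<omega> j) \<in> Nspace \<rightarrow>\<^sub>M count_space UNIV"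
proof (induction j)
  case (Suc j)
  note [measurable] = Suc
  have *: "(\<lambda>\<omega>. \<omega> (f (sbits \<omega> j))) \<in> Nspace \<rightarrow>\<^sub>M (borel :: nat measure)" for f
    by (rule measurable_compose_countable[OF _ Suc]) simp
  note [measurable] = *[of "\<lambda>\<beta>. src \<beta> j"] *[of "\<lambda>\<beta>. src \<beta> j + lam \<beta> * \<delta>"]
  have "(\<lambda>\<omega>. (sbits \<omega> j, \<omega> (src (sbits \<omega> j) j) < \<omega> (src (sbits \<omega> j) j + lam (sbits \<omega> j) * \<delta>)))
      \<in> Nspace \<rightarrow>\<^sub>M count_space UNIV \<Otimes>\<^sub>M count_space UNIV" by measurable
  then have "(\<lambda>\<omega>. (sbits \<omega> j, \<omega> (src (sbits \<omega> j) j) < \<omega> (src (sbits \<omega> j) j + lam (sbits \<omega> j) * \<delta>))) \<in> Nspace \<rightarrow>\<^sub>M count_space UNIV"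
    by (simp add: pair_measure_countable)
  from measurable_compose[OF this, of "\<lambda>(x, y). x @ [y]" "count_space UNIV"]
  show ?case by simp
qed simp

lemma Nfrak_change: "\<omega> \<in> Nfrak \<Longrightarrow> (\<lambda>t. \<omega> (change \<beta> t)) \<in> Nfrak"
  unfolding change_def by (rule Nfrak_comp_PL[OF _ grid_img grid_src]) auto

lemma measurable_change: "(\<lambda>\<omega> t. \<omega> (change \<beta> t)) \<in> Nspace \<rightarrow>\<^sub>M Nspace"
  unfolding change_def by (rule measurable_comp_PL[OF grid_img grid_src]) auto

lemma measurable_Y [measurable]: "Y \<in> Nspace \<rightarrow>\<^sub>M Nspace"
proof (rule measurable_into_Nspace)
  show "Y \<omega> \<in> Nfrak" if "\<omega> \<in> space Nspace" for \<omega>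
    using that by (auto simp: Y_def intro: Nfrak_change)
  show "(\<lambda>\<omega>. Y \<omega> u) \<in> Nspace \<rightarrow>\<^sub>M count_space UNIV" for u
    unfolding Y_def by (rule measurable_compose_countable[OF _ measurable_sbits]) simp
qed

text \<open>The likelihood ratio, against the unit rate law, of a point process whose intensity on
  each cell is \<open>lam\<close> of the bits of the earlier cells.\<close>

definition LD :: "path \<Rightarrow> real" where
  "LD \<omega> = (\<Prod>j<M. lam (bits \<delta> \<omega> j) ^ (\<omega> (img (Suc j)) - \<omega> (img j)) * exp (- (lam (bits \<delta> \<omega> j) - 1) * \<delta>))"

lemma measurable_LD [measurable]: "LD \<in> borel_measurable Nspace"
proof -
  have [measurable]: "(\<lambda>\<omega>. lam (bits \<delta> \<omega> j)) \<in> borel_measurable Nspace" for j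
    by (rule measurable_compose[OF measurable_bits]) simp
  show ?thesis unfolding LD_def by measurable
qed

lemma LD_pos: "0 < LD \<omega>"
  unfolding LD_def using lam_pos by (intro prod_pos) simp

lemma distr_Y: "distr pi_law Nspace Y = density pi_law (\<lambda>\<omega>. ennreal (LD \<omega>))"
proof (rule measure_eqI)
  fix A assume "A \<in> sets (distr pi_law Nspace Y)"
  then have A [measurable]: "A \<in> sets Nspace" by simp
  define B where "B = {\<beta> :: bool list. length \<beta> = M}"
  have B: "finite B"
    unfolding B_def using finite_lists_length_eq[of "UNIV :: bool set" M] by simp
  define D where "D \<beta> \<omega> = (\<Prod>j<M. cell_density img (src \<beta>) j \<omega>)" for \<beta> \<omega>
  \<comment> \<open>When \<beta> is the full bit string of the path itself, the slope of cell j is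
    \<open>lam\<close> at the first j of these bits, so the deterministic density becomes the
    adaptive one.\<close>
  have D: "D (bits \<delta> \<omega> M) \<omega> = LD \<omega>" for \<omega>
    unfolding D_def LD_def using delta
    by (intro prod.cong) (auto simp: cell_density_def src_Suc img_Suc take_bits algebra_simps)
  have [measurable]: "{\<omega>\<in>Nfrak. bits \<delta> \<omega> M = \<beta>} \<in> sets Nspace" for \<beta>
  proof -
    have "{\<omega>\<in>space Nspace. bits \<delta> \<omega> M = \<beta>} \<in> sets Nspace" by measurable
    then show ?thesis by simp
  qed
  have [measurable]: "D \<beta> \<in> borel_measurable Nspace" for \<beta>
    unfolding D_def by measurable
  have piece: "{\<omega>\<in>Nfrak. Y \<omega> \<in> A \<and> sbits \<omega> M = \<beta>}
      = (\<lambda>\<omega> t. \<omega> (change \<beta> t)) -` (A \<inter> {\<omega>\<in>Nfrak. bits \<delta> \<omega> M = \<beta>}) \<inter> space pi_law" if "\<beta> \<in> B" for \<beta>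
  proof (rule set_eqI)
    fix \<omega>
    show "\<omega> \<in> {\<omega>\<in>Nfrak. Y \<omega> \<in> A \<and> sbits \<omega> M = \<beta>} \<longleftrightarrow>
      \<omega> \<in> (\<lambda>\<omega> t. \<omega> (change \<beta> t)) -` (A \<inter> {\<omega>\<in>Nfrak. bits \<delta> \<omega> M = \<beta>}) \<inter> space pi_law"
      using that sbits_eq_iff[of \<beta> \<omega>] Nfrak_change[of \<omega> \<beta>]
      by (cases "sbits \<omega> M = \<beta>") (auto simp: B_def Y_def)
  qed
  have "emeasure (distr pi_law Nspace Y) A = emeasure pi_law {\<omega>\<in>Nfrak. Y \<omega> \<in> A}"
    by (subst emeasure_distr) (auto intro!: arg_cong[where f = "emeasure pi_law"])
  also have "{\<omega>\<in>Nfrak. Y \<omega> \<in> A} = (\<Union>\<beta>\<in>B. {\<omega>\<in>Nfrak. Y \<omega> \<in> A \<and> sbits \<omega> M = \<beta>})"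
    by (auto simp: B_def)
  also have "emeasure pi_law \<dots> = (\<Sum>\<beta>\<in>B. emeasure pi_law {\<omega>\<in>Nfrak. Y \<omega> \<in> A \<and> sbits \<omega> M = \<beta>})"
  proof (rule sum_emeasure[symmetric])
    show "(\<lambda>\<beta>. {\<omega>\<in>Nfrak. Y \<omega> \<in> A \<and> sbits \<omega> M = \<beta>}) ` B \<subseteq> sets pi_law"
    proof safe
      fix \<beta>
      have "{\<omega>\<in>space Nspace. Y \<omega> \<in> A \<and> sbits \<omega> M = \<beta>} \<in> sets Nspace" by measurable
      then show "{\<omega>\<in>Nfrak. Y \<omega> \<in> A \<and> sbits \<omega> M = \<beta>} \<in> sets pi_law" by simp
    qed
  qed (auto simp: disjoint_family_on_def B)
  also have "\<dots> = (\<Sum>\<beta>\<in>B. \<integral>\<^sup>+\<omega>. ennreal (LD \<omega>) * indicator (A \<inter> {\<omega>\<in>Nfrak. bits \<delta> \<omega> M = \<beta>}) \<omega> \<partial>pi_law)"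
  proof (rule sum.cong)
    fix \<beta> assume "\<beta> \<in> B"
    note [measurable] = measurable_change[of \<beta>]
    have "emeasure pi_law {\<omega>\<in>Nfrak. Y \<omega> \<in> A \<and> sbits \<omega> M = \<beta>}
      = emeasure (distr pi_law Nspace (\<lambda>\<omega> t. \<omega> (change \<beta> t))) (A \<inter> {\<omega>\<in>Nfrak. bits \<delta> \<omega> M = \<beta>})"
      unfolding piece[OF \<open>\<beta> \<in> B\<close>] by (rule emeasure_distr[symmetric]) auto
    also have "distr pi_law Nspace (\<lambda>\<omega> t. \<omega> (change \<beta> t)) = density pi_law (\<lambda>\<omega>. ennreal (D \<beta> \<omega>))"
      unfolding change_def D_def by (rule distr_comp_PL[OF grid_img grid_src]) auto
    also have "emeasure \<dots> (A \<inter> {\<omega>\<in>Nfrak. bits \<delta> \<omega> M = \<beta>})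
      = (\<integral>\<^sup>+\<omega>. ennreal (D \<beta> \<omega>) * indicator (A \<inter> {\<omega>\<in>Nfrak. bits \<delta> \<omega> M = \<beta>}) \<omega> \<partial>pi_law)"
      by (rule emeasure_density) auto
    also have "\<dots> = (\<integral>\<^sup>+\<omega>. ennreal (LD \<omega>) * indicator (A \<inter> {\<omega>\<in>Nfrak. bits \<delta> \<omega> M = \<beta>}) \<omega> \<partial>pi_law)"
      by (intro nn_integral_cong) (auto simp: D split: split_indicator)
    finally show "emeasure pi_law {\<omega>\<in>Nfrak. Y \<omega> \<in> A \<and> sbits \<omega> M = \<beta>} = \<dots>" .
  qed simp
  also have "\<dots> = (\<integral>\<^sup>+\<omega>. (\<Sum>\<beta>\<in>B. ennreal (LD \<omega>) * indicator (A \<inter> {\<omega>\<in>Nfrak. bits \<delta> \<omega> M = \<beta>}) \<omega>) \<partial>pi_law)"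
    by (rule nn_integral_sum[symmetric]) auto
  also have "\<dots> = (\<integral>\<^sup>+\<omega>. ennreal (LD \<omega>) * indicator A \<omega> \<partial>pi_law)"
  proof (rule nn_integral_cong)
    fix \<omega> assume w: "\<omega> \<in> space pi_law"
    have "(\<Sum>\<beta>\<in>B. ennreal (LD \<omega>) * indicator (A \<inter> {\<omega>\<in>Nfrak. bits \<delta> \<omega> M = \<beta>}) \<omega>)
       = (\<Sum>\<beta>\<in>B. if \<beta> = bits \<delta> \<omega> M then ennreal (LD \<omega>) * indicator A \<omega> else 0)"
      using w by (intro sum.cong) (auto split: split_indicator)
    also have "\<dots> = ennreal (LD \<omega>) * indicator A \<omega>"
      using B by (simp add: B_def)
    finally show "(\<Sum>\<beta>\<in>B. ennreal (LD \<omega>) * indicator (A \<inter> {\<omega>\<in>Nfrak. bits \<delta> \<omega> M = \<beta>}) \<omega>) = ennreal (LD \<omega>) * indicator A \<omega>" .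
  qed
  also have "\<dots> = emeasure (density pi_law (\<lambda>\<omega>. ennreal (LD \<omega>))) A"
    by (rule emeasure_density[symmetric]) auto
  finally show "emeasure (distr pi_law Nspace Y) A = emeasure (density pi_law (\<lambda>\<omega>. ennreal (LD \<omega>))) A" .
qed simp

section \<open>The rate process and its membership in the admissible class\<close>

definition ydot :: "path \<Rightarrow> real \<Rightarrow> real" where
  "ydot \<omega> t = 1 + (\<Sum>j<M. if src (sbits \<omega> M) j < t \<and> t \<le> src (sbits \<omega> M) (Suc j) then 1 / lam (sbits \<omega> j) - 1 else 0)"

lemma has_integral_step:
  fixes a b c u :: real
  assumes "0 \<le> a" "a < b" "0 \<le> u"
  shows "((\<lambda>t. if a < t \<and> t \<le> b then c else 0) has_integral c * clip (b - a) (u - a)) {0..u}"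
proof -
  have eq: "{a..b} \<inter> {0..u} = {a..min b u}" using assms by auto
  have "((\<lambda>t. c) has_integral c * clip (b - a) (u - a)) {a..min b u}"
  proof (cases "a \<le> u")
    case True
    then have "clip (b - a) (u - a) = min b u - a" using assms by (auto simp: clip_def)
    then show ?thesis using has_integral_const_real[of c a "min b u"] True assms by (simp add: mult.commute)
  next
    case False
    then have "{a..min b u} = {}" "clip (b - a) (u - a) = 0" using assms by (auto simp: clip_def)
    then show ?thesis by simp
  qed
  then have "((\<lambda>t. if t \<in> {a..b} then c else 0) has_integral c * clip (b - a) (u - a)) {0..u}"
    unfolding eq[symmetric] by (subst has_integral_restrict_Int) simp
  then show ?thesis
    by (rule has_integral_spike_finite[of "{a}", rotated 2]) auto
qed

text \<open>The integral of the rate runs from source time to image time, hence the slope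
  \<open>1 / lam\<close> on source cells and the roles of the two grids exchanged in comparison with
  \<open>change\<close>.\<close>

lemma yfun_ydot:
  assumes "0 \<le> u"
  shows "yfun ydot \<omega> u = PL M (src (sbits \<omega> M)) img u"
proof -
  let ?a = "src (sbits \<omega> M)"
  have "((\<lambda>t. 1 + (\<Sum>j<M. if ?a j < t \<and> t \<le> ?a (Suc j) then 1 / lam (sbits \<omega> j) - 1 else 0)) has_integral
     (u + (\<Sum>j<M. (1 / lam (sbits \<omega> j) - 1) * clip (?a (Suc j) - ?a j) (u - ?a j)))) {0..u}"
    using has_integral_const_real[of "1 :: real" 0 u] assms grid_src[of M "sbits \<omega> M"]
    by (intro has_integral_add has_integral_sum has_integral_step src_nonneg) (auto simp: grid_def)
  then have "yfun ydot \<omega> u = u + (\<Sum>j<M. (1 / lam (sbits \<omega> j) - 1) * clip (?a (Suc j) - ?a j) (u - ?a j))"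
    unfolding yfun_def ydot_def by (rule integral_unique)
  also have "\<dots> = PL M ?a img u"
    unfolding PL_def using delta by (simp add: src_Suc img_Suc take_sbits)
  finally show ?thesis .
qed

lemma change_nonneg_iff: "0 \<le> change \<beta> t \<longleftrightarrow> 0 \<le> t"
proof -
  have "strict_mono (change \<beta>)"
    unfolding change_def by (rule PL_strict_mono[OF grid_img grid_src]) simp
  moreover have "change \<beta> 0 = 0" using change_img[of 0 \<beta>] by simp
  ultimately show ?thesis by (metis strict_mono_less_eq)
qed

lemma ystar_ydot:
  assumes "0 \<le> t"
  shows "ystar ydot \<omega> t = change (sbits \<omega> M) t"
  unfolding ystar_def
proof (rule the_equality)
  have inv: "PL M (src \<beta>) img (change \<beta> x) = x" "change \<beta> (PL M (src \<beta>) img x) = x" for \<beta> x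
    unfolding change_def by (intro PL_inverse grid_img grid_src; simp)+
  show "0 \<le> change (sbits \<omega> M) t \<and> yfun ydot \<omega> (change (sbits \<omega> M) t) = t"
    using assms by (simp add: change_nonneg_iff yfun_ydot inv)
  show "u = change (sbits \<omega> M) t" if "0 \<le> u \<and> yfun ydot \<omega> u = t" for u
    using that yfun_ydot[of u \<omega>] inv(2)[of "sbits \<omega> M" u] by simp
qed

lemma Ymap_ydot: "\<omega> \<in> Nfrak \<Longrightarrow> Ymap ydot \<omega> = Y \<omega>"
  using change_nonneg_iff[of "sbits \<omega> M"]
  by (auto simp: Ymap_def Y_def fun_eq_iff ystar_ydot Nfrak_nonpos[OF Nfrak_change, unfolded o_def])

lemma measurable_Ymap_ydot [measurable]: "Ymap ydot \<in> Nspace \<rightarrow>\<^sub>M Nspace"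
  by (subst measurable_cong[where g = Y]) (auto simp: Ymap_ydot)

lemma distr_Ymap_ydot: "distr pi_law Nspace (Ymap ydot) = density pi_law (\<lambda>\<omega>. ennreal (LD \<omega>))"
  unfolding distr_Y[symmetric] by (rule distr_cong) (auto simp: Ymap_ydot)

text \<open>Unrolls the recursion for a given \<beta>: the event becomes finitely many conditions at
  deterministic times no later than \<open>src \<beta> j\<close>, which places it in the filtration
  at that time.\<close>

lemma sbits_eq_iff_nth:
  "length \<beta> = j \<Longrightarrow> sbits \<omega> j = \<beta> \<longleftrightarrow> (\<forall>i<j. \<beta> ! i = (\<omega> (src \<beta> i) < \<omega> (src \<beta> (Suc i))))"
proof (induction j arbitrary: \<beta>)
  case (Suc j)
  define \<gamma> where "\<gamma> = take j \<beta>"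
  have len: "length \<gamma> = j" and \<beta>: "\<beta> = \<gamma> @ [\<beta> ! j]"
    using Suc.prems by (auto simp: \<gamma>_def take_Suc_conv_app_nth[symmetric])
  have src: "src \<gamma> i = src \<beta> i" if "i \<le> j" for i
    using that by (intro src_cong[of j]) (auto simp: \<gamma>_def)
  have nth: "\<gamma> ! i = \<beta> ! i" if "i < j" for i using that by (simp add: \<gamma>_def)
  have "sbits \<omega> (Suc j) = \<beta> \<longleftrightarrow> sbits \<omega> j = \<gamma> \<and> \<beta> ! j = (\<omega> (src \<gamma> j) < \<omega> (src \<gamma> j + lam \<gamma> * \<delta>))"
    by (subst \<beta>) (auto simp: len)
  also have "src \<gamma> j + lam \<gamma> * \<delta> = src \<beta> (Suc j)"
    using src[of j] by (simp add: src_Suc \<gamma>_def)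
  also have "sbits \<omega> j = \<gamma> \<longleftrightarrow> (\<forall>i<j. \<beta> ! i = (\<omega> (src \<beta> i) < \<omega> (src \<beta> (Suc i))))"
    unfolding Suc.IH[OF len] by (auto simp: src nth)
  finally show ?case by (auto simp: src less_Suc_eq)
qed simp

definition active :: "path \<Rightarrow> nat \<Rightarrow> real \<Rightarrow> bool" where
  "active \<omega> j t \<longleftrightarrow> src (sbits \<omega> M) j < t \<and> t \<le> src (sbits \<omega> M) (Suc j)"

lemma ydot_active: "ydot \<omega> t = 1 + (\<Sum>j<M. if active \<omega> j t then 1 / lam (sbits \<omega> j) - 1 else 0)"
  by (simp add: ydot_def active_def)

lemma active_unique:
  assumes "active \<omega> i t" "active \<omega> j t"
  shows "i = j"
proof -
  have "\<not> i' < j'" if "active \<omega> i' t" "active \<omega> j' t" for i' j'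
    using that grid_mono[OF grid_src[of j'], of "Suc i'" j' "sbits \<omega> M"] by (auto simp: active_def)
  then show ?thesis using assms by (meson linorder_neqE_nat)
qed

lemma ydot_cases:
  obtains "\<And>j. j < M \<Longrightarrow> \<not> active \<omega> j t" "ydot \<omega> t = 1"
  | j where "j < M" "active \<omega> j t" "ydot \<omega> t = 1 / lam (sbits \<omega> j)"
proof (cases "\<exists>j<M. active \<omega> j t")
  case True
  then obtain j where j: "j < M" "active \<omega> j t" by blast
  then have "active \<omega> i t \<longleftrightarrow> i = j" for i using active_unique by blast
  then have "ydot \<omega> t = 1 / lam (sbits \<omega> j)" using j by (simp add: ydot_active)
  then show thesis using that j by blast
next
  case False
  then show thesis using that by (simp add: ydot_active)
qed

lemma src_bound: "src \<beta> j \<le> real j * (K * \<delta>)"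
  unfolding src_def using lam delta sum_bounded_above[of "{..<j}" "\<lambda>i. lam (take i \<beta>) * \<delta>" "K * \<delta>"]
  by (simp add: mult_right_mono)

text \<open>The rate is 1 plus a finite linear combination of indicators of predictable rectangles,
  one for each cell and each possible history before that cell.\<close>

lemma predictable_ydot: "(\<lambda>(s, \<omega>). ydot \<omega> s) \<in> borel_measurable Pred"
proof -
  have space: "space Pred = {0<..} \<times> Nfrak"
    unfolding Pred_def
  proof (rule space_measure_of, safe)
    fix s t a b :: real and A x assume "A \<in> sets (Fil s)" "x \<in> A"
    then show "x \<in> Nfrak" using sets.sets_into_space[of A "Fil s"]
      by (auto simp: Fil_def space_measure_of_conv)
  qed auto
  have Fil_eval: "{\<omega>\<in>Nfrak. P (\<omega> u) (\<omega> v)} \<in> sets (Fil s)" if "u \<le> s" "v \<le> s" for u v s P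
  proof -
    have sp: "space (Fil s) = Nfrak" unfolding Fil_def by (rule space_measure_of) auto
    have [measurable]: "(\<lambda>\<omega>. \<omega> w) \<in> Fil s \<rightarrow>\<^sub>M count_space UNIV" if "w \<le> s" for w
    proof (subst measurable_count_space_eq2_countable)
      have *: "(\<lambda>\<omega>. \<omega> w) -` {k} \<inter> space (Fil s) \<in> sets (Fil s)" for k :: nat
      proof -
        have "(\<lambda>\<omega>. \<omega> w) -` {k} \<inter> space (Fil s) = {\<omega>\<in>Nfrak. \<omega> w = k}" by (auto simp: sp)
      also have "\<dots> \<in> sets (Fil s)" unfolding Fil_def using that by (subst sets_measure_of) auto
        finally show ?thesis .
      qed
      show "(\<lambda>\<omega>. \<omega> w) \<in> space (Fil s) \<rightarrow> UNIV \<and>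
          (\<forall>k\<in>UNIV. (\<lambda>\<omega>. \<omega> w) -` {k} \<inter> space (Fil s) \<in> sets (Fil s))"
        using * by auto
    qed
    have "{\<omega>\<in>Nfrak. P (\<omega> u) (\<omega> v)} = (\<Union>(k, l)\<in>{(k, l). P k l}. {\<omega>\<in>space (Fil s). \<omega> u = k \<and> \<omega> v = l})"
      by (auto simp: sp)
    also have "\<dots> \<in> sets (Fil s)"
    proof (rule sets.countable_UN'')
      show "countable {(k :: nat, l :: nat). P k l}" by simp
      fix x :: "nat \<times> nat"
      show "(case x of (k, l) \<Rightarrow> {\<omega>\<in>space (Fil s). \<omega> u = k \<and> \<omega> v = l}) \<in> sets (Fil s)"
        using that by (cases x) simp
    qed
    finally show ?thesis .
  qed
  define B where "B j = {\<beta> :: bool list. length \<beta> = j}" for j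
  have B: "finite (B j)" for j
    unfolding B_def using finite_lists_length_eq[of "UNIV :: bool set" j] by simp
  \<comment> \<open>For \<beta> of length j both ends of the cell are constants and the history is
    decided at the left end. The left-open intervals are those of the generating rectangles of
    \<open>Pred\<close>.\<close>
  define R where "R j \<beta> = {src \<beta> j<..src \<beta> (Suc j)} \<times> {\<omega>\<in>Nfrak. sbits \<omega> j = \<beta>}" for j \<beta>
  have R: "R j \<beta> \<in> sets Pred" if "\<beta> \<in> B j" for j \<beta>
  proof -
    have len: "length \<beta> = j" using that by (simp add: B_def)
    have "{\<omega>\<in>Nfrak. sbits \<omega> j = \<beta>} = space (Fil (src \<beta> j)) \<inter>
        (\<Inter>i\<in>{..<j}. {\<omega>\<in>Nfrak. \<beta> ! i = (\<omega> (src \<beta> i) < \<omega> (src \<beta> (Suc i)))})"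
      unfolding sbits_eq_iff_nth[OF len] by (auto simp: Fil_def space_measure_of_conv)
    also have "\<dots> \<in> sets (Fil (src \<beta> j))"
    \<comment> \<open>With no earlier cell the intersection has an empty index set, and the event is
      the whole space.\<close>
    proof (cases "j = 0")
      case False
      then show ?thesis
        using grid_mono[OF grid_src[of j \<beta>]] by (intro sets.Int sets.finite_INT Fil_eval) auto
    qed simp
    finally have "{\<omega>\<in>Nfrak. sbits \<omega> j = \<beta>} \<in> sets (Fil (src \<beta> j))" .
    moreover have "src \<beta> j < src \<beta> (Suc j)" using grid_src[of "Suc j" \<beta>] by (simp add: grid_def)
    moreover have "{{s<..t} \<times> A | s t A. 0 \<le> s \<and> s < t \<and> A \<in> sets (Fil s)} \<subseteq> Pow ({0<..} \<times> Nfrak)"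
    proof safe
      fix s t a b :: real and A x assume "A \<in> sets (Fil s)" "x \<in> A"
      then show "x \<in> Nfrak" using sets.sets_into_space[of A "Fil s"]
        by (auto simp: Fil_def space_measure_of_conv)
    qed auto
    ultimately show ?thesis
      unfolding Pred_def R_def using src_nonneg[of \<beta> j]
      by (subst sets_measure_of) (auto intro!: sigma_sets.Basic)
  qed
  have [measurable]: "(\<lambda>x. 1 + (\<Sum>j<M. \<Sum>\<beta>\<in>B j. (1 / lam \<beta> - 1) * indicator (R j \<beta>) x)) \<in> borel_measurable Pred"
    using R by (intro borel_measurable_add borel_measurable_sum borel_measurable_times borel_measurable_indicator) auto
  show ?thesis
  proof (subst measurable_cong)
    fix x assume "x \<in> space Pred"
    then obtain s \<omega> where x: "x = (s, \<omega>)" "0 < s" "\<omega> \<in> Nfrak" by (auto simp: space)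
    have "(\<Sum>\<beta>\<in>B j. (1 / lam \<beta> - 1) * indicator (R j \<beta>) x) = (if active \<omega> j s then 1 / lam (sbits \<omega> j) - 1 else 0)"
      if "j < M" for j
    proof -
      have s: "src (sbits \<omega> j) i = src (sbits \<omega> M) i" if "i \<le> Suc j" for i
      proof (cases "i = Suc j")
        case True
        then show ?thesis using src_take[of j "sbits \<omega> M"] take_sbits[of j M \<omega>] \<open>j < M\<close> by (simp add: src_Suc)
      next
        case False
        then show ?thesis using take_sbits[of j M \<omega>] \<open>j < M\<close> \<open>i \<le> Suc j\<close> by (intro src_cong[of j]) auto
      qed
      have "(\<Sum>\<beta>\<in>B j. (1 / lam \<beta> - 1) * indicator (R j \<beta>) x)
        = (\<Sum>\<beta>\<in>B j. if \<beta> = sbits \<omega> j then (if active \<omega> j s then 1 / lam (sbits \<omega> j) - 1 else 0) else 0)"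
        using x by (intro sum.cong refl) (auto simp: R_def active_def s split: split_indicator)
      also have "\<dots> = (if active \<omega> j s then 1 / lam (sbits \<omega> j) - 1 else 0)"
        using B by (simp add: B_def)
      finally show ?thesis .
    qed
    then show "(case x of (s, \<omega>) \<Rightarrow> ydot \<omega> s) = 1 + (\<Sum>j<M. \<Sum>\<beta>\<in>B j. (1 / lam \<beta> - 1) * indicator (R j \<beta>) x)"
      by (simp add: x ydot_active)
  qed measurable
qed

lemma Ppp_ydot: "Ppp ydot"
  unfolding Ppp_def
proof (intro conjI AE_I2)
  show "piecewise_const (ydot \<omega>)" for \<omega>
    unfolding piecewise_const_def
  proof (intro exI[of _ "src (sbits \<omega> M) ` {..M}"] conjI allI impI)
    fix s t :: real assume st: "s < t" "{s..t} \<inter> src (sbits \<omega> M) ` {..M} = {}"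
    have "active \<omega> j s = active \<omega> j t" if "j < M" for j
    proof -
      have "src (sbits \<omega> M) j \<notin> {s..t}" "src (sbits \<omega> M) (Suc j) \<notin> {s..t}" using st(2) that by auto
      then show ?thesis using st(1) by (auto simp: active_def)
    qed
    then show "ydot \<omega> s = ydot \<omega> t" by (simp add: ydot_active)
  qed simp
  show "\<exists>\<epsilon> T. 0 < \<epsilon> \<and> \<epsilon> < 1 \<and> 0 < T \<and> (AE \<omega> in pi_law. \<forall>s>0. \<epsilon> \<le> ydot \<omega> s \<and> ydot \<omega> s \<le> 1 / \<epsilon> \<and> (T \<le> s \<longrightarrow> ydot \<omega> s = 1))"
  \<comment> \<open>\<open>K\<close> may equal 1, and \<open>K + 1\<close> makes the lower bound
    strictly less than 1. All source cells end by \<open>real M * (K * \<delta>)\<close>; the extra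
    1 keeps the horizon positive when \<open>M = 0\<close>.\<close>
  proof (rule exI[of _ "1 / (K + 1)"], rule exI[of _ "real M * (K * \<delta>) + 1"], intro conjI AE_I2 allI impI)
    fix \<omega> and s :: real
    have inv: "1 / K \<le> 1 / lam \<beta> \<and> 1 / lam \<beta> \<le> K" for \<beta>
      using lam[of \<beta>] lam_pos[of \<beta>] K by (auto simp: field_simps)
    have "1 / K \<le> ydot \<omega> s \<and> ydot \<omega> s \<le> K"
      using inv K by (cases rule: ydot_cases[of \<omega> s]) auto
    moreover have "1 / (K + 1) \<le> 1 / K" using K by (simp add: frac_le)
    ultimately show "1 / (K + 1) \<le> ydot \<omega> s" "ydot \<omega> s \<le> 1 / (1 / (K + 1))" by auto
    assume "real M * (K * \<delta>) + 1 \<le> s"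
    then have "\<not> active \<omega> j s" if "j < M" for j
      using grid_mono[OF grid_src[of M], of "Suc j" M "sbits \<omega> M"] that src_bound[of "sbits \<omega> M" M]
      by (auto simp: active_def)
    then show "ydot \<omega> s = 1" by (simp add: ydot_active)
  qed (use K delta in \<open>auto intro: add_nonneg_pos\<close>)
qed (rule predictable_ydot)

end

section \<open>Likelihoods of bits\<close>

text \<open>Right-continuity and the bound on jumps give around each time a ball on which the path
  rises by at most one; a Lebesgue number of this cover of the compact interval serves as
  \<eta>.\<close>

lemma Nfrak_small_increments:
  assumes w: "\<omega> \<in> Nfrak"
  obtains \<eta> where "0 < \<eta>" "\<And>s t. 0 \<le> s \<Longrightarrow> s \<le> t \<Longrightarrow> t \<le> T \<Longrightarrow> t - s < \<eta> \<Longrightarrow> \<omega> t \<le> Suc (\<omega> s)"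
proof -
  define G where "G = {ball x e | x e. 0 < e \<and> (\<forall>s\<in>ball x e. \<forall>t\<in>ball x e. \<omega> t \<le> Suc (\<omega> s))}"
  have "{0..T} \<subseteq> \<Union>G"
  proof
    fix x assume "x \<in> {0..T}"
    obtain s1 where s1: "x < s1" "\<omega> s1 = \<omega> x" using Nfrak_right[OF w] by blast
    \<comment> \<open>The jump condition speaks of positive times only. At 0 any negative time will
      do, since the path vanishes at 0.\<close>
    obtain s0 where s0: "s0 < x" "\<omega> x \<le> Suc (\<omega> s0)"
    proof (cases "x = 0")
      case True
      then show thesis using that[of "- 1"] Nfrak_nonpos[OF w, of 0] by simp
    next
      case False
      then show thesis using that Nfrak_jump[OF w, of x] \<open>x \<in> {0..T}\<close> by auto
    qed
    define e where "e = min (s1 - x) (x - s0)"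
    have "\<omega> t \<le> Suc (\<omega> s)" if "s \<in> ball x e" "t \<in> ball x e" for s t
    proof -
      have "t \<le> s1" "s0 \<le> s" using that by (auto simp: e_def dist_real_def)
      then show ?thesis using Nfrak_mono[OF w, of t s1] Nfrak_mono[OF w, of s0 s] s0 s1 by simp
    qed
    moreover have "0 < e" using s0 s1 by (simp add: e_def)
    ultimately have "ball x e \<in> G" "x \<in> ball x e" unfolding G_def by (blast, simp)
    then show "x \<in> \<Union>G" by blast
  qed
  moreover have "open A" if "A \<in> G" for A using that by (auto simp: G_def)
  ultimately obtain e where e: "0 < e" "\<forall>x\<in>{0..T}. \<exists>A\<in>G. ball x e \<subseteq> A"
    using Heine_Borel_lemma[OF compact_Icc] by metis
  have "\<omega> t \<le> Suc (\<omega> s)" if st: "0 \<le> s" "s \<le> t" "t \<le> T" "t - s < e" for s t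
  proof -
    obtain A where A: "A \<in> G" "ball s e \<subseteq> A" using bspec[OF e(2), of s] st by auto
    have "s \<in> A" "t \<in> A" using A(2) st e(1) by (auto simp: subset_iff dist_real_def)
    then show ?thesis using A(1) by (auto simp: G_def)
  qed
  with e(1) show thesis using that by blast
qed

text \<open>For \<open>r = exp c\<close> the one-cell density is a constant multiple of
  \<open>exp (c * \<omega> T)\<close>, and it integrates to 1 because it is the density of an image
  probability. No series has to be summed.\<close>

lemma integrable_exp_count:
  assumes "0 \<le> T"
  shows "integrable pi_law (\<lambda>\<omega>. exp (c * real (\<omega> T)))"
proof (cases "T = 0")
  case True
  then have "integrable pi_law (\<lambda>\<omega>. exp (c * real (\<omega> T))) \<longleftrightarrow> integrable pi_law (\<lambda>\<omega>. 1 :: real)"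
    by (intro Bochner_Integration.integrable_cong) (auto simp: Nfrak_nonpos)
  then show ?thesis by simp
next
  case False
  then have T: "0 < T" using assms by simp
  define r where "r = exp c"
  have meas: "(\<lambda>\<omega>. ennreal (r ^ (\<omega> (0 + T) - \<omega> 0) * exp (- (r - 1) * T))) \<in> borel_measurable pi_law"
    by measurable
  have "emeasure (density pi_law (\<lambda>\<omega>. ennreal (r ^ (\<omega> (0 + T) - \<omega> 0) * exp (- (r - 1) * T)))) (space pi_law) = 1"
  proof -
    have "prob_space (distr pi_law Nspace (\<lambda>\<omega> t. \<omega> (theta 0 T r t)))"
      by (rule pi.prob_space_distr) (use T measurable_comp_theta[of 0 T r] in \<open>simp add: r_def cong: measurable_cong_sets\<close>)
    then show ?thesis
      using T distr_one_cell[of 0 T r] prob_space.emeasure_space_1 by (fastforce simp: r_def)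
  qed
  then have "(\<integral>\<^sup>+\<omega>. ennreal (r ^ (\<omega> (0 + T) - \<omega> 0) * exp (- (r - 1) * T)) \<partial>pi_law) = 1"
    unfolding emeasure_density[OF meas sets.top]
    by (subst nn_integral_cong[where v = "\<lambda>\<omega>. ennreal (r ^ (\<omega> (0 + T) - \<omega> 0) * exp (- (r - 1) * T)) * indicator (space pi_law) \<omega>"]) simp_all
  then have "integrable pi_law (\<lambda>\<omega>. r ^ (\<omega> (0 + T) - \<omega> 0) * exp (- (r - 1) * T))"
    by (intro integrableI_nonneg) (auto simp: r_def)
  then have "integrable pi_law (\<lambda>\<omega>. r ^ (\<omega> (0 + T) - \<omega> 0))"
    by simp
  moreover have "integrable pi_law (\<lambda>\<omega>. r ^ (\<omega> (0 + T) - \<omega> 0)) \<longleftrightarrow> integrable pi_law (\<lambda>\<omega>. exp (c * real (\<omega> T)))"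
    by (intro Bochner_Integration.integrable_cong)
      (auto simp: Nfrak_nonpos r_def exp_of_nat_mult[symmetric] mult.commute)
  ultimately show ?thesis by simp
qed

lemma sum_increments:
  assumes "\<omega> \<in> Nfrak" "grid M s" "s 0 = 0"
  shows "(\<Sum>j<M. real (\<omega> (s (Suc j)) - \<omega> (s j))) = real (\<omega> (s M))"
  using assms(2)
proof (induction M)
  case 0
  then show ?case using assms by (simp add: Nfrak_nonpos)
next
  case (Suc M)
  have "\<omega> (s M) \<le> \<omega> (s (Suc M))"
    using Suc.prems by (intro Nfrak_mono[OF assms(1)]) (auto simp: grid_def less_imp_le)
  then show ?case using Suc grid_SucD by simp
qed

context adaptive
begin

lemma ln_LD: "ln (LD \<omega>) = (\<Sum>j<M. real (\<omega> (img (Suc j)) - \<omega> (img j)) * ln (lam (bits \<delta> \<omega> j)) - (lam (bits \<delta> \<omega> j) - 1) * \<delta>)"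
proof -
  have "ln (LD \<omega>) = (\<Sum>j<M. ln (lam (bits \<delta> \<omega> j) ^ (\<omega> (img (Suc j)) - \<omega> (img j)) * exp (- (lam (bits \<delta> \<omega> j) - 1) * \<delta>)))"
    unfolding LD_def by (intro ln_prod) (auto simp: lam_pos less_imp_neq[OF lam_pos, symmetric])
  also have "\<dots> = (\<Sum>j<M. real (\<omega> (img (Suc j)) - \<omega> (img j)) * ln (lam (bits \<delta> \<omega> j)) - (lam (bits \<delta> \<omega> j) - 1) * \<delta>)"
    using lam_pos by (intro sum.cong refl, subst ln_mult_pos) (auto simp: ln_realpow algebra_simps)
  finally show ?thesis .
qed

text \<open>The mesh and the number of cells enter only through the horizon
  \<open>real M * \<delta>\<close>, so the bound is unchanged by refinement at a fixed
  horizon.\<close>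

lemma abs_ln_LD_le:
  assumes "\<omega> \<in> Nfrak"
  shows "\<bar>ln (LD \<omega>)\<bar> \<le> ln K * real (\<omega> (img M)) + K * (real M * \<delta>)"
proof -
  have ln: "\<bar>ln (lam \<beta>)\<bar> \<le> ln K" for \<beta>
    using lam[of \<beta>] lam_pos[of \<beta>] K ln_le_cancel_iff[of "1 / K" "lam \<beta>"] ln_le_cancel_iff[of "lam \<beta>" K]
    by (auto simp: ln_div abs_le_iff)
  have lin: "\<bar>(lam \<beta> - 1) * \<delta>\<bar> \<le> K * \<delta>" for \<beta>
    using lam[of \<beta>] lam_pos[of \<beta>] K delta by (auto simp: abs_mult intro!: mult_right_mono)
  have "\<bar>ln (LD \<omega>)\<bar> \<le> (\<Sum>j<M. real (\<omega> (img (Suc j)) - \<omega> (img j)) * ln K + K * \<delta>)"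
    unfolding ln_LD
  proof (rule order.trans[OF sum_abs sum_mono])
    fix j
    show "\<bar>real (\<omega> (img (Suc j)) - \<omega> (img j)) * ln (lam (bits \<delta> \<omega> j)) - (lam (bits \<delta> \<omega> j) - 1) * \<delta>\<bar>
      \<le> real (\<omega> (img (Suc j)) - \<omega> (img j)) * ln K + K * \<delta>"
      using lin[of "bits \<delta> \<omega> j"] mult_left_mono[OF ln, of "real (\<omega> (img (Suc j)) - \<omega> (img j))" "bits \<delta> \<omega> j"]
        abs_triangle_ineq4[of "real (\<omega> (img (Suc j)) - \<omega> (img j)) * ln (lam (bits \<delta> \<omega> j))" "(lam (bits \<delta> \<omega> j) - 1) * \<delta>"]
      by (simp add: abs_mult)
  qed
  also have "\<dots> = ln K * real (\<omega> (img M)) + K * (real M * \<delta>)"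
    using sum_increments[OF assms grid_img[of M]] by (simp add: sum.distrib sum_distrib_right[symmetric])
  finally show ?thesis .
qed

end

text \<open>A single dominating function for all meshes. With b the bound on the logarithm of a
  density L, both L and its absolute logarithm are at most \<open>exp b\<close>, so the first term
  controls the entropy; the other two control the product with \<open>w\<close> through conjugate
  exponents.\<close>

definition envelope :: "real \<Rightarrow> real \<Rightarrow> real \<Rightarrow> (path \<Rightarrow> real) \<Rightarrow> path \<Rightarrow> real" where
  "envelope r K T w \<omega> = exp (2 * (ln K * real (\<omega> T) + K * T))
     + exp (r / (r - 1) * (ln K * real (\<omega> T) + K * T)) + \<bar>w \<omega>\<bar> powr r"

lemma integrable_envelope:
  assumes "integrable pi_law (\<lambda>\<omega>. \<bar>w \<omega>\<bar> powr r)" "0 \<le> T"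
  shows "integrable pi_law (envelope r K T w)"
proof -
  have "integrable pi_law (\<lambda>\<omega>. exp (a * (ln K * real (\<omega> T) + K * T)))" for a
  proof -
    have "exp (a * (ln K * real (\<omega> T) + K * T)) = exp (a * K * T) * exp ((a * ln K) * real (\<omega> T))" for \<omega> :: path
      by (simp add: exp_add[symmetric] algebra_simps)
    then show ?thesis using integrable_exp_count[OF assms(2)] by simp
  qed
  then show ?thesis unfolding envelope_def using assms(1)
    by (intro Bochner_Integration.integrable_add)
qed

text \<open>A form of Young's inequality without constants: if x is at most
  \<open>y powr (r - 1)\<close>, the product is at most \<open>y powr r\<close>; otherwise y is at
  most \<open>x powr (1 / (r - 1))\<close>, and the power of x wins.\<close>

lemma mult_le_powr_sum:
  fixes x y r :: real
  assumes "0 \<le> x" "0 \<le> y" "1 < r"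
  shows "x * y \<le> x powr (r / (r - 1)) + y powr r"
proof (cases "x = 0 \<or> y = 0")
  case False
  then have xy: "0 < x" "0 < y" using assms by auto
  show ?thesis
  proof (cases "x \<le> y powr (r - 1)")
    case True
    then have "x * y \<le> y powr (r - 1) * y powr 1" using xy by (intro mult_mono) auto
    also have "\<dots> = y powr r" by (subst powr_add[symmetric]) simp
    finally show ?thesis by (smt (verit) powr_ge_zero)
  next
    case False
    then have "(y powr (r - 1)) powr (1 / (r - 1)) \<le> x powr (1 / (r - 1))"
      using assms by (intro powr_mono2) auto
    then have "y \<le> x powr (1 / (r - 1))" using xy assms by (simp add: powr_powr)
    then have "x * y \<le> x powr 1 * x powr (1 / (r - 1))" using xy by (intro mult_mono) auto
    also have "\<dots> = x powr (1 + 1 / (r - 1))" by (rule powr_add[symmetric])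
    also have "1 + 1 / (r - 1) = r / (r - 1)" using assms by (simp add: field_simps)
    finally show ?thesis by (smt (verit) powr_ge_zero)
  qed
qed auto

lemma envelope_bounds:
  assumes L: "0 < L" "\<bar>ln L\<bar> \<le> ln K * real (\<omega> T) + K * T" and r: "1 < r"
  shows "\<bar>L * ln L\<bar> \<le> envelope r K T w \<omega>" and "\<bar>L * w \<omega>\<bar> \<le> envelope r K T w \<omega>"
    and "L \<le> envelope r K T w \<omega>"
proof -
  define b where "b = ln K * real (\<omega> T) + K * T"
  have b: "0 \<le> b" "ln L \<le> b" "\<bar>ln L\<bar> \<le> b" using L by (auto simp: b_def)
  have Lb: "L \<le> exp b" using b L by (metis exp_le_cancel_iff exp_ln)
  have "\<bar>ln L\<bar> \<le> exp b" using b exp_ge_add_one_self[of b] by linarith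
  then have "L * \<bar>ln L\<bar> \<le> exp b * exp b" using Lb L by (intro mult_mono) auto
  then have "L * \<bar>ln L\<bar> \<le> exp (2 * b)" by (simp add: exp_add[symmetric])
  then show "\<bar>L * ln L\<bar> \<le> envelope r K T w \<omega>" using L
    unfolding envelope_def b_def[symmetric] by (simp add: abs_mult add_increasing2)
  have "exp b \<le> exp (2 * b)" using b by simp
  with Lb have "L \<le> exp (2 * b)" by linarith
  then show "L \<le> envelope r K T w \<omega>"
    unfolding envelope_def b_def[symmetric] by (simp add: add_increasing2)
  have "L * \<bar>w \<omega>\<bar> \<le> L powr (r / (r - 1)) + \<bar>w \<omega>\<bar> powr r"
    using L r by (intro mult_le_powr_sum) auto
  moreover have "L powr (r / (r - 1)) \<le> exp b powr (r / (r - 1))"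
    using L r Lb by (intro powr_mono2) auto
  moreover have "exp b powr (r / (r - 1)) = exp (r / (r - 1) * b)" by (simp add: powr_def)
  moreover have "0 \<le> exp (2 * b)" by simp
  ultimately show "\<bar>L * w \<omega>\<bar> \<le> envelope r K T w \<omega>" using L
    unfolding envelope_def b_def[symmetric] abs_mult by linarith
qed

text \<open>Here q is the unit rate probability that a cell is occupied, and
  \<open>1 - q * \<rho>\<close> is the probability that it is empty after occupation has been
  reweighted by \<rho>. In the constant, the quadratic term comes from the second order bound on the
  logarithm and the linear one from \<open>\<delta> - q \<le> \<delta>\<^sup>2\<close>.\<close>

lemma LD_cond_bound:
  fixes \<rho> q \<delta> K :: real
  assumes "0 < \<rho>" "\<rho> \<le> K" "1 \<le> K" "0 < \<delta>" "K * \<delta> \<le> 1 / 2" and q: "q = 1 - exp (- \<delta>)"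
  shows "q * \<rho> < 1" and "\<bar>ln (1 - q * \<rho>) + \<rho> * \<delta>\<bar> \<le> (2 * K\<^sup>2 + K) * \<delta>\<^sup>2"
proof -
  have d1: "\<delta> \<le> 1 / 2" using assms(4,5) mult_right_mono[OF assms(3), of \<delta>] by linarith
  have q1: "0 < q" "q \<le> \<delta>" using exp_ge_add_one_self[of "- \<delta>"] assms by (auto simp: q)
  have q2: "\<delta> - q \<le> \<delta>\<^sup>2"
  proof -
    have "exp (- \<delta>) \<le> 1 / (1 + \<delta>)"
      using exp_ge_add_one_self[of \<delta>] assms by (simp add: exp_minus inverse_eq_divide frac_le)
    also have "\<dots> \<le> 1 - \<delta> + \<delta>\<^sup>2"
    proof -
      have "(1 - \<delta> + \<delta>\<^sup>2) * (1 + \<delta>) = 1 + \<delta> ^ 3" by (simp add: algebra_simps power2_eq_square power3_eq_cube)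
      then have "1 \<le> (1 - \<delta> + \<delta>\<^sup>2) * (1 + \<delta>)" using assms by simp
      then show ?thesis using assms by (simp add: divide_le_eq)
    qed
    finally show ?thesis by (simp add: q)
  qed
  have x: "0 < q * \<rho>" "q * \<rho> \<le> K * \<delta>"
    using q1 assms mult_mono[of q \<delta> \<rho> K] by (auto simp: mult.commute)
  then show "q * \<rho> < 1" using assms by simp
  have "\<bar>ln (1 + - (q * \<rho>)) - - (q * \<rho>)\<bar> \<le> 2 * (- (q * \<rho>))\<^sup>2"
    using x assms by (intro abs_ln_one_plus_x_minus_x_bound) auto
  moreover have "(q * \<rho>)\<^sup>2 \<le> (K * \<delta>)\<^sup>2" using x by (intro power_mono) auto
  ultimately have 1: "\<bar>ln (1 - q * \<rho>) + q * \<rho>\<bar> \<le> 2 * K\<^sup>2 * \<delta>\<^sup>2"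
    by (simp add: power_mult_distrib)
  have "\<rho> * (\<delta> - q) \<le> K * \<delta>\<^sup>2" "0 \<le> \<rho> * (\<delta> - q)"
    using assms q1 q2 by (auto intro!: mult_mono mult_nonneg_nonneg)
  then have "\<bar>\<rho> * (\<delta> - q)\<bar> \<le> K * \<delta>\<^sup>2" by simp
  moreover have "ln (1 - q * \<rho>) + \<rho> * \<delta> = (ln (1 - q * \<rho>) + q * \<rho>) + \<rho> * (\<delta> - q)"
    by (simp add: algebra_simps)
  ultimately show "\<bar>ln (1 - q * \<rho>) + \<rho> * \<delta>\<bar> \<le> (2 * K\<^sup>2 + K) * \<delta>\<^sup>2"
    using 1 abs_triangle_ineq[of "ln (1 - q * \<rho>) + q * \<rho>" "\<rho> * (\<delta> - q)"] by (simp add: algebra_simps)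
qed

text \<open>\<open>gcond \<delta> g n \<beta>\<close> is the conditional expectation of \<open>g\<close>, a function of
  \<open>length \<beta> + n\<close> bits of mesh \<open>\<delta>\<close>, given that the first bits are \<open>\<beta>\<close>.\<close>
primrec gcond :: "real \<Rightarrow> (bool list \<Rightarrow> real) \<Rightarrow> nat \<Rightarrow> bool list \<Rightarrow> real" where
  "gcond \<delta> g 0 \<beta> = g \<beta>"
| "gcond \<delta> g (Suc n) \<beta> = (1 - exp (- \<delta>)) * gcond \<delta> g n (\<beta> @ [True]) + exp (- \<delta>) * gcond \<delta> g n (\<beta> @ [False])"

lemma gcond_bounds:
  assumes "0 < \<delta>" "\<And>\<beta>. c \<le> g \<beta> \<and> g \<beta> \<le> C"
  shows "c \<le> gcond \<delta> g n \<beta> \<and> gcond \<delta> g n \<beta> \<le> C"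
proof (induction n arbitrary: \<beta>)
  case (Suc n)
  let ?e = "exp (- \<delta>)"
  have e: "0 \<le> ?e" "0 \<le> 1 - ?e" using assms by auto
  have "(1 - ?e) * c + ?e * c \<le> gcond \<delta> g (Suc n) \<beta>"
    using Suc e by (auto intro!: add_mono mult_left_mono)
  moreover have "gcond \<delta> g (Suc n) \<beta> \<le> (1 - ?e) * C + ?e * C"
    using Suc e unfolding gcond.simps by (intro add_mono mult_left_mono) auto
  ultimately show ?case by (simp add: algebra_simps)
qed (use assms in simp)

text \<open>Multiplied by \<open>1 - exp (- \<delta>)\<close>, this is the probability that the next
  cell is occupied under the law reweighted by g. On strings of length at least M both truncated
  differences are 0 and the ratio is one of values of g, so the two-sided bounds hold for every
  string, as \<open>adaptive\<close> demands.\<close>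

definition gratio :: "real \<Rightarrow> nat \<Rightarrow> (bool list \<Rightarrow> real) \<Rightarrow> bool list \<Rightarrow> real" where
  "gratio \<delta> M g \<beta> = gcond \<delta> g (M - Suc (length \<beta>)) (\<beta> @ [True]) / gcond \<delta> g (M - length \<beta>) \<beta>"

lemma adaptive_gratio:
  assumes "0 < \<delta>" "\<And>\<beta>. c \<le> g \<beta> \<and> g \<beta> \<le> C" "0 < c"
  shows "adaptive \<delta> (gratio \<delta> M g) (C / c)"
proof
  have "c \<le> C" using assms(2) order.trans by blast
  then show "1 \<le> C / c" using assms by simp
  fix \<beta>
  note b = gcond_bounds[where g = g and c = c and C = C, OF assms(1,2)]
  have pos: "0 < gcond \<delta> g n \<gamma>" for n \<gamma> using b[of n \<gamma>] assms(3) by linarith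
  show "1 / (C / c) \<le> gratio \<delta> M g \<beta> \<and> gratio \<delta> M g \<beta> \<le> C / c"
    unfolding gratio_def using b pos \<open>c \<le> C\<close> assms(3)
    by (auto intro!: frac_le simp: less_imp_le)
qed (rule assms)

text \<open>The two children average to the parent. So if an occupied cell multiplies the
  conditional expectation by \<rho>, an empty cell must multiply it by
  \<open>(1 - q * \<rho>) / (1 - q)\<close> with \<open>q = 1 - exp (- \<delta>)\<close>, and
  \<open>1 / (1 - q) = exp \<delta>\<close>.\<close>

lemma gcond_step:
  assumes "0 < \<delta>" "\<And>\<beta>. c \<le> g \<beta> \<and> g \<beta> \<le> C" "0 < c" "length \<beta> < M"
  defines "\<rho> \<equiv> gratio \<delta> M g \<beta>" and "m \<equiv> M - Suc (length \<beta>)"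
  shows "gcond \<delta> g m (\<beta> @ [True]) = gcond \<delta> g (Suc m) \<beta> * \<rho>"
    and "gcond \<delta> g m (\<beta> @ [False]) = gcond \<delta> g (Suc m) \<beta> * ((1 - (1 - exp (- \<delta>)) * \<rho>) * exp \<delta>)"
proof -
  have S: "M - length \<beta> = Suc m" using assms(4) by (simp add: m_def)
  have pos: "0 < gcond \<delta> g (Suc m) \<beta>" using gcond_bounds[where g = g and c = c and C = C, OF assms(1,2), of "Suc m" \<beta>] assms(3) by linarith
  show T: "gcond \<delta> g m (\<beta> @ [True]) = gcond \<delta> g (Suc m) \<beta> * \<rho>"
    using pos unfolding \<rho>_def gratio_def S m_def[symmetric] by simp
  have "gcond \<delta> g (Suc m) \<beta> * (1 - (1 - exp (- \<delta>)) * \<rho>) = exp (- \<delta>) * gcond \<delta> g m (\<beta> @ [False])"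
    using T by (simp add: algebra_simps)
  then show "gcond \<delta> g m (\<beta> @ [False]) = gcond \<delta> g (Suc m) \<beta> * ((1 - (1 - exp (- \<delta>)) * \<rho>) * exp \<delta>)"
    by (simp add: mult.assoc[symmetric] exp_minus)
qed

text \<open>The logarithm of g telescopes over successive conditional expectations, and each
  increment is compared with the term of \<open>ln_LD\<close> for the same cell. In an occupied cell
  the logarithms of the ratio cancel and an error of order \<delta> is charged to its single point;
  in an empty cell the compensators cancel up to order \<open>\<delta>\<^sup>2\<close>.\<close>

lemma ln_LD_gratio_close:
  assumes \<delta>: "0 < \<delta>" and g: "\<And>\<beta>. c \<le> g \<beta> \<and> g \<beta> \<le> C" and c: "0 < c" and small: "C / c * \<delta> \<le> 1 / 2"
    and w: "\<omega> \<in> Nfrak" and simple: "\<And>j. j < M \<Longrightarrow> \<omega> (real (Suc j) * \<delta>) \<le> Suc (\<omega> (real j * \<delta>))"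
  shows "\<bar>ln (adaptive.LD \<delta> M (gratio \<delta> M g) \<omega>) - (ln (g (bits \<delta> \<omega> M)) - ln (gcond \<delta> g M []))\<bar>
    \<le> C / c * \<delta> * real (\<omega> (real M * \<delta>)) + (2 * (C / c)\<^sup>2 + C / c) * \<delta>\<^sup>2 * real M"
proof -
  define K where "K = C / c"
  interpret adaptive \<delta> M "gratio \<delta> M g" K
    unfolding K_def by (rule adaptive_gratio[where g = g and c = c and C = C, OF \<delta> g c])
  define lam' where "lam' j = gratio \<delta> M g (bits \<delta> \<omega> j)" for j
  define \<Gamma> where "\<Gamma> j = gcond \<delta> g (M - j) (bits \<delta> \<omega> j)" for j
  define N where "N j = \<omega> (img (Suc j)) - \<omega> (img j)" for j
  have pos: "0 < \<Gamma> j" for j unfolding \<Gamma>_def using gcond_bounds[where g = g and c = c and C = C, OF \<delta> g] c by (meson less_le_trans)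
  have lp: "0 < lam' j" "lam' j \<le> K" "1 / K \<le> lam' j" for j
    using lam_pos lam by (auto simp: lam'_def)
  have bnd: "\<bar>real (N j) * ln (lam' j) - (lam' j - 1) * \<delta> - (ln (\<Gamma> (Suc j)) - ln (\<Gamma> j))\<bar>
      \<le> K * \<delta> * real (N j) + (2 * K\<^sup>2 + K) * \<delta>\<^sup>2" if "j < M" for j
  proof -
    define b where "b = (\<omega> (real j * \<delta>) < \<omega> (real (Suc j) * \<delta>))"
    have m: "M - j = Suc (M - Suc j)" using that by simp
    have G: "\<Gamma> (Suc j) = gcond \<delta> g (M - Suc j) (bits \<delta> \<omega> j @ [b])" by (simp add: \<Gamma>_def bits_Suc b_def)
    note step = gcond_step[where g = g and c = c and C = C, OF \<delta> g c, of "bits \<delta> \<omega> j" M, simplified, OF that]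
    show ?thesis
    proof (cases b)
      case True
      have "\<omega> (real (Suc j) * \<delta>) = Suc (\<omega> (real j * \<delta>))" using True simple[OF that] by (simp add: b_def)
      then have N1: "N j = 1" by (simp add: N_def img_def)
      have "\<Gamma> (Suc j) = \<Gamma> j * lam' j" using G True step(1) by (simp add: \<Gamma>_def m lam'_def)
      then have "ln (\<Gamma> (Suc j)) - ln (\<Gamma> j) = ln (lam' j)" using pos[of j] lp[of j] by (simp add: ln_mult)
      moreover have "\<bar>(lam' j - 1) * \<delta>\<bar> \<le> K * \<delta>"
        using lp[of j] K \<delta> by (auto simp: abs_mult intro!: mult_right_mono)
      moreover have "0 \<le> (2 * K\<^sup>2 + K) * \<delta>\<^sup>2" using K by simp
      ultimately show ?thesis using N1 by simp
    next
      case False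
      have "\<omega> (real j * \<delta>) \<le> \<omega> (real (Suc j) * \<delta>)" using \<delta> by (intro Nfrak_mono[OF w]) auto
      then have N0: "N j = 0" using False by (simp add: N_def img_def b_def)
      define q where "q = 1 - exp (- \<delta>)"
      note B = LD_cond_bound[OF lp(1,2)[of j] K \<delta> _ q_def]
      have q: "q * lam' j < 1" using small by (intro B) (simp add: K_def)
      have "\<Gamma> (Suc j) = \<Gamma> j * ((1 - q * lam' j) * exp \<delta>)" using G False step(2) by (simp add: \<Gamma>_def m lam'_def q_def)
      then have "ln (\<Gamma> (Suc j)) - ln (\<Gamma> j) = ln (1 - q * lam' j) + \<delta>" using pos[of j] q by (simp add: ln_mult)
      moreover have "\<bar>ln (1 - q * lam' j) + lam' j * \<delta>\<bar> \<le> (2 * K\<^sup>2 + K) * \<delta>\<^sup>2"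
        using small by (intro B) (simp add: K_def)
      ultimately show ?thesis using N0 by (simp add: algebra_simps abs_le_iff)
    qed
  qed
  have "ln (g (bits \<delta> \<omega> M)) - ln (gcond \<delta> g M []) = (\<Sum>j<M. ln (\<Gamma> (Suc j)) - ln (\<Gamma> j))"
    by (subst sum_lessThan_telescope) (simp add: \<Gamma>_def)
  then have "\<bar>ln (LD \<omega>) - (ln (g (bits \<delta> \<omega> M)) - ln (gcond \<delta> g M []))\<bar>
      = \<bar>\<Sum>j<M. real (N j) * ln (lam' j) - (lam' j - 1) * \<delta> - (ln (\<Gamma> (Suc j)) - ln (\<Gamma> j))\<bar>"
    by (simp add: ln_LD sum_subtractf N_def lam'_def)
  also have "\<dots> \<le> (\<Sum>j<M. K * \<delta> * real (N j) + (2 * K\<^sup>2 + K) * \<delta>\<^sup>2)"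
    by (rule order.trans[OF sum_abs sum_mono]) (use bnd in auto)
  also have "\<dots> = K * \<delta> * real (\<omega> (img M)) + (2 * K\<^sup>2 + K) * \<delta>\<^sup>2 * real M"
    using sum_increments[OF w grid_img[of M]] by (simp add: sum.distrib sum_distrib_left[symmetric] N_def)
  finally show ?thesis by (simp add: K_def img_def)
qed

section \<open>Entropic approximation of bit densities\<close>

lemma dominated_L1:
  fixes f :: "'a \<Rightarrow> real"
  assumes [measurable]: "f \<in> borel_measurable M" "\<And>n. s n \<in> borel_measurable M"
    and W: "integrable M W" and lim: "AE x in M. (\<lambda>n. s n x) \<longlonglongrightarrow> f x"
    and bound: "\<And>n. AE x in M. \<bar>s n x\<bar> \<le> W x"
  shows "integrable M f" "(\<lambda>n. \<integral>x. \<bar>s n x - f x\<bar> \<partial>M) \<longlonglongrightarrow> 0"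
proof -
  show f: "integrable M f"
    by (rule integrable_dominated_convergence[OF _ _ W lim]) (use bound in auto)
  have "(\<lambda>n. \<integral>x. \<bar>s n x - f x\<bar> \<partial>M) \<longlonglongrightarrow> (\<integral>x. 0 \<partial>M)"
  proof (rule integral_dominated_convergence)
    show "integrable M (\<lambda>x. W x + \<bar>f x\<bar>)" using f W by auto
    show "AE x in M. (\<lambda>n. \<bar>s n x - f x\<bar>) \<longlonglongrightarrow> 0"
      using lim by eventually_elim (intro tendsto_rabs_zero LIM_zero)
    show "AE x in M. norm \<bar>s n x - f x\<bar> \<le> W x + \<bar>f x\<bar>" for n
      using bound[of n] by eventually_elim auto
  qed auto
  then show "(\<lambda>n. \<integral>x. \<bar>s n x - f x\<bar> \<partial>M) \<longlonglongrightarrow> 0" by simp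
qed

lemma integral_abs_triangle:
  fixes f g h :: "'a \<Rightarrow> real"
  assumes "integrable M f" "integrable M g" "integrable M h"
  shows "(\<integral>x. \<bar>f x - h x\<bar> \<partial>M) \<le> (\<integral>x. \<bar>f x - g x\<bar> \<partial>M) + (\<integral>x. \<bar>g x - h x\<bar> \<partial>M)"
proof -
  have "(\<integral>x. \<bar>f x - h x\<bar> \<partial>M) \<le> (\<integral>x. \<bar>f x - g x\<bar> + \<bar>g x - h x\<bar> \<partial>M)"
    using assms by (intro integral_mono) auto
  also have "\<dots> = (\<integral>x. \<bar>f x - g x\<bar> \<partial>M) + (\<integral>x. \<bar>g x - h x\<bar> \<partial>M)"
    using assms by (intro Bochner_Integration.integral_add) auto
  finally show ?thesis .
qed

text \<open>The parameter \<open>w\<close> stands for the logarithm of the final target. It stays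
  fixed while the density being approximated passes through bit functions, bounded densities and
  truncations.\<close>

definition realizable :: "(path \<Rightarrow> real) \<Rightarrow> (path \<Rightarrow> real) \<Rightarrow> bool" where
  "realizable w L \<longleftrightarrow> L \<in> borel_measurable Nspace \<and> (\<forall>\<omega>. 0 \<le> L \<omega>)
    \<and> (\<exists>ydot. Ppp ydot \<and> Ymap ydot \<in> Nspace \<rightarrow>\<^sub>M Nspace
        \<and> distr pi_law Nspace (Ymap ydot) = density pi_law (\<lambda>\<omega>. ennreal (L \<omega>)))
    \<and> integrable pi_law (\<lambda>\<omega>. L \<omega> * ln (L \<omega>)) \<and> integrable pi_law (\<lambda>\<omega>. L \<omega> * w \<omega>)"

definition approximable :: "(path \<Rightarrow> real) \<Rightarrow> (path \<Rightarrow> real) \<Rightarrow> bool" where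
  "approximable w Z \<longleftrightarrow> integrable pi_law (\<lambda>\<omega>. Z \<omega> * ln (Z \<omega>)) \<and> integrable pi_law (\<lambda>\<omega>. Z \<omega> * w \<omega>)
    \<and> (\<forall>\<epsilon>>0. \<exists>L. realizable w L \<and> (\<integral>\<omega>. \<bar>L \<omega> * ln (L \<omega>) - Z \<omega> * ln (Z \<omega>)\<bar> \<partial>pi_law) < \<epsilon>
        \<and> (\<integral>\<omega>. \<bar>L \<omega> * w \<omega> - Z \<omega> * w \<omega>\<bar> \<partial>pi_law) < \<epsilon>)"

lemma realizable_approximable: "realizable w L \<Longrightarrow> approximable w L"
  unfolding approximable_def realizable_def by (intro conjI allI impI exI[of _ L]) auto

text \<open>Each limit passage below has this form: domination gives L1 convergence of both
  products, and an approximation of \<open>Zn n\<close> within half of \<epsilon> completes the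
  triangle inequality. Positivity of the limit is used for continuity of \<open>ln\<close>.\<close>

lemma approximable_limit:
  assumes [measurable]: "Z \<in> borel_measurable Nspace" "\<And>n. Zn n \<in> borel_measurable Nspace" "w \<in> borel_measurable Nspace"
    and W: "integrable pi_law W" and lim: "AE \<omega> in pi_law. (\<lambda>n. Zn n \<omega>) \<longlonglongrightarrow> Z \<omega>"
    and pos: "AE \<omega> in pi_law. 0 < Z \<omega>"
    and bound: "\<And>n. AE \<omega> in pi_law. \<bar>Zn n \<omega> * ln (Zn n \<omega>)\<bar> \<le> W \<omega>"
      "\<And>n. AE \<omega> in pi_law. \<bar>Zn n \<omega> * w \<omega>\<bar> \<le> W \<omega>"
    and appr: "\<And>n. approximable w (Zn n)"
  shows "approximable w Z"
proof -
  have l1: "AE \<omega> in pi_law. (\<lambda>n. Zn n \<omega> * ln (Zn n \<omega>)) \<longlonglongrightarrow> Z \<omega> * ln (Z \<omega>)"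
    using lim pos by eventually_elim (auto intro!: tendsto_intros)
  have l2: "AE \<omega> in pi_law. (\<lambda>n. Zn n \<omega> * w \<omega>) \<longlonglongrightarrow> Z \<omega> * w \<omega>"
    using lim by eventually_elim (auto intro!: tendsto_intros)
  note d1 = dominated_L1[OF _ _ W l1 bound(1)] and d2 = dominated_L1[OF _ _ W l2 bound(2)]
  have i: "integrable pi_law (\<lambda>\<omega>. Z \<omega> * ln (Z \<omega>))" "integrable pi_law (\<lambda>\<omega>. Z \<omega> * w \<omega>)"
    by (rule d1(1) d2(1); measurable)+
  have t: "(\<lambda>n. \<integral>\<omega>. \<bar>Zn n \<omega> * ln (Zn n \<omega>) - Z \<omega> * ln (Z \<omega>)\<bar> \<partial>pi_law) \<longlonglongrightarrow> 0"
    "(\<lambda>n. \<integral>\<omega>. \<bar>Zn n \<omega> * w \<omega> - Z \<omega> * w \<omega>\<bar> \<partial>pi_law) \<longlonglongrightarrow> 0"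
    by (rule d1(2) d2(2); measurable)+
  have "\<exists>L. realizable w L \<and> (\<integral>\<omega>. \<bar>L \<omega> * ln (L \<omega>) - Z \<omega> * ln (Z \<omega>)\<bar> \<partial>pi_law) < \<epsilon>
        \<and> (\<integral>\<omega>. \<bar>L \<omega> * w \<omega> - Z \<omega> * w \<omega>\<bar> \<partial>pi_law) < \<epsilon>" if "0 < \<epsilon>" for \<epsilon>
  proof -
    have e: "0 < \<epsilon> / 2" using that by simp
    have "eventually (\<lambda>n. (\<integral>\<omega>. \<bar>Zn n \<omega> * ln (Zn n \<omega>) - Z \<omega> * ln (Z \<omega>)\<bar> \<partial>pi_law) < \<epsilon> / 2
      \<and> (\<integral>\<omega>. \<bar>Zn n \<omega> * w \<omega> - Z \<omega> * w \<omega>\<bar> \<partial>pi_law) < \<epsilon> / 2) sequentially"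
      using order_tendstoD(2)[OF t(1) e] order_tendstoD(2)[OF t(2) e] by eventually_elim auto
    then obtain n where n: "(\<integral>\<omega>. \<bar>Zn n \<omega> * ln (Zn n \<omega>) - Z \<omega> * ln (Z \<omega>)\<bar> \<partial>pi_law) < \<epsilon> / 2"
      "(\<integral>\<omega>. \<bar>Zn n \<omega> * w \<omega> - Z \<omega> * w \<omega>\<bar> \<partial>pi_law) < \<epsilon> / 2"
      by (auto dest: eventually_happens)
    obtain L where L: "realizable w L"
      "(\<integral>\<omega>. \<bar>L \<omega> * ln (L \<omega>) - Zn n \<omega> * ln (Zn n \<omega>)\<bar> \<partial>pi_law) < \<epsilon> / 2"
      "(\<integral>\<omega>. \<bar>L \<omega> * w \<omega> - Zn n \<omega> * w \<omega>\<bar> \<partial>pi_law) < \<epsilon> / 2"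
      using appr[of n] e unfolding approximable_def by blast
    have "integrable pi_law (\<lambda>\<omega>. Zn n \<omega> * ln (Zn n \<omega>))" "integrable pi_law (\<lambda>\<omega>. Zn n \<omega> * w \<omega>)"
      "integrable pi_law (\<lambda>\<omega>. L \<omega> * ln (L \<omega>))" "integrable pi_law (\<lambda>\<omega>. L \<omega> * w \<omega>)"
      using appr[of n] L(1) by (auto simp: approximable_def realizable_def)
    note ints = this
    show ?thesis
      using integral_abs_triangle[OF ints(3,1) i(1)] integral_abs_triangle[OF ints(4,2) i(2)] n L
      by (intro exI[of _ L]) auto
  qed
  then show ?thesis using i by (auto simp: approximable_def)
qed

section \<open>Refinement of the mesh\<close>

definition halve :: "bool list \<Rightarrow> bool list" where
  "halve \<beta> = map (\<lambda>i. \<beta> ! (2 * i) \<or> \<beta> ! Suc (2 * i)) [0..<length \<beta> div 2]"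

lemma nth_bits: "i < j \<Longrightarrow> bits \<delta> \<omega> j ! i \<longleftrightarrow> \<omega> (real i * \<delta>) < \<omega> (real (Suc i) * \<delta>)"
  by (simp add: bits_def)

text \<open>Paths are nondecreasing, so a cell contains a point exactly when one of its halves
  does.\<close>

lemma halve_bits:
  assumes w: "\<omega> \<in> Nfrak" and "0 < \<delta>"
  shows "halve (bits (\<delta> / 2) \<omega> (2 * M)) = bits \<delta> \<omega> M"
proof (rule nth_equalityI)
  fix i assume "i < length (halve (bits (\<delta> / 2) \<omega> (2 * M)))"
  then have i: "i < M" by (simp add: halve_def)
  have "real i * \<delta> \<le> (2 * real i + 1) * (\<delta> / 2)" "(2 * real i + 1) * (\<delta> / 2) \<le> (1 + real i) * \<delta>"
    using assms(2) by (auto simp: algebra_simps)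
  note m = this[THEN Nfrak_mono[OF w]]
  have "halve (bits (\<delta> / 2) \<omega> (2 * M)) ! i
    = (\<omega> (real i * \<delta>) < \<omega> ((2 * real i + 1) * (\<delta> / 2)) \<or> \<omega> ((2 * real i + 1) * (\<delta> / 2)) < \<omega> ((1 + real i) * \<delta>))"
  proof -
    have e: "real (2 * i) * (\<delta> / 2) = real i * \<delta>" "real (Suc (2 * i)) * (\<delta> / 2) = (2 * real i + 1) * (\<delta> / 2)"
      "real (Suc (Suc (2 * i))) * (\<delta> / 2) = (1 + real i) * \<delta>"
      by (simp_all add: field_simps)
    have "2 * i < 2 * M" "Suc (2 * i) < 2 * M" using i by auto
    note n = this[THEN nth_bits, of "\<delta> / 2" \<omega>]
    have "halve (bits (\<delta> / 2) \<omega> (2 * M)) ! i = (bits (\<delta> / 2) \<omega> (2 * M) ! (2 * i) \<or> bits (\<delta> / 2) \<omega> (2 * M) ! Suc (2 * i))"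
      using i by (simp add: halve_def)
    then show ?thesis unfolding n e .
  qed
  also have "\<dots> = bits \<delta> \<omega> M ! i" using m i by (auto simp: nth_bits)
  finally show "halve (bits (\<delta> / 2) \<omega> (2 * M)) ! i = bits \<delta> \<omega> M ! i" .
qed (simp add: halve_def)

lemma halve_iterate_bits:
  assumes "\<omega> \<in> Nfrak" "0 < \<delta>"
  shows "(halve ^^ k) (bits (\<delta> / 2 ^ k) \<omega> (M * 2 ^ k)) = bits \<delta> \<omega> M"
proof (induction k)
  case (Suc k)
  have "halve (bits (\<delta> / 2 ^ k / 2) \<omega> (2 * (M * 2 ^ k))) = bits (\<delta> / 2 ^ k) \<omega> (M * 2 ^ k)"
    using assms by (intro halve_bits) auto
  then show ?case using Suc by (simp add: funpow_Suc_right mult_ac del: funpow.simps)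
qed simp

lemma measurable_fun_bits [measurable]: "(\<lambda>\<omega>. g (bits \<delta> \<omega> M)) \<in> borel_measurable Nspace"
  by (rule measurable_compose[OF measurable_bits]) simp

lemma Nfrak_sets [simp]: "Nfrak \<in> sets Nspace"
  using sets.top[of Nspace] by simp

lemma integral_density_eq_1:
  assumes [measurable]: "L \<in> borel_measurable Nspace" "X \<in> Nspace \<rightarrow>\<^sub>M Nspace" and L: "\<And>\<omega>. 0 \<le> L \<omega>"
    and eq: "distr pi_law Nspace X = density pi_law (\<lambda>\<omega>. ennreal (L \<omega>))"
  shows "integrable pi_law L" "(\<integral>\<omega>. L \<omega> \<partial>pi_law) = 1"
proof -
  have "prob_space (distr pi_law Nspace X)" by (rule pi.prob_space_distr) simp
  then have "emeasure (density pi_law (\<lambda>\<omega>. ennreal (L \<omega>))) (space pi_law) = 1"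
    using prob_space.emeasure_space_1 eq by fastforce
  then have "(\<integral>\<^sup>+\<omega>. ennreal (L \<omega>) * indicator (space pi_law) \<omega> \<partial>pi_law) = 1"
    by (subst (asm) emeasure_density) auto
  also have "(\<integral>\<^sup>+\<omega>. ennreal (L \<omega>) * indicator (space pi_law) \<omega> \<partial>pi_law) = (\<integral>\<^sup>+\<omega>. ennreal (L \<omega>) \<partial>pi_law)"
    by (intro nn_integral_cong) simp
  finally have 1: "(\<integral>\<^sup>+\<omega>. ennreal (L \<omega>) \<partial>pi_law) = 1" .
  then show "integrable pi_law L" using L by (intro integrableI_nonneg) auto
  show "(\<integral>\<omega>. L \<omega> \<partial>pi_law) = 1" using 1 L by (subst integral_eq_nn_integral) auto
qed

text \<open>Refining the mesh turns the bit likelihood into the density of a time change: \<open>gratio\<close> is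
  the conditional occupation probability of a cell divided by its value under \<open>pi_law\<close>, hence
  close to the intensity that the cell needs.\<close>
lemma approximable_bits:
  fixes g :: "bool list \<Rightarrow> real"
  assumes \<delta>: "0 < \<delta>" and g: "\<And>\<beta>. c \<le> g \<beta> \<and> g \<beta> \<le> C" and c: "0 < c"
    and [measurable]: "w \<in> borel_measurable Nspace"
    and w: "integrable pi_law (\<lambda>\<omega>. \<bar>w \<omega>\<bar> powr r)" and r: "1 < r"
  shows "approximable w (\<lambda>\<omega>. g (bits \<delta> \<omega> M) / (\<integral>\<omega>. g (bits \<delta> \<omega> M) \<partial>pi_law))"
proof -
  define f where "f \<omega> = g (bits \<delta> \<omega> M)" for \<omega>
  define K where "K = C / c"
  define T where "T = real M * \<delta>"
  define d where "d k = \<delta> / 2 ^ k" for k :: nat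
  define m where "m k = M * 2 ^ k" for k :: nat
  \<comment> \<open>The same target read at the finer mesh: k-fold halving recovers the original
    bits, so the time changes become finer while \<open>f\<close> stays the same.\<close>
  define h where "h k = g \<circ> (halve ^^ k)" for k
  define lam where "lam k = gratio (d k) (m k) (h k)" for k
  define L where "L k = adaptive.LD (d k) (m k) (lam k)" for k
  define G where "G k = gcond (d k) (h k) (m k) []" for k
  define W where "W = envelope r K T w"
  have [measurable]: "f \<in> borel_measurable Nspace" unfolding f_def by measurable
  have d: "0 < d k" for k using \<delta> by (simp add: d_def)
  have md: "real (m k) * d k = T" for k by (simp add: m_def d_def T_def)
  have T: "0 \<le> T" using \<delta> by (simp add: T_def)
  have h: "c \<le> h k \<beta> \<and> h k \<beta> \<le> C" for k \<beta> using g by (simp add: h_def)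
  have hf: "h k (bits (d k) \<omega> (m k)) = f \<omega>" if "\<omega> \<in> Nfrak" for k \<omega>
    using halve_iterate_bits[OF that \<delta>, of k M] by (simp add: h_def f_def d_def m_def)
  have ad: "adaptive (d k) (lam k) K" for k
    unfolding lam_def K_def by (rule adaptive_gratio[where g = "h k" and c = c and C = C, OF d h c])
  have Gb: "c \<le> G k \<and> G k \<le> C" for k
    unfolding G_def by (rule gcond_bounds[where g = "h k" and c = c and C = C, OF d h])
  have Gpos: "0 < G k" for k using Gb[of k] c by linarith
  have W: "integrable pi_law W" unfolding W_def by (rule integrable_envelope[OF w T])
  have L_meas [measurable]: "L k \<in> borel_measurable Nspace" for k
    unfolding L_def by (rule adaptive.measurable_LD[OF ad])
  have L_pos: "0 < L k \<omega>" for k \<omega> unfolding L_def by (rule adaptive.LD_pos[OF ad])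
  have L_ln: "\<bar>ln (L k \<omega>)\<bar> \<le> ln K * real (\<omega> T) + K * T" if "\<omega> \<in> Nfrak" for k \<omega>
    using adaptive.abs_ln_LD_le[OF ad that, of k "m k"] md[of k] by (simp add: L_def adaptive.img_def[OF ad])
  have L_bounds: "\<bar>L k \<omega> * ln (L k \<omega>)\<bar> \<le> W \<omega>" "\<bar>L k \<omega> * w \<omega>\<bar> \<le> W \<omega>" "L k \<omega> \<le> W \<omega>"
    if "\<omega> \<in> Nfrak" for k \<omega>
    unfolding W_def using envelope_bounds[where K = K and T = T and w = w and \<omega> = \<omega>, OF L_pos L_ln[OF that] r] by auto
  have L_distr: "distr pi_law Nspace (Ymap (adaptive.ydot (d k) (m k) (lam k))) = density pi_law (\<lambda>\<omega>. ennreal (L k \<omega>))" for k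
    unfolding L_def by (rule adaptive.distr_Ymap_ydot[OF ad])
  have real: "realizable w (L k)" for k
    unfolding realizable_def
  proof (intro conjI exI allI)
    show "Ppp (adaptive.ydot (d k) (m k) (lam k))" by (rule adaptive.Ppp_ydot[OF ad])
    show "Ymap (adaptive.ydot (d k) (m k) (lam k)) \<in> Nspace \<rightarrow>\<^sub>M Nspace"
      by (rule adaptive.measurable_Ymap_ydot[OF ad])
    show "integrable pi_law (\<lambda>\<omega>. L k \<omega> * ln (L k \<omega>))"
      by (rule Bochner_Integration.integrable_bound[OF W]) (auto intro!: AE_I2 order.trans[OF L_bounds(1) abs_ge_self])
    show "integrable pi_law (\<lambda>\<omega>. L k \<omega> * w \<omega>)"
      by (rule Bochner_Integration.integrable_bound[OF W]) (auto intro!: AE_I2 order.trans[OF L_bounds(2) abs_ge_self])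
  qed (use L_pos L_distr in \<open>auto simp: less_imp_le\<close>)
  have L_int: "integrable pi_law (L k)" "(\<integral>\<omega>. L k \<omega> \<partial>pi_law) = 1" for k
    using integral_density_eq_1[OF L_meas adaptive.measurable_Ymap_ydot[OF ad] _ L_distr] L_pos by (auto simp: less_imp_le)
  have f_bound: "c \<le> f \<omega> \<and> f \<omega> \<le> C" for \<omega> using g by (simp add: f_def)
  have d0: "d \<longlonglongrightarrow> 0"
    unfolding d_def[abs_def] using LIMSEQ_divide_realpow_zero[of 2 \<delta>] by simp
  have LG: "(\<lambda>k. L k \<omega> * G k) \<longlonglongrightarrow> f \<omega>" if w: "\<omega> \<in> Nfrak" for \<omega>
  proof -
    obtain \<eta> where \<eta>: "0 < \<eta>" "\<And>s t. 0 \<le> s \<Longrightarrow> s \<le> t \<Longrightarrow> t \<le> T \<Longrightarrow> t - s < \<eta> \<Longrightarrow> \<omega> t \<le> Suc (\<omega> s)"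
      using Nfrak_small_increments[OF w] by blast
    define E where "E k = ln (L k \<omega>) - (ln (f \<omega>) - ln (G k))" for k
    have Kd: "(\<lambda>k. K * d k) \<longlonglongrightarrow> 0" using tendsto_mult_right_zero[OF d0] .
    \<comment> \<open>The first condition leaves at most one point in each cell up to the horizon;
      the second is the smallness required by the estimate of the logarithm.\<close>
    have "eventually (\<lambda>k. d k < \<eta> \<and> K * d k < 1 / 2) sequentially"
      by (intro eventually_conj order_tendstoD(2)[OF d0 \<eta>(1)] order_tendstoD(2)[OF Kd]) simp
    then have "eventually (\<lambda>k. norm (E k) \<le> d k * (K * real (\<omega> T) + (2 * K\<^sup>2 + K) * T)) sequentially"
    proof eventually_elim
      case (elim k)
      have "\<omega> (real (Suc j) * d k) \<le> Suc (\<omega> (real j * d k))" if "j < m k" for j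
      proof (rule \<eta>(2))
        have "real (Suc j) * d k \<le> real (m k) * d k" using that d[of k] by (intro mult_right_mono) auto
        then show "real (Suc j) * d k \<le> T" by (simp add: md)
        show "real (Suc j) * d k - real j * d k < \<eta>" using elim by (simp add: algebra_simps)
      qed (use d[of k] in auto)
      then have "\<bar>E k\<bar> \<le> K * d k * real (\<omega> (real (m k) * d k)) + (2 * K\<^sup>2 + K) * (d k)\<^sup>2 * real (m k)"
        using ln_LD_gratio_close[where g = "h k" and c = c and C = C and M = "m k" and \<delta> = "d k", OF d h c _ w] elim hf[OF w, of k]
        by (simp add: E_def L_def lam_def G_def K_def)
      also have "(2 * K\<^sup>2 + K) * (d k)\<^sup>2 * real (m k) = d k * ((2 * K\<^sup>2 + K) * (real (m k) * d k))"
        by (simp add: power2_eq_square)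
      finally show ?case unfolding md by (simp add: algebra_simps)
    qed
    moreover have "(\<lambda>k. d k * (K * real (\<omega> T) + (2 * K\<^sup>2 + K) * T)) \<longlonglongrightarrow> 0"
      by (rule tendsto_mult_left_zero[OF d0])
    ultimately have "E \<longlonglongrightarrow> 0" by (rule Lim_null_comparison)
    then have "(\<lambda>k. f \<omega> * exp (E k)) \<longlonglongrightarrow> f \<omega> * exp 0" by (intro tendsto_intros)
    moreover have "f \<omega> * exp (E k) = L k \<omega> * G k" for k
      using L_pos[of k \<omega>] Gpos[of k] f_bound[of \<omega>] c by (simp add: E_def exp_diff exp_ln)
    ultimately show ?thesis by simp
  qed
  \<comment> \<open>Every \<open>L k\<close> integrates to 1, so the left side is
    \<open>G k\<close>. This yields the limit of the normalising constants without computing the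
    integral of \<open>f\<close> from the recursion \<open>gcond\<close>.\<close>
  have "(\<lambda>k. \<integral>\<omega>. L k \<omega> * G k \<partial>pi_law) \<longlonglongrightarrow> (\<integral>\<omega>. f \<omega> \<partial>pi_law)"
  proof (rule integral_dominated_convergence)
    show "integrable pi_law (\<lambda>\<omega>. W \<omega> * C)" using W by simp
    show "AE \<omega> in pi_law. norm (L k \<omega> * G k) \<le> W \<omega> * C" for k
    proof (rule AE_I2)
      fix \<omega> assume "\<omega> \<in> space pi_law"
      then have "L k \<omega> * G k \<le> W \<omega> * C"
        using L_bounds(3)[of \<omega> k] L_pos[of k \<omega>] Gb[of k] Gpos[of k] by (intro mult_mono) auto
      then show "norm (L k \<omega> * G k) \<le> W \<omega> * C" using L_pos[of k \<omega>] Gpos[of k] by simp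
    qed
    show "AE \<omega> in pi_law. (\<lambda>k. L k \<omega> * G k) \<longlonglongrightarrow> f \<omega>" using LG by (intro AE_I2) auto
  qed auto
  then have G: "G \<longlonglongrightarrow> (\<integral>\<omega>. f \<omega> \<partial>pi_law)" using L_int by simp
  have Ef: "0 < (\<integral>\<omega>. f \<omega> \<partial>pi_law)"
    using LIMSEQ_le_const[OF G, of c] Gb c by force
  show ?thesis
    unfolding f_def[symmetric]
  proof (rule approximable_limit[OF _ L_meas _ W])
    show "AE \<omega> in pi_law. (\<lambda>n. L n \<omega>) \<longlonglongrightarrow> f \<omega> / (\<integral>\<omega>. f \<omega> \<partial>pi_law)"
    proof (rule AE_I2)
      fix \<omega> assume "\<omega> \<in> space pi_law"
      then have "(\<lambda>k. L k \<omega> * G k / G k) \<longlonglongrightarrow> f \<omega> / (\<integral>\<omega>. f \<omega> \<partial>pi_law)"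
        using Ef by (intro tendsto_divide LG G) auto
      moreover have "L k \<omega> * G k / G k = L k \<omega>" for k using Gpos[of k] by simp
      ultimately show "(\<lambda>n. L n \<omega>) \<longlonglongrightarrow> f \<omega> / (\<integral>\<omega>. f \<omega> \<partial>pi_law)" by simp
    qed
    show "AE \<omega> in pi_law. 0 < f \<omega> / (\<integral>\<omega>. f \<omega> \<partial>pi_law)"
      using Ef f_bound c by (intro AE_I2 divide_pos_pos) (auto intro: less_le_trans)
  qed (use L_bounds real realizable_approximable in auto)
qed

section \<open>Bit functions are dense\<close>

lemma bits_coarser:
  assumes "\<omega> \<in> Nfrak" "\<omega>' \<in> Nfrak" and "0 < \<delta>"
    and eq: "bits (\<delta> / 2 ^ k) \<omega> M' = bits (\<delta> / 2 ^ k) \<omega>' M'" and "M * 2 ^ k \<le> M'"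
  shows "bits \<delta> \<omega> M = bits \<delta> \<omega>' M"
proof -
  have "bits (\<delta> / 2 ^ k) \<omega> (M * 2 ^ k) = bits (\<delta> / 2 ^ k) \<omega>' (M * 2 ^ k)"
    using arg_cong[OF eq, of "take (M * 2 ^ k)"] assms(5) by (simp add: take_bits)
  then show ?thesis
    using halve_iterate_bits[OF assms(1,3), of k M] halve_iterate_bits[OF assms(2,3), of k M] by metis
qed

text \<open>With mesh \<open>1 / 2 ^ n\<close> and \<open>4 ^ n\<close> cells the horizon is
  \<open>2 ^ n\<close>, so passing to the next level both halves the mesh and doubles the
  horizon.\<close>

definition lbits :: "nat \<Rightarrow> path \<Rightarrow> bool list" where
  "lbits n \<omega> = bits (1 / 2 ^ n) \<omega> (4 ^ n)"

lemma measurable_lbits [measurable]: "lbits n \<in> Nspace \<rightarrow>\<^sub>M count_space UNIV"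
  unfolding lbits_def[abs_def] by measurable

text \<open>The map \<rho> evaluates the coarse bits on an arbitrarily chosen path with the given
  fine bits; the choice does not matter because fine bits determine coarse ones.\<close>

lemma lbits_coarser:
  assumes "m \<le> n"
  obtains \<rho> where "\<And>\<omega>. \<omega> \<in> Nfrak \<Longrightarrow> lbits m \<omega> = \<rho> (lbits n \<omega>)"
proof -
  define \<rho> where "\<rho> \<beta> = lbits m (SOME \<omega>. \<omega> \<in> Nfrak \<and> lbits n \<omega> = \<beta>)" for \<beta>
  have "lbits m \<omega> = \<rho> (lbits n \<omega>)" if "\<omega> \<in> Nfrak" for \<omega>
  proof -
    define \<omega>' where "\<omega>' = (SOME \<omega>'. \<omega>' \<in> Nfrak \<and> lbits n \<omega>' = lbits n \<omega>)"
    have w': "\<omega>' \<in> Nfrak \<and> lbits n \<omega>' = lbits n \<omega>"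
      unfolding \<omega>'_def by (rule someI[of _ \<omega>]) (use that in simp)
    define k where "k = n - m"
    have n: "n = m + k" using assms by (simp add: k_def)
    have "(1 :: real) / 2 ^ n = 1 / 2 ^ m / 2 ^ k" by (simp add: n power_add)
    moreover have "4 ^ m * 2 ^ k \<le> (4 :: nat) ^ n"
      unfolding n power_add by (intro mult_le_mono2 power_mono) auto
    moreover have "bits (1 / 2 ^ n) \<omega> (4 ^ n) = bits (1 / 2 ^ n) \<omega>' (4 ^ n)"
      using w' unfolding lbits_def by (rule conjunct2[THEN sym])
    ultimately have "bits (1 / 2 ^ m) \<omega> (4 ^ m) = bits (1 / 2 ^ m) \<omega>' (4 ^ m)"
      by (intro bits_coarser[OF that conjunct1[OF w'], of "1 / 2 ^ m" k "4 ^ n"]) simp_all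
    then have "lbits m \<omega> = lbits m \<omega>'" unfolding lbits_def .
    then show ?thesis unfolding \<rho>_def \<omega>'_def .
  qed
  then show thesis using that by blast
qed

text \<open>Once each relevant cell holds at most one point, the number of occupied cells starting
  by time u is the count at the end of the last such cell, and for a small mesh this equals the
  count at u. The sequence is therefore eventually constant.\<close>

lemma count_from_lbits:
  assumes w: "\<omega> \<in> Nfrak" and u: "0 \<le> u"
  shows "(\<lambda>n. \<Sum>j<4 ^ n. if real j / 2 ^ n \<le> u \<and> lbits n \<omega> ! j then 1 else 0 :: real) \<longlonglongrightarrow> real (\<omega> u)"
proof (rule tendsto_eventually)
  obtain \<eta> where \<eta>: "0 < \<eta>" "\<And>s t. 0 \<le> s \<Longrightarrow> s \<le> t \<Longrightarrow> t \<le> u + 1 \<Longrightarrow> t - s < \<eta> \<Longrightarrow> \<omega> t \<le> Suc (\<omega> s)"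
    using Nfrak_small_increments[OF w] by blast
  \<comment> \<open>The last counted cell overshoots u by at most one mesh width; the path is
    constant from u to v, so the overshoot adds no point.\<close>
  obtain v where v: "u < v" "\<omega> v = \<omega> u" using Nfrak_right[OF w] by blast
  have lim: "(\<lambda>n. 1 / 2 ^ n :: real) \<longlonglongrightarrow> 0"
    using LIMSEQ_divide_realpow_zero[of 2 1] by simp
  obtain n0 where n0: "u + 1 < 2 ^ n0" using real_arch_pow[of 2 "u + 1"] by auto
  have "eventually (\<lambda>n. 1 / 2 ^ n < \<eta> \<and> 1 / 2 ^ n < v - u \<and> n0 \<le> n) sequentially"
    using \<eta>(1) v(1) by (intro eventually_conj order_tendstoD(2)[OF lim] eventually_ge_at_top) auto
  then show "eventually (\<lambda>n. (\<Sum>j<4 ^ n. if real j / 2 ^ n \<le> u \<and> lbits n \<omega> ! j then 1 else 0 :: real) = real (\<omega> u)) sequentially"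
  proof eventually_elim
    case (elim n)
    define d where "d = (1 :: real) / 2 ^ n"
    have d: "0 < d" "d \<le> 1" "d < \<eta>" "d < v - u" using elim by (auto simp: d_def)
    \<comment> \<open>The number of cells whose left end is at most u, the cell that starts at 0
      included.\<close>
    define J where "J = Suc (nat \<lfloor>u / d\<rfloor>)"
    have iff: "real j * d \<le> u \<longleftrightarrow> j < J" for j
    proof -
      have "real j * d \<le> u \<longleftrightarrow> real j \<le> u / d" using d by (simp add: le_divide_eq)
      also have "\<dots> \<longleftrightarrow> int j \<le> \<lfloor>u / d\<rfloor>" by (simp add: le_floor_iff)
      also have "\<dots> \<longleftrightarrow> j \<le> nat \<lfloor>u / d\<rfloor>"
      proof -
        have "0 \<le> \<lfloor>u / d\<rfloor>" using u d by simp
        then show ?thesis by linarith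
      qed
      finally show ?thesis by (simp add: J_def less_Suc_eq_le)
    qed
    have Jd: "u < real J * d" "real J * d \<le> u + d"
    proof -
      show "u < real J * d" using iff[of J] by simp
      have "real (nat \<lfloor>u / d\<rfloor>) * d \<le> u" unfolding iff by (simp add: J_def)
      then show "real J * d \<le> u + d" by (simp add: J_def distrib_right)
    qed
    define N where "N = (4 :: nat) ^ n"
    have "J \<le> N"
    proof -
      have "real J * d \<le> 2 ^ n0" using Jd n0 d by linarith
      also have "\<dots> \<le> 2 ^ n" using elim by (intro power_increasing) auto
      also have "\<dots> = real N * d"
      proof -
        have "(2 :: real) ^ n * 2 ^ n = 4 ^ n" by (simp add: power_mult_distrib[symmetric])
        then show ?thesis by (simp add: d_def N_def field_simps)
      qed
      finally have "real J \<le> real N" using d by (simp only: mult_le_cancel_right_pos)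
      then show ?thesis by (simp only: of_nat_le_iff)
    qed
    have occ: "lbits n \<omega> ! j \<longleftrightarrow> \<omega> (real j * d) < \<omega> (real (Suc j) * d)" if "j < N" for j
      unfolding lbits_def d_def by (rule nth_bits) (use that in \<open>simp add: N_def\<close>)
    have iff': "real j / 2 ^ n \<le> u \<longleftrightarrow> j < J" for j
      using iff[of j] by (simp add: d_def)
    have "(\<Sum>j<4 ^ n. if real j / 2 ^ n \<le> u \<and> lbits n \<omega> ! j then 1 else 0 :: real)
      = (\<Sum>j<J. if lbits n \<omega> ! j then 1 else 0)"
      unfolding iff' N_def[symmetric] using \<open>J \<le> N\<close> by (intro sum.mono_neutral_cong_right) auto
    also have "\<dots> = (\<Sum>j<J. real (\<omega> (real (Suc j) * d) - \<omega> (real j * d)))"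
    proof (rule sum.cong)
      fix j assume "j \<in> {..<J}"
      then have j: "j < J" by simp
      have step: "real (Suc j) * d = real j * d + d" by (simp add: algebra_simps)
      have "\<omega> (real (Suc j) * d) \<le> Suc (\<omega> (real j * d))"
      proof (rule \<eta>(2))
        have "real j * d \<le> u" using iff j by simp
        then show "real (Suc j) * d \<le> u + 1" using d unfolding step by linarith
      qed (use d step in simp_all)
      then show "(if lbits n \<omega> ! j then 1 else 0) = real (\<omega> (real (Suc j) * d) - \<omega> (real j * d))"
        using occ[of j] j \<open>J \<le> N\<close> by (cases "lbits n \<omega> ! j") auto
    qed simp
    also have "\<dots> = real (\<omega> (real J * d))"
      using sum_increments[OF w, of J "\<lambda>j. real j * d"] d by (simp add: grid_def)
    also have "\<omega> (real J * d) = \<omega> u"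
      using Nfrak_mono[OF w, of u "real J * d"] Nfrak_mono[OF w, of "real J * d" v] v Jd d by simp
    finally show ?case .
  qed
qed

definition lbit_sets :: "path set set" where
  "lbit_sets = {{\<omega>\<in>Nfrak. lbits n \<omega> \<in> B} | n B. True}"

text \<open>The nontrivial inclusion holds because each evaluation of the path is a pointwise limit
  of functions of dyadic bits, by \<open>count_from_lbits\<close>.\<close>

lemma sigma_sets_lbit_sets: "sigma_sets Nfrak lbit_sets = sets Nspace"
proof (rule antisym)
  have "{\<omega>\<in>space Nspace. lbits n \<omega> \<in> B} \<in> sets Nspace" for n B by measurable
  then have "lbit_sets \<subseteq> sets Nspace" by (auto simp: lbit_sets_def)
  then show "sigma_sets Nfrak lbit_sets \<subseteq> sets Nspace"
    using sets.sigma_sets_subset[of lbit_sets Nspace] by simp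
  define S where "S = sigma Nfrak lbit_sets"
  have sub: "lbit_sets \<subseteq> Pow Nfrak" by (auto simp: lbit_sets_def)
  have space: "space S = Nfrak" and sets: "sets S = sigma_sets Nfrak lbit_sets"
    using sub by (simp_all add: S_def space_measure_of)
  have lbits_S: "lbits n \<in> S \<rightarrow>\<^sub>M count_space UNIV" for n
  proof (rule measurableI)
    show "lbits n -` B \<inter> space S \<in> sets S" for B
      unfolding space sets by (rule sigma_sets.Basic) (auto simp: lbit_sets_def)
  qed simp
  have "{\<omega>\<in>Nfrak. \<omega> u = k} \<in> sets S" for u k
  proof (cases "u \<le> 0")
    case True
    then have "{\<omega>\<in>Nfrak. \<omega> u = k} = (if k = 0 then space S else {})"
      by (auto simp: Nfrak_nonpos space)
    then show ?thesis by simp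
  next
    case False
    define F where "F n \<beta> = (\<Sum>j<4 ^ n. if real j / 2 ^ n \<le> u \<and> \<beta> ! j then 1 else 0 :: real)" for n \<beta>
    have "(\<lambda>\<omega>. real (\<omega> u)) \<in> borel_measurable S"
    proof (rule borel_measurable_LIMSEQ_real)
      show "(\<lambda>n. F n (lbits n \<omega>)) \<longlonglongrightarrow> real (\<omega> u)" if "\<omega> \<in> space S" for \<omega>
        unfolding F_def by (rule count_from_lbits) (use that False space in auto)
      show "(\<lambda>\<omega>. F n (lbits n \<omega>)) \<in> borel_measurable S" for n
        by (rule measurable_compose[OF lbits_S]) simp
    qed
    then have "(\<lambda>\<omega>. real (\<omega> u)) -` {real k} \<inter> space S \<in> sets S"
      by (rule measurable_sets) (rule borel_singleton, rule sets.empty_sets)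
    also have "(\<lambda>\<omega>. real (\<omega> u)) -` {real k} \<inter> space S = {\<omega>\<in>Nfrak. \<omega> u = k}" using space by auto
    finally show ?thesis .
  qed
  then have "{{\<omega>\<in>Nfrak. \<omega> u = k} | u k. True} \<subseteq> sets S" by blast
  moreover have "Nfrak \<in> sets S" using sets.top[of S] unfolding space .
  ultimately show "sets Nspace \<subseteq> sigma_sets Nfrak lbit_sets"
    unfolding sets_Nspace sets[symmetric] by (rule sets.sigma_sets_subset')
qed

section \<open>Approximation in L1 by functions of dyadic bits\<close>

definition bit_limit :: "(path \<Rightarrow> real) \<Rightarrow> bool" where
  "bit_limit h \<longleftrightarrow> integrable pi_law h \<and>
    (\<forall>\<epsilon>>0. \<exists>n g. integrable pi_law (\<lambda>\<omega>. g (lbits n \<omega>)) \<and> (\<integral>\<omega>. \<bar>h \<omega> - g (lbits n \<omega>)\<bar> \<partial>pi_law) < \<epsilon>)"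

lemma measurable_fun_lbits [measurable]: "(\<lambda>\<omega>. g (lbits n \<omega>)) \<in> borel_measurable Nspace"
  by (rule measurable_compose[OF measurable_lbits]) simp

text \<open>Two approximants of different levels are rewritten at the larger level through
  \<open>lbits_coarser\<close> and then added.\<close>

lemma bit_limit_add:
  assumes "bit_limit h" "bit_limit h'"
  shows "bit_limit (\<lambda>\<omega>. h \<omega> + h' \<omega>)"
  unfolding bit_limit_def
proof (intro conjI allI impI)
  have h: "integrable pi_law h" "integrable pi_law h'" using assms by (auto simp: bit_limit_def)
  then show "integrable pi_law (\<lambda>\<omega>. h \<omega> + h' \<omega>)" by simp
  fix \<epsilon> :: real assume "0 < \<epsilon>"
  then have e: "0 < \<epsilon> / 2" by simp
  obtain n g where g: "integrable pi_law (\<lambda>\<omega>. g (lbits n \<omega>))" "(\<integral>\<omega>. \<bar>h \<omega> - g (lbits n \<omega>)\<bar> \<partial>pi_law) < \<epsilon> / 2"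
    using assms(1) e unfolding bit_limit_def by blast
  obtain n' g' where g': "integrable pi_law (\<lambda>\<omega>. g' (lbits n' \<omega>))" "(\<integral>\<omega>. \<bar>h' \<omega> - g' (lbits n' \<omega>)\<bar> \<partial>pi_law) < \<epsilon> / 2"
    using assms(2) e unfolding bit_limit_def by blast
  obtain \<rho> where \<rho>: "\<And>\<omega>. \<omega> \<in> Nfrak \<Longrightarrow> lbits n \<omega> = \<rho> (lbits (max n n') \<omega>)"
    using lbits_coarser[of n "max n n'"] by auto
  obtain \<rho>' where \<rho>': "\<And>\<omega>. \<omega> \<in> Nfrak \<Longrightarrow> lbits n' \<omega> = \<rho>' (lbits (max n n') \<omega>)"
    using lbits_coarser[of n' "max n n'"] by auto
  let ?G = "\<lambda>\<beta>. g (\<rho> \<beta>) + g' (\<rho>' \<beta>)"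
  have eq: "?G (lbits (max n n') \<omega>) = g (lbits n \<omega>) + g' (lbits n' \<omega>)" if "\<omega> \<in> space pi_law" for \<omega>
    using \<rho>[of \<omega>] \<rho>'[of \<omega>] that by simp
  have "integrable pi_law (\<lambda>\<omega>. ?G (lbits (max n n') \<omega>)) \<longleftrightarrow> integrable pi_law (\<lambda>\<omega>. g (lbits n \<omega>) + g' (lbits n' \<omega>))"
    by (rule Bochner_Integration.integrable_cong[OF refl eq])
  then have int: "integrable pi_law (\<lambda>\<omega>. ?G (lbits (max n n') \<omega>))" using g g' by simp
  have "(\<integral>\<omega>. \<bar>h \<omega> + h' \<omega> - ?G (lbits (max n n') \<omega>)\<bar> \<partial>pi_law)
      \<le> (\<integral>\<omega>. \<bar>h \<omega> - g (lbits n \<omega>)\<bar> + \<bar>h' \<omega> - g' (lbits n' \<omega>)\<bar> \<partial>pi_law)"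
    using h g(1) g'(1) int by (intro integral_mono) (auto simp: eq simp del: space_pi)
  also have "\<dots> = (\<integral>\<omega>. \<bar>h \<omega> - g (lbits n \<omega>)\<bar> \<partial>pi_law) + (\<integral>\<omega>. \<bar>h' \<omega> - g' (lbits n' \<omega>)\<bar> \<partial>pi_law)"
    using h g(1) g'(1) by (intro Bochner_Integration.integral_add) auto
  finally show "\<exists>n g. integrable pi_law (\<lambda>\<omega>. g (lbits n \<omega>)) \<and> (\<integral>\<omega>. \<bar>h \<omega> + h' \<omega> - g (lbits n \<omega>)\<bar> \<partial>pi_law) < \<epsilon>"
    using int g g' by (intro exI[of _ "max n n'"] exI[of _ ?G]) auto
qed

lemma bit_limit_cmult:
  assumes "bit_limit h"
  shows "bit_limit (\<lambda>\<omega>. c * h \<omega>)"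
  unfolding bit_limit_def
proof (intro conjI allI impI)
  have h: "integrable pi_law h" using assms by (auto simp: bit_limit_def)
  then show "integrable pi_law (\<lambda>\<omega>. c * h \<omega>)" by simp
  fix \<epsilon> :: real assume e: "0 < \<epsilon>"
  \<comment> \<open>The summand 1 in the denominator also covers \<open>c = 0\<close> and makes the
    final inequality strict.\<close>
  define \<epsilon>' where "\<epsilon>' = \<epsilon> / (\<bar>c\<bar> + 1)"
  have e': "0 < \<epsilon>'" "\<bar>c\<bar> * \<epsilon>' < \<epsilon>" using e by (auto simp: \<epsilon>'_def field_simps)
  obtain n g where g: "integrable pi_law (\<lambda>\<omega>. g (lbits n \<omega>))" "(\<integral>\<omega>. \<bar>h \<omega> - g (lbits n \<omega>)\<bar> \<partial>pi_law) < \<epsilon>'"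
    using assms e' unfolding bit_limit_def by blast
  have "(\<integral>\<omega>. \<bar>c * h \<omega> - c * g (lbits n \<omega>)\<bar> \<partial>pi_law) = \<bar>c\<bar> * (\<integral>\<omega>. \<bar>h \<omega> - g (lbits n \<omega>)\<bar> \<partial>pi_law)"
    by (subst integral_mult_right_zero[symmetric]) (simp add: abs_mult[symmetric] right_diff_distrib)
  also have "\<dots> \<le> \<bar>c\<bar> * \<epsilon>'" using g by (intro mult_left_mono) auto
  finally show "\<exists>n g. integrable pi_law (\<lambda>\<omega>. g (lbits n \<omega>)) \<and> (\<integral>\<omega>. \<bar>c * h \<omega> - g (lbits n \<omega>)\<bar> \<partial>pi_law) < \<epsilon>"
    using g e' by (intro exI[of _ n] exI[of _ "\<lambda>\<beta>. c * g \<beta>"]) auto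
qed

lemma bit_limit_L1:
  assumes h: "integrable pi_law h" and s: "\<And>i. bit_limit (s i)"
    and lim: "(\<lambda>i. \<integral>\<omega>. \<bar>s i \<omega> - h \<omega>\<bar> \<partial>pi_law) \<longlonglongrightarrow> 0"
  shows "bit_limit h"
  unfolding bit_limit_def
proof (intro conjI allI impI h)
  fix \<epsilon> :: real assume "0 < \<epsilon>"
  then have e: "0 < \<epsilon> / 2" by simp
  obtain i where i: "(\<integral>\<omega>. \<bar>s i \<omega> - h \<omega>\<bar> \<partial>pi_law) < \<epsilon> / 2"
    using order_tendstoD(2)[OF lim e] by (auto dest: eventually_happens)
  obtain n g where g: "integrable pi_law (\<lambda>\<omega>. g (lbits n \<omega>))" "(\<integral>\<omega>. \<bar>s i \<omega> - g (lbits n \<omega>)\<bar> \<partial>pi_law) < \<epsilon> / 2"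
    using s[of i] e unfolding bit_limit_def by blast
  have "integrable pi_law (s i)" using s by (auto simp: bit_limit_def)
  from integral_abs_triangle[OF h this g(1)] i g
  have "(\<integral>\<omega>. \<bar>h \<omega> - g (lbits n \<omega>)\<bar> \<partial>pi_law) < \<epsilon>" by (simp add: abs_minus_commute)
  then show "\<exists>n g. integrable pi_law (\<lambda>\<omega>. g (lbits n \<omega>)) \<and> (\<integral>\<omega>. \<bar>h \<omega> - g (lbits n \<omega>)\<bar> \<partial>pi_law) < \<epsilon>"
    using g by blast
qed

lemma bit_limit_fun_lbits:
  assumes "integrable pi_law (\<lambda>\<omega>. g (lbits n \<omega>))" "\<And>\<omega>. \<omega> \<in> Nfrak \<Longrightarrow> h \<omega> = g (lbits n \<omega>)"
  shows "bit_limit h"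
proof -
  have "integrable pi_law h \<longleftrightarrow> integrable pi_law (\<lambda>\<omega>. g (lbits n \<omega>))"
    using assms by (intro Bochner_Integration.integrable_cong) auto
  moreover have "(\<integral>\<omega>. \<bar>h \<omega> - g (lbits n \<omega>)\<bar> \<partial>pi_law) = (\<integral>\<omega>. 0 \<partial>pi_law)"
    using assms by (intro Bochner_Integration.integral_cong) auto
  ultimately show ?thesis unfolding bit_limit_def using assms by (auto intro!: exI[of _ n] exI[of _ g])
qed

lemma bit_limit_cong:
  assumes "bit_limit h" "\<And>\<omega>. \<omega> \<in> Nfrak \<Longrightarrow> h \<omega> = h' \<omega>"
  shows "bit_limit h'"
proof -
  have "integrable pi_law h \<longleftrightarrow> integrable pi_law h'"
    using assms by (intro Bochner_Integration.integrable_cong) auto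
  moreover have "(\<integral>\<omega>. \<bar>h' \<omega> - g (lbits n \<omega>)\<bar> \<partial>pi_law) = (\<integral>\<omega>. \<bar>h \<omega> - g (lbits n \<omega>)\<bar> \<partial>pi_law)" for g n
    using assms by (intro Bochner_Integration.integral_cong) auto
  ultimately show ?thesis using assms(1) by (simp add: bit_limit_def)
qed

text \<open>Dynkin's argument: bit events are stable under intersection through a common level,
  complements come from linearity, and countable disjoint unions are L1 limits of their finite
  partial unions.\<close>

lemma bit_limit_indicator:
  assumes "A \<in> sets Nspace"
  shows "bit_limit (indicator A)"
proof -
  have bdd: "integrable pi_law (indicator A :: path \<Rightarrow> real)" if "A \<in> sets Nspace" for A
    using that by (intro pi.integrable_const_bound[where B = 1]) auto
  have lev: "bit_limit (indicator A)" if "A \<in> lbit_sets" for A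
  proof -
    obtain n B where A: "A = {\<omega>\<in>Nfrak. lbits n \<omega> \<in> B}" using \<open>A \<in> lbit_sets\<close> by (auto simp: lbit_sets_def)
    show ?thesis
    proof (rule bit_limit_fun_lbits)
      show "integrable pi_law (\<lambda>\<omega>. indicator B (lbits n \<omega>) :: real)"
        by (rule pi.integrable_const_bound[where B = 1]) auto
    qed (simp add: A indicator_def)
  qed
  have space: "Nfrak \<in> lbit_sets" by (auto simp: lbit_sets_def intro!: exI[of _ 0] exI[of _ UNIV])
  have A: "A \<in> sigma_sets Nfrak lbit_sets" using assms by (simp add: sigma_sets_lbit_sets)
  have Int: "Int_stable lbit_sets"
  proof (rule Int_stableI)
    fix A A' assume "A \<in> lbit_sets" "A' \<in> lbit_sets"
    then obtain n B n' B' where A: "A = {\<omega>\<in>Nfrak. lbits n \<omega> \<in> B}" "A' = {\<omega>\<in>Nfrak. lbits n' \<omega> \<in> B'}"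
      by (auto simp: lbit_sets_def)
    obtain \<rho> where \<rho>: "\<And>\<omega>. \<omega> \<in> Nfrak \<Longrightarrow> lbits n \<omega> = \<rho> (lbits (max n n') \<omega>)"
      using lbits_coarser[of n "max n n'"] by auto
    obtain \<rho>' where \<rho>': "\<And>\<omega>. \<omega> \<in> Nfrak \<Longrightarrow> lbits n' \<omega> = \<rho>' (lbits (max n n') \<omega>)"
      using lbits_coarser[of n' "max n n'"] by auto
    have "A \<inter> A' = {\<omega>\<in>Nfrak. lbits (max n n') \<omega> \<in> \<rho> -` B \<inter> \<rho>' -` B'}"
      using \<rho> \<rho>' by (auto simp: A)
    then show "A \<inter> A' \<in> lbit_sets" unfolding lbit_sets_def by blast
  qed
  have sub: "lbit_sets \<subseteq> Pow Nfrak" by (auto simp: lbit_sets_def)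
  have compl: "bit_limit (indicator (Nfrak - A))" if "bit_limit (indicator A)" for A
  proof -
    from bit_limit_add[OF lev[OF space] bit_limit_cmult[OF that, of "- 1"]]
    show "bit_limit (indicator (Nfrak - A))"
      by (rule bit_limit_cong) (auto split: split_indicator)
  qed
  have union: "bit_limit (indicator (\<Union>i. A i))"
    if dis: "disjoint_family A" and sets: "range A \<subseteq> sigma_sets Nfrak lbit_sets" and A: "\<And>i. bit_limit (indicator (A i))"
    for A :: "nat \<Rightarrow> path set"
  proof (rule bit_limit_L1)
    have [measurable]: "A i \<in> sets Nspace" for i using sets by (auto simp: sigma_sets_lbit_sets)
    show "integrable pi_law (indicator (\<Union>i. A i) :: path \<Rightarrow> real)" by (rule bdd) measurable
    show "bit_limit (indicator (\<Union>k<i. A k))" for i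
    proof (induction i)
      case 0
      show ?case by (rule bit_limit_fun_lbits[where g = "\<lambda>_. 0" and n = 0]) auto
    next
      case (Suc i)
      have "A i \<inter> A k = {}" if "k < i" for k using dis that by (auto simp: disjoint_family_on_def)
      then have "indicator (\<Union>k<i. A k) \<omega> + indicator (A i) \<omega> = (indicator (\<Union>k<Suc i. A k) \<omega> :: real)" for \<omega>
        by (auto simp: lessThan_Suc split: split_indicator)
      with bit_limit_add[OF Suc A[of i]] show ?case by simp
    qed
    have "(\<lambda>i. indicator (\<Union>k<i. A k) \<omega> :: real) \<longlonglongrightarrow> indicator (\<Union>i. A i) \<omega>" for \<omega>
      by (rule LIMSEQ_indicator_UN)
    then show "(\<lambda>i. \<integral>\<omega>. \<bar>indicator (\<Union>k<i. A k) \<omega> - indicator (\<Union>i. A i) \<omega> :: real\<bar> \<partial>pi_law) \<longlonglongrightarrow> 0"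
      by (intro dominated_L1(2)[where W = "\<lambda>_. 1"]) (auto intro!: AE_I2 simp: indicator_def)
  qed
  have empty: "bit_limit (indicator {})"
    by (rule bit_limit_fun_lbits[where g = "\<lambda>_. 0" and n = 0]) auto
  show ?thesis
    by (rule sigma_sets_induct_disjoint[OF Int sub A, of "\<lambda>A. bit_limit (indicator A)", OF lev empty compl union])
qed

lemma integrable_bit_limit: "integrable pi_law h \<Longrightarrow> bit_limit h"
proof (induction rule: integrable_induct)
  case (base A c)
  then show ?case using bit_limit_cmult[OF bit_limit_indicator, of A c] by (simp add: mult.commute)
next
  case (add f g)
  then show ?case by (intro bit_limit_add)
next
  case (lim f s)
  show ?case
  proof (rule bit_limit_L1[OF lim(4) lim(5)])
    show "(\<lambda>i. \<integral>\<omega>. \<bar>s i \<omega> - f \<omega>\<bar> \<partial>pi_law) \<longlonglongrightarrow> 0"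
    proof (rule dominated_L1(2))
      show "integrable pi_law (\<lambda>\<omega>. 2 * \<bar>f \<omega>\<bar>)" using lim(4) by simp
    qed (use lim in \<open>auto intro!: AE_I2\<close>)
  qed
qed

text \<open>An L1 approximation has an almost everywhere convergent subsequence. Bounds are wanted
  on all bit strings, including those that no path produces, because
  \<open>approximable_bits\<close> asks for them.\<close>

lemma bounded_bit_sequence:
  assumes h: "integrable pi_law h" and hb: "\<And>\<omega>. c \<le> h \<omega> \<and> h \<omega> \<le> C"
  obtains g :: "nat \<Rightarrow> bool list \<Rightarrow> real" and n :: "nat \<Rightarrow> nat"
  where "\<And>i \<beta>. c \<le> g i \<beta> \<and> g i \<beta> \<le> C" "AE \<omega> in pi_law. (\<lambda>i. g i (lbits (n i) \<omega>)) \<longlonglongrightarrow> h \<omega>"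
proof -
  have "c \<le> C" using hb order.trans by blast
  have "\<exists>n g. integrable pi_law (\<lambda>\<omega>. g (lbits n \<omega>)) \<and> (\<integral>\<omega>. \<bar>h \<omega> - g (lbits n \<omega>)\<bar> \<partial>pi_law) < 1 / real (Suc i)" for i
    using integrable_bit_limit[OF h] unfolding bit_limit_def by simp
  then obtain n g where g: "\<And>i. integrable pi_law (\<lambda>\<omega>. g i (lbits (n i) \<omega>))"
    "\<And>i. (\<integral>\<omega>. \<bar>h \<omega> - g i (lbits (n i) \<omega>)\<bar> \<partial>pi_law) < 1 / real (Suc i)" by metis
  have "(\<lambda>i. \<integral>\<omega>. norm (h \<omega> - g i (lbits (n i) \<omega>)) \<partial>pi_law) \<longlonglongrightarrow> 0"
  proof (rule tendsto_sandwich[OF _ _ tendsto_const LIMSEQ_Suc[OF lim_1_over_n]])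
    show "eventually (\<lambda>i. (\<integral>\<omega>. norm (h \<omega> - g i (lbits (n i) \<omega>)) \<partial>pi_law) \<le> 1 / real (Suc i)) sequentially"
      using g(2) by (intro always_eventually allI less_imp_le) simp
  qed auto
  from tendsto_L1_AE_subseq[OF _ this] h g(1)
  obtain r :: "nat \<Rightarrow> nat" where r: "AE \<omega> in pi_law. (\<lambda>i. h \<omega> - g (r i) (lbits (n (r i)) \<omega>)) \<longlonglongrightarrow> 0"
    by auto
  \<comment> \<open>Clamping enforces the bounds on every string. It is continuous and fixes the
    values of \<open>h\<close>, so the limit is not affected.\<close>
  define g' where "g' i \<beta> = max c (min C (g (r i) \<beta>))" for i \<beta>
  show thesis
  proof
    show "c \<le> g' i \<beta> \<and> g' i \<beta> \<le> C" for i \<beta> using \<open>c \<le> C\<close> by (auto simp: g'_def)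
    show "AE \<omega> in pi_law. (\<lambda>i. g' i (lbits (n (r i)) \<omega>)) \<longlonglongrightarrow> h \<omega>"
      using r
    proof eventually_elim
      case (elim \<omega>)
      then have "(\<lambda>i. h \<omega> - (h \<omega> - g (r i) (lbits (n (r i)) \<omega>))) \<longlonglongrightarrow> h \<omega> - 0" by (intro tendsto_intros)
      then have "(\<lambda>i. max c (min C (g (r i) (lbits (n (r i)) \<omega>)))) \<longlonglongrightarrow> max c (min C (h \<omega>))"
        by (intro tendsto_max tendsto_min tendsto_const) simp
      moreover have "max c (min C (h \<omega>)) = h \<omega>" using hb[of \<omega>] by auto
      ultimately show ?case by (simp add: g'_def)
    qed
  qed
qed

section \<open>Bounded densities and truncation\<close>

lemma integrable_of_powr:
  fixes w :: "path \<Rightarrow> real"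
  assumes [measurable]: "w \<in> borel_measurable Nspace"
    and w: "integrable pi_law (\<lambda>\<omega>. \<bar>w \<omega>\<bar> powr r)" and r: "1 < r"
  shows "integrable pi_law w"
proof (rule Bochner_Integration.integrable_bound)
  show "integrable pi_law (\<lambda>\<omega>. 1 + \<bar>w \<omega>\<bar> powr r)" using w by simp
  have "\<bar>x\<bar> \<le> 1 + \<bar>x\<bar> powr r" for x :: real
  proof (cases "\<bar>x\<bar> \<le> 1")
    case False
    then have "\<bar>x\<bar> powr 1 \<le> \<bar>x\<bar> powr r" using r by (intro powr_mono) auto
    then show ?thesis by simp
  qed (simp add: add_increasing2)
  then show "AE \<omega> in pi_law. norm (w \<omega>) \<le> norm (1 + \<bar>w \<omega>\<bar> powr r)"
    by (intro AE_I2) (smt (verit) real_norm_def)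
qed simp

text \<open>Bit functions bounded between c and C have integrals in the same range, so after
  normalisation they lie between \<open>1 / K\<close> and \<open>K\<close> with
  \<open>K = C / c\<close>. This bounds the entropy term by \<open>K * ln K\<close> and the other
  product by \<open>K * \<bar>w \<omega>\<bar>\<close>.\<close>

lemma approximable_bounded:
  assumes [measurable]: "Z \<in> borel_measurable Nspace" and Z: "\<And>\<omega>. c \<le> Z \<omega> \<and> Z \<omega> \<le> C" and c: "0 < c"
    and [measurable]: "w \<in> borel_measurable Nspace"
    and w: "integrable pi_law (\<lambda>\<omega>. \<bar>w \<omega>\<bar> powr r)" and r: "1 < r"
  shows "approximable w (\<lambda>\<omega>. Z \<omega> / (\<integral>\<omega>. Z \<omega> \<partial>pi_law))"
proof -
  have intb: "integrable pi_law F \<and> c \<le> (\<integral>\<omega>. F \<omega> \<partial>pi_law) \<and> (\<integral>\<omega>. F \<omega> \<partial>pi_law) \<le> C"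
    if [measurable]: "F \<in> borel_measurable Nspace" and F: "\<And>\<omega>. c \<le> F \<omega> \<and> F \<omega> \<le> C" for F :: "path \<Rightarrow> real"
  proof (intro conjI)
    show i: "integrable pi_law F"
    proof (rule pi.integrable_const_bound[where B = C])
      show "AE \<omega> in pi_law. norm (F \<omega>) \<le> C"
      proof (rule AE_I2)
        fix \<omega> show "norm (F \<omega>) \<le> C" using F[of \<omega>] c by simp
      qed
    qed simp
    show "c \<le> (\<integral>\<omega>. F \<omega> \<partial>pi_law)"
      by (rule pi.integral_ge_const[OF i]) (rule AE_I2, rule conjunct1[OF F])
    show "(\<integral>\<omega>. F \<omega> \<partial>pi_law) \<le> C"
      by (rule pi.integral_le_const[OF i]) (rule AE_I2, rule conjunct2[OF F])
  qed
  obtain g :: "nat \<Rightarrow> bool list \<Rightarrow> real" and n :: "nat \<Rightarrow> nat"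
    where g: "\<And>i \<beta>. c \<le> g i \<beta> \<and> g i \<beta> \<le> C" and lim: "AE \<omega> in pi_law. (\<lambda>i. g i (lbits (n i) \<omega>)) \<longlonglongrightarrow> Z \<omega>"
  proof (rule bounded_bit_sequence[where h = Z and c = c and C = C, OF conjunct1[OF intb[OF assms(1) Z]] Z])
    fix g :: "nat \<Rightarrow> bool list \<Rightarrow> real" and n :: "nat \<Rightarrow> nat"
    assume "\<And>i \<beta>. c \<le> g i \<beta> \<and> g i \<beta> \<le> C" "AE \<omega> in pi_law. (\<lambda>i. g i (lbits (n i) \<omega>)) \<longlonglongrightarrow> Z \<omega>"
    then show thesis by (rule that)
  qed
  define F where "F i \<omega> = g i (lbits (n i) \<omega>)" for i \<omega>
  define e where "e i = (\<integral>\<omega>. F i \<omega> \<partial>pi_law)" for i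
  define K where "K = C / c"
  have [measurable]: "F i \<in> borel_measurable Nspace" for i unfolding F_def by measurable
  have Fb: "c \<le> F i \<omega> \<and> F i \<omega> \<le> C" for i \<omega> using g by (simp add: F_def)
  have eb: "c \<le> e i \<and> e i \<le> C" for i unfolding e_def using intb[of "F i"] Fb by simp
  have cC: "c \<le> C" using eb order.trans by blast
  have K: "1 \<le> K" using cC c by (simp add: K_def)
  have e_lim: "e \<longlonglongrightarrow> (\<integral>\<omega>. Z \<omega> \<partial>pi_law)"
    unfolding e_def
  proof (rule integral_dominated_convergence[where w = "\<lambda>_. C"])
    show "AE \<omega> in pi_law. norm (F i \<omega>) \<le> C" for i
    proof (rule AE_I2)
      fix \<omega> show "norm (F i \<omega>) \<le> C" using Fb[of i \<omega>] c by simp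
    qed
  qed (use lim in \<open>auto simp: F_def\<close>)
  have EZ: "0 < (\<integral>\<omega>. Z \<omega> \<partial>pi_law)" using intb[of Z] Z c by force
  have q: "1 / K \<le> F i \<omega> / e i \<and> F i \<omega> / e i \<le> K" for i \<omega>
    using Fb[of i \<omega>] eb[of i] c cC by (auto simp: K_def intro!: frac_le)
  show ?thesis
  proof (rule approximable_limit[where Zn = "\<lambda>i \<omega>. F i \<omega> / e i" and W = "\<lambda>\<omega>. K * ln K + K * \<bar>w \<omega>\<bar>"])
    show "integrable pi_law (\<lambda>\<omega>. K * ln K + K * \<bar>w \<omega>\<bar>)"
      using integrable_of_powr[OF _ w r] by simp
    show "AE \<omega> in pi_law. (\<lambda>i. F i \<omega> / e i) \<longlonglongrightarrow> Z \<omega> / (\<integral>\<omega>. Z \<omega> \<partial>pi_law)"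
      using lim unfolding F_def[symmetric] by eventually_elim (use EZ in \<open>intro tendsto_divide e_lim, auto\<close>)
    show "AE \<omega> in pi_law. 0 < Z \<omega> / (\<integral>\<omega>. Z \<omega> \<partial>pi_law)"
      using EZ Z c by (intro AE_I2 divide_pos_pos) (auto intro: less_le_trans)
    show "AE \<omega> in pi_law. \<bar>F i \<omega> / e i * ln (F i \<omega> / e i)\<bar> \<le> K * ln K + K * \<bar>w \<omega>\<bar>" for i
    proof (rule AE_I2)
      fix \<omega>
      define x where "x = F i \<omega> / e i"
      have x: "0 < x" "1 / K \<le> x" "x \<le> K" using q[of i \<omega>] Fb[of i \<omega>] eb[of i] c by (auto simp: x_def)
      have "\<bar>ln x\<bar> \<le> ln K"
        using x K ln_le_cancel_iff[of "1 / K" x] ln_le_cancel_iff[of x K] by (auto simp: ln_div abs_le_iff)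
      then have "x * \<bar>ln x\<bar> \<le> K * ln K" using x K by (intro mult_mono) auto
      moreover have "0 \<le> K * \<bar>w \<omega>\<bar>" using K by simp
      ultimately show "\<bar>F i \<omega> / e i * ln (F i \<omega> / e i)\<bar> \<le> K * ln K + K * \<bar>w \<omega>\<bar>"
        unfolding x_def[symmetric] using x(1) by (simp add: abs_mult)
    qed
    show "AE \<omega> in pi_law. \<bar>F i \<omega> / e i * w \<omega>\<bar> \<le> K * ln K + K * \<bar>w \<omega>\<bar>" for i
    proof (rule AE_I2)
      fix \<omega>
      have "0 < F i \<omega> / e i" using Fb[of i \<omega>] eb[of i] c by (intro divide_pos_pos) auto
      then have "\<bar>F i \<omega> / e i * w \<omega>\<bar> \<le> K * \<bar>w \<omega>\<bar>"
        using q[of i \<omega>] unfolding abs_mult by (intro mult_right_mono) auto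
      moreover have "0 \<le> K * ln K" using K by simp
      ultimately show "\<bar>F i \<omega> / e i * w \<omega>\<bar> \<le> K * ln K + K * \<bar>w \<omega>\<bar>" by simp
    qed
    show "approximable w (\<lambda>\<omega>. F i \<omega> / e i)" for i
      unfolding e_def F_def lbits_def using approximable_bits[OF _ _ c _ w r, of "1 / 2 ^ n i" "g i" C "4 ^ n i"] g by simp
  qed measurable
qed

text \<open>Above the upper cut, \<open>x * ln x\<close> is increasing and nonnegative. At the lower
  cut the value is \<open>ln m / m\<close> in absolute value, which the added 1 absorbs.\<close>

lemma abs_truncate_ln_le:
  fixes x m :: real
  assumes "0 < x" "1 \<le> m"
  defines "z \<equiv> max (1 / m) (min m x)"
  shows "\<bar>z * ln z\<bar> \<le> \<bar>x * ln x\<bar> + 1"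
proof -
  have m: "1 / m \<le> m" using assms(2) mult_mono[of 1 m 1 m] by (simp add: divide_le_eq)
  consider "z = x" | "z = m" "m \<le> x" | "z = 1 / m"
    using m unfolding z_def by (cases "m \<le> x"; cases "1 / m \<le> x") (auto simp: max_def min_def)
  then show ?thesis
  proof cases
    case 2
    then have "m * ln m \<le> x * ln x" using assms by (intro mult_mono) auto
    moreover have "0 \<le> m * ln m" using assms by simp
    ultimately show ?thesis using 2 by simp
  next
    case 3
    have "ln m \<le> m" using assms ln_le_minus_one[of m] by linarith
    then have "\<bar>z * ln z\<bar> \<le> 1" using assms 3 by (simp add: ln_div abs_mult divide_le_eq)
    then show ?thesis by simp
  qed simp
qed

text \<open>Truncation from above and from below gives bounded densities after renormalisation; the
  second factor remains the logarithm of the untruncated \<open>L\<close> throughout.\<close>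

lemma approximable_density:
  assumes [measurable]: "L \<in> borel_measurable Nspace" and L0: "AE \<omega> in pi_law. 0 < L \<omega>"
    and L: "integrable pi_law L" "(\<integral>\<omega>. L \<omega> \<partial>pi_law) = 1"
    and ent: "integrable pi_law (\<lambda>\<omega>. L \<omega> * ln (L \<omega>))"
    and w: "integrable pi_law (\<lambda>\<omega>. \<bar>ln (L \<omega>)\<bar> powr r)" and r: "1 < r"
  shows "approximable (\<lambda>\<omega>. ln (L \<omega>)) L"
proof -
  define Z where "Z n \<omega> = max (1 / real (Suc n)) (min (real (Suc n)) (L \<omega>))" for n \<omega>
  define e where "e n = (\<integral>\<omega>. Z n \<omega> \<partial>pi_law)" for n
  have [measurable]: "Z n \<in> borel_measurable Nspace" for n unfolding Z_def by measurable
  have inv1: "1 / real (Suc n) \<le> 1" for n by simp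
  have Zb: "1 / real (Suc n) \<le> Z n \<omega> \<and> Z n \<omega> \<le> real (Suc n)" for n \<omega>
  proof -
    have "1 / real (Suc n) \<le> real (Suc n)" by (rule order.trans[OF inv1]) simp
    then show ?thesis unfolding Z_def by (auto simp del: of_nat_Suc)
  qed
  have Zpos: "0 < Z n \<omega>" for n \<omega>
    by (rule less_le_trans[OF _ conjunct1[OF Zb]]) simp
  have ZL: "Z n \<omega> \<le> L \<omega> + 1" if "0 < L \<omega>" for n \<omega>
    using inv1[of n] that unfolding Z_def by linarith
  have Zlim: "(\<lambda>n. Z n \<omega>) \<longlonglongrightarrow> L \<omega>" if "0 < L \<omega>" for \<omega>
  proof (rule tendsto_eventually)
    obtain N :: nat where N: "max (L \<omega>) (1 / L \<omega>) < real N" using reals_Archimedean2 by blast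
    have "Z n \<omega> = L \<omega>" if "N \<le> n" for n
    proof -
      have n: "L \<omega> \<le> real (Suc n)" "1 / L \<omega> \<le> real (Suc n)" using N that by auto
      then have "1 / real (Suc n) \<le> L \<omega>" using \<open>0 < L \<omega>\<close> by (simp add: field_simps)
      then show ?thesis using n by (simp add: Z_def)
    qed
    then show "eventually (\<lambda>n. Z n \<omega> = L \<omega>) sequentially" by (auto simp: eventually_sequentially)
  qed
  have e_lim: "e \<longlonglongrightarrow> 1"
    unfolding L(2)[symmetric] e_def
  proof (rule integral_dominated_convergence[where w = "\<lambda>\<omega>. L \<omega> + 1"])
    show "AE \<omega> in pi_law. (\<lambda>n. Z n \<omega>) \<longlonglongrightarrow> L \<omega>" using L0 by eventually_elim (rule Zlim)
    show "AE \<omega> in pi_law. norm (Z n \<omega>) \<le> L \<omega> + 1" for n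
      using L0 by eventually_elim (use ZL Zpos in \<open>auto simp: abs_of_pos\<close>)
  qed (use L in auto)
  \<comment> \<open>The normalising constants tend to 1. Shifting the index by \<open>N\<close>
    keeps them between 1/2 and 2, so that division costs at most a factor 2 and their logarithm at
    most \<open>ln 2\<close>.\<close>
  have "eventually (\<lambda>n. 1 / 2 < e n \<and> e n < 2) sequentially"
    by (intro eventually_conj order_tendstoD[OF e_lim]) auto
  then obtain N where N: "\<And>n. N \<le> n \<Longrightarrow> 1 / 2 < e n \<and> e n < 2" by (auto simp: eventually_sequentially)
  \<comment> \<open>The first two summands bound the entropy of the normalised truncation, with
    \<open>ln 2\<close> coming from the normalising constant. The last is twice
    \<open>(L \<omega> + 1) * \<bar>ln (L \<omega>)\<bar>\<close> where \<open>L \<omega>\<close> is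
    positive, and it bounds the product with \<open>ln L\<close>.\<close>
  define W where "W \<omega> = 2 * (\<bar>L \<omega> * ln (L \<omega>)\<bar> + 1) + 2 * ln 2 * (L \<omega> + 1) + 2 * (\<bar>L \<omega> * ln (L \<omega>)\<bar> + \<bar>ln (L \<omega>)\<bar>)" for \<omega>
  have wi: "integrable pi_law (\<lambda>\<omega>. ln (L \<omega>))" by (rule integrable_of_powr[OF _ w r]) measurable
  show ?thesis
  proof (rule approximable_limit[where Zn = "\<lambda>n \<omega>. Z (n + N) \<omega> / e (n + N)" and W = W])
    show "integrable pi_law W" unfolding W_def using ent wi L by simp
    show "AE \<omega> in pi_law. (\<lambda>n. Z (n + N) \<omega> / e (n + N)) \<longlonglongrightarrow> L \<omega>"
      using L0
    proof eventually_elim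
      case (elim \<omega>)
      have "(\<lambda>n. Z n \<omega> / e n) \<longlonglongrightarrow> L \<omega> / 1" by (intro tendsto_divide Zlim elim e_lim) simp
      then show ?case using LIMSEQ_ignore_initial_segment by fastforce
    qed
    show "AE \<omega> in pi_law. \<bar>Z (n + N) \<omega> / e (n + N) * ln (Z (n + N) \<omega> / e (n + N))\<bar> \<le> W \<omega>" for n
      using L0
    proof eventually_elim
      case (elim \<omega>)
      define z E where "z = Z (n + N) \<omega>" and "E = e (n + N)"
      have z: "0 < z" "z \<le> L \<omega> + 1" "\<bar>z * ln z\<bar> \<le> \<bar>L \<omega> * ln (L \<omega>)\<bar> + 1"
        unfolding z_def by (rule Zpos, rule ZL[OF elim], unfold Z_def, rule abs_truncate_ln_le[OF elim]) simp
      have E: "1 / 2 < E" "E < 2" using N[of "n + N"] by (auto simp: E_def)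
      have "\<bar>ln E\<bar> \<le> ln 2"
        using E ln_le_cancel_iff[of "1 / 2" E] ln_le_cancel_iff[of E 2] by (auto simp: ln_div abs_le_iff)
      then have "z * \<bar>ln E\<bar> \<le> (L \<omega> + 1) * ln 2" using z by (intro mult_mono) auto
      then have b: "\<bar>z * ln z - z * ln E\<bar> \<le> (\<bar>L \<omega> * ln (L \<omega>)\<bar> + 1) + ln 2 * (L \<omega> + 1)"
        using z abs_triangle_ineq4[of "z * ln z" "z * ln E"] by (simp add: abs_mult mult.commute)
      have "z / E * ln (z / E) = (z * ln z - z * ln E) * (1 / E)"
        using z E by (simp add: ln_div field_simps)
      then have "\<bar>z / E * ln (z / E)\<bar> = \<bar>z * ln z - z * ln E\<bar> * (1 / E)" using E by (simp add: abs_mult)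
      also have "\<dots> \<le> ((\<bar>L \<omega> * ln (L \<omega>)\<bar> + 1) + ln 2 * (L \<omega> + 1)) * 2"
        using E b by (intro mult_mono) (auto simp: divide_le_eq)
      also have "\<dots> \<le> W \<omega>" by (simp add: W_def algebra_simps)
      finally show ?case by (simp add: z_def E_def)
    qed
    show "AE \<omega> in pi_law. \<bar>Z (n + N) \<omega> / e (n + N) * ln (L \<omega>)\<bar> \<le> W \<omega>" for n
      using L0
    proof eventually_elim
      case (elim \<omega>)
      have E: "1 / 2 < e (n + N)" using N[of "n + N"] by auto
      have "\<bar>Z (n + N) \<omega> / e (n + N) * ln (L \<omega>)\<bar> = (Z (n + N) \<omega> * (1 / e (n + N))) * \<bar>ln (L \<omega>)\<bar>"
        using Zpos[of "n + N" \<omega>] E by (simp add: abs_mult)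
      also have "\<dots> \<le> ((L \<omega> + 1) * 2) * \<bar>ln (L \<omega>)\<bar>"
        using ZL[OF elim, of "n + N"] E elim Zpos[of "n + N" \<omega>]
        by (intro mult_right_mono mult_mono) (auto simp: divide_le_eq)
      also have "\<dots> = 2 * (\<bar>L \<omega> * ln (L \<omega>)\<bar> + \<bar>ln (L \<omega>)\<bar>)" using elim by (simp add: abs_mult algebra_simps)
      also have "\<dots> \<le> W \<omega>" using elim by (simp add: W_def)
      finally show ?case .
    qed
    show "approximable (\<lambda>\<omega>. ln (L \<omega>)) (\<lambda>\<omega>. Z (n + N) \<omega> / e (n + N))" for n
      unfolding e_def by (rule approximable_bounded[OF _ Zb _ _ w r]) auto
  qed (use L0 in measurable)
qed

section \<open>Radon-Nikodym densities and the conclusion\<close>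

lemma measurable_dens [measurable]: "dens pi_law Q \<in> borel_measurable Nspace"
proof -
  have "dens pi_law Q \<in> borel_measurable pi_law" unfolding dens_def[abs_def] by measurable
  then show ?thesis by simp
qed

lemma dens_density:
  assumes [measurable]: "L \<in> borel_measurable Nspace" and L: "\<And>\<omega>. 0 \<le> L \<omega>"
  shows "AE \<omega> in pi_law. dens pi_law (density pi_law (\<lambda>\<omega>. ennreal (L \<omega>))) \<omega> = L \<omega>"
proof -
  have "AE \<omega> in pi_law. ennreal (L \<omega>) = RN_deriv pi_law (density pi_law (\<lambda>\<omega>. ennreal (L \<omega>))) \<omega>"
    by (rule pi.RN_deriv_unique) auto
  then show ?thesis
  proof eventually_elim
    case (elim \<omega>)
    show ?case unfolding dens_def elim[symmetric] using L by simp
  qed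
qed

lemma integral_dens:
  assumes "prob_space nu" and sets: "sets nu = sets Nspace" and ac: "absolutely_continuous pi_law nu"
  shows "integrable pi_law (dens pi_law nu)" "(\<integral>\<omega>. dens pi_law nu \<omega> \<partial>pi_law) = 1"
proof -
  interpret nu: prob_space nu by fact
  have sets': "sets nu = sets pi_law" using sets by simp
  have fin: "AE \<omega> in pi_law. RN_deriv pi_law nu \<omega> \<noteq> \<infinity>"
    by (rule pi.RN_deriv_finite[OF nu.sigma_finite_measure_axioms ac sets'])
  have "(\<integral>\<^sup>+\<omega>. ennreal (dens pi_law nu \<omega>) \<partial>pi_law) = (\<integral>\<^sup>+\<omega>. RN_deriv pi_law nu \<omega> * indicator (space pi_law) \<omega> \<partial>pi_law)"
    using fin by (intro nn_integral_cong_AE) (auto simp: dens_def less_top)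
  also have "\<dots> = emeasure (density pi_law (RN_deriv pi_law nu)) (space pi_law)"
    by (rule emeasure_density[symmetric]) auto
  also have "density pi_law (RN_deriv pi_law nu) = nu"
    by (rule pi.density_RN_deriv[OF ac sets'])
  also have "emeasure nu (space pi_law) = 1"
    using nu.emeasure_space_1 sets_eq_imp_space_eq[OF sets'] by simp
  finally have 1: "(\<integral>\<^sup>+\<omega>. ennreal (dens pi_law nu \<omega>) \<partial>pi_law) = 1" .
  have nn: "0 \<le> dens pi_law nu \<omega>" for \<omega> by (simp add: dens_def)
  show "integrable pi_law (dens pi_law nu)" using 1 nn by (intro integrableI_nonneg) auto
  show "(\<integral>\<omega>. dens pi_law nu \<omega> \<partial>pi_law) = 1" using 1 nn by (subst integral_eq_nn_integral) auto
qed

theorem mainTheorem15: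
  fixes nu :: "path measure" and r :: real
  assumes "prob_space nu" and "sets nu = sets Nspace"
    and "absolutely_continuous pi_law nu"
    and "integrable pi_law (\<lambda>\<omega>. dens pi_law nu \<omega> * ln (dens pi_law nu \<omega>))"
    and "1 < r"
    and "AE \<omega> in pi_law. 0 < dens pi_law nu \<omega>"
    and "integrable pi_law (\<lambda>\<omega>. \<bar>ln (dens pi_law nu \<omega>)\<bar> powr r)"
  shows "\<exists>ydot :: nat \<Rightarrow> path \<Rightarrow> real \<Rightarrow> real.
    (\<forall>n. Ppp (ydot n)
       \<and> Ymap (ydot n) \<in> Nspace \<rightarrow>\<^sub>M Nspace
       \<and> absolutely_continuous pi_law (distr pi_law Nspace (Ymap (ydot n)))
       \<and> integrable pi_law (\<lambda>\<omega>. dens pi_law (distr pi_law Nspace (Ymap (ydot n))) \<omega>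
                              * ln (dens pi_law (distr pi_law Nspace (Ymap (ydot n))) \<omega>))
       \<and> integrable pi_law (\<lambda>\<omega>. dens pi_law (distr pi_law Nspace (Ymap (ydot n))) \<omega>
                              * ln (dens pi_law nu \<omega>)))
    \<and> (\<lambda>n. \<integral>\<omega>. \<bar>dens pi_law (distr pi_law Nspace (Ymap (ydot n))) \<omega>
                   * ln (dens pi_law (distr pi_law Nspace (Ymap (ydot n))) \<omega>)
                 - dens pi_law nu \<omega> * ln (dens pi_law nu \<omega>)\<bar> \<partial>pi_law) \<longlonglongrightarrow> 0
    \<and> (\<lambda>n. \<integral>\<omega>. \<bar>dens pi_law (distr pi_law Nspace (Ymap (ydot n))) \<omega>
                   * ln (dens pi_law nu \<omega>)
                 - dens pi_law nu \<omega> * ln (dens pi_law nu \<omega>)\<bar> \<partial>pi_law) \<longlonglongrightarrow> 0"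
proof -
  define L where "L = dens pi_law nu"
  define w where "w \<omega> = ln (L \<omega>)" for \<omega>
  have [measurable]: "L \<in> borel_measurable Nspace" "w \<in> borel_measurable Nspace"
    unfolding w_def L_def by measurable
  have "approximable w L"
    unfolding w_def
    by (rule approximable_density[OF _ _ _ _ _ _ assms(5)])
      (unfold L_def, (rule measurable_dens assms(6) integral_dens[OF assms(1-3)] assms(4) assms(7))+)
  then have ex: "\<exists>X. realizable w X \<and> (\<integral>\<omega>. \<bar>X \<omega> * ln (X \<omega>) - L \<omega> * ln (L \<omega>)\<bar> \<partial>pi_law) < 1 / real (Suc n)
      \<and> (\<integral>\<omega>. \<bar>X \<omega> * w \<omega> - L \<omega> * w \<omega>\<bar> \<partial>pi_law) < 1 / real (Suc n)" for n
    unfolding approximable_def by simp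
  define X where "X n = (SOME X. realizable w X \<and> (\<integral>\<omega>. \<bar>X \<omega> * ln (X \<omega>) - L \<omega> * ln (L \<omega>)\<bar> \<partial>pi_law) < 1 / real (Suc n)
      \<and> (\<integral>\<omega>. \<bar>X \<omega> * w \<omega> - L \<omega> * w \<omega>\<bar> \<partial>pi_law) < 1 / real (Suc n))" for n
  have X: "realizable w (X n)"
    and X1: "(\<integral>\<omega>. \<bar>X n \<omega> * ln (X n \<omega>) - L \<omega> * ln (L \<omega>)\<bar> \<partial>pi_law) < 1 / real (Suc n)"
    and X2: "(\<integral>\<omega>. \<bar>X n \<omega> * w \<omega> - L \<omega> * w \<omega>\<bar> \<partial>pi_law) < 1 / real (Suc n)" for n
    using someI_ex[OF ex[of n]] unfolding X_def[symmetric] by blast+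
  have [measurable]: "X n \<in> borel_measurable Nspace" for n
    using X[of n] by (simp add: realizable_def)
  have "\<forall>n. \<exists>ydot. Ppp ydot \<and> Ymap ydot \<in> Nspace \<rightarrow>\<^sub>M Nspace
      \<and> distr pi_law Nspace (Ymap ydot) = density pi_law (\<lambda>\<omega>. ennreal (X n \<omega>))"
    using X by (simp add: realizable_def)
  from choice[OF this] obtain ydot where Y: "\<And>n. Ppp (ydot n)" "\<And>n. Ymap (ydot n) \<in> Nspace \<rightarrow>\<^sub>M Nspace"
    "\<And>n. distr pi_law Nspace (Ymap (ydot n)) = density pi_law (\<lambda>\<omega>. ennreal (X n \<omega>))" by blast
  \<comment> \<open>\<open>X n\<close> is an explicit version of the density, while
    \<open>D n\<close> is the version selected by \<open>RN_deriv\<close>. They agree only almost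
    everywhere, so integrability and distances are transferred through almost sure equality.\<close>
  define D where "D n = dens pi_law (distr pi_law Nspace (Ymap (ydot n)))" for n
  have [measurable]: "D n \<in> borel_measurable Nspace" for n unfolding D_def by measurable
  have D: "AE \<omega> in pi_law. D n \<omega> = X n \<omega>" for n
    unfolding D_def Y(3) by (rule dens_density) (use X[of n] in \<open>simp_all add: realizable_def\<close>)
  have ac: "absolutely_continuous pi_law (distr pi_law Nspace (Ymap (ydot n)))" for n
    unfolding Y(3) by (rule absolutely_continuousI_density) simp
  have i1: "integrable pi_law (\<lambda>\<omega>. D n \<omega> * ln (D n \<omega>))" for n
  proof (subst integrable_cong_AE)
    show "AE \<omega> in pi_law. D n \<omega> * ln (D n \<omega>) = X n \<omega> * ln (X n \<omega>)" using D[of n] by eventually_elim simp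
    show "integrable pi_law (\<lambda>\<omega>. X n \<omega> * ln (X n \<omega>))" using X[of n] by (simp add: realizable_def)
  qed simp_all
  have i2: "integrable pi_law (\<lambda>\<omega>. D n \<omega> * w \<omega>)" for n
  proof (subst integrable_cong_AE)
    show "AE \<omega> in pi_law. D n \<omega> * w \<omega> = X n \<omega> * w \<omega>" using D[of n] by eventually_elim simp
    show "integrable pi_law (\<lambda>\<omega>. X n \<omega> * w \<omega>)" using X[of n] by (simp add: realizable_def)
  qed simp_all
  have d1: "(\<integral>\<omega>. \<bar>D n \<omega> * ln (D n \<omega>) - L \<omega> * ln (L \<omega>)\<bar> \<partial>pi_law) < 1 / real (Suc n)" for n
  proof -
    have "(\<integral>\<omega>. \<bar>D n \<omega> * ln (D n \<omega>) - L \<omega> * ln (L \<omega>)\<bar> \<partial>pi_law)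
        = (\<integral>\<omega>. \<bar>X n \<omega> * ln (X n \<omega>) - L \<omega> * ln (L \<omega>)\<bar> \<partial>pi_law)"
    proof (rule integral_cong_AE)
      show "AE \<omega> in pi_law. \<bar>D n \<omega> * ln (D n \<omega>) - L \<omega> * ln (L \<omega>)\<bar> = \<bar>X n \<omega> * ln (X n \<omega>) - L \<omega> * ln (L \<omega>)\<bar>"
        using D[of n] by eventually_elim simp
    qed simp_all
    then show ?thesis using X1[of n] by simp
  qed
  have d2: "(\<integral>\<omega>. \<bar>D n \<omega> * w \<omega> - L \<omega> * w \<omega>\<bar> \<partial>pi_law) < 1 / real (Suc n)" for n
  proof -
    have "(\<integral>\<omega>. \<bar>D n \<omega> * w \<omega> - L \<omega> * w \<omega>\<bar> \<partial>pi_law) = (\<integral>\<omega>. \<bar>X n \<omega> * w \<omega> - L \<omega> * w \<omega>\<bar> \<partial>pi_law)"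
    proof (rule integral_cong_AE)
      show "AE \<omega> in pi_law. \<bar>D n \<omega> * w \<omega> - L \<omega> * w \<omega>\<bar> = \<bar>X n \<omega> * w \<omega> - L \<omega> * w \<omega>\<bar>"
        using D[of n] by eventually_elim simp
    qed simp_all
    then show ?thesis using X2[of n] by simp
  qed
  have to_0: "a \<longlonglongrightarrow> 0" if "\<And>n. 0 \<le> a n" "\<And>n. a n < 1 / real (Suc n)" for a :: "nat \<Rightarrow> real"
    by (rule tendsto_sandwich[OF _ _ tendsto_const LIMSEQ_Suc[OF lim_1_over_n]])
      (intro always_eventually allI that(1), intro always_eventually allI less_imp_le that(2))
  show ?thesis
    by (rule exI[of _ ydot], unfold D_def[symmetric] L_def[symmetric] w_def[symmetric])
      (intro conjI allI Y ac i1 i2 to_0 d1[folded w_def] d2 integral_nonneg_AE AE_I2 abs_ge_zero)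
qed

end
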